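(* Let $n\ge 1$, $d\ge 1$ and $g$ be integers with $0<g\le 8$ and $d\ge \max(n,2g-2)$. Let $M^n_d$ be the space of nondegenerate morphisms $f:\mathbb{P}^1\to\mathbb{P}^n$ of degree $d$ over $\mathbb{C}$, and let $M^n_{d,g}\subset M^n_d$ be the subvariety of those morphisms whose image curve $f(\mathbb{P}^1)$ has arithmetic genus $g$. Let $\mathcal{V}\subset M^n_{d,g}$ be the subvariety consisting of those morphisms whose image has at worst unibranch singularities (i.e. every singular point of $f(\mathbb{P}^1)$ has a single branch). Then \[ \operatorname{cod}(\mathcal{V},M^n_d)\ \ge\ (n-2)g . \]
   Context: Work over $\mathbb{C}$. A morphism $f=(f_0,\dots,f_n):\mathbb{P}^1\to\mathbb{P}^n$ of degree $d$ is given by homogeneous polynomials $f_i=a_{i,0}t^d+a_{i,1}t^{d-1}u+\dots+a_{i,d}u^d$ of degree $d$ in homogeneous coordinates $t,u$ on $\mathbb{P}^1$, and is identified with its tuple of coefficients $(a_{i,j})$; nondegenerate means the image is not contained in a hyperplane. Thus $M^n_d$ is a space of frames over the Grassmannian of $(n+1)$-dimensional subspaces of $H^0(\mathcal{O}_{\mathbb{P}^1}(d))$. The arithmetic genus of the rational image curve $C=f(\mathbb{P}^1)$ is $g=\sum_{P\in C}\delta_P$, where $\delta_P$ is the delta-invariant of $C$ at $P$; for a unibranch singular point $P$ with value semigroup $\mathrm{S}\subset\mathbb{N}$ (the set of valuations $v(\phi(h))$ of elements $h$ of the local ring under the normalization map to $\mathbb{C}[[t]]$), $\delta_P=\#(\mathbb{N}\setminus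 \mathrm{S})$. *)

theory Defs
  imports "HOL-Computational_Algebra.Formal_Power_Series"
begin

inductive_set polyfun :: "(('i \<Rightarrow> complex) \<Rightarrow> complex) set" where
  pf_const: "(\<lambda>x. c) \<in> polyfun"
| pf_coord: "(\<lambda>x. x i) \<in> polyfun"
| pf_add: "p \<in> polyfun \<Longrightarrow> q \<in> polyfun \<Longrightarrow> (\<lambda>x. p x + q x) \<in> polyfun"
| pf_mult: "p \<in> polyfun \<Longrightarrow> q \<in> polyfun \<Longrightarrow> (\<lambda>x. p x * q x) \<in> polyfun"

definition zariski_closed :: "('i \<Rightarrow> complex) set \<Rightarrow> bool" where
  "zariski_closed S \<longleftrightarrow> (\<exists>F \<subseteq> polyfun. S = {x. \<forall>p\<in>F. p x = 0})"

definition zclosure :: "('i \<Rightarrow> complex) set \<Rightarrow> ('i \<Rightarrow> complex) set" where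
  "zclosure S = \<Inter> {Z. zariski_closed Z \<and> S \<subseteq> Z}"

definition zirreducible :: "('i \<Rightarrow> complex) set \<Rightarrow> bool" where
  "zirreducible Z \<longleftrightarrow> zariski_closed Z \<and> Z \<noteq> {} \<and>
     (\<forall>A B. zariski_closed A \<longrightarrow> zariski_closed B \<longrightarrow> Z \<subseteq> A \<union> B \<longrightarrow> Z \<subseteq> A \<or> Z \<subseteq> B)"

definition zdim :: "('i \<Rightarrow> complex) set \<Rightarrow> int" where
  "zdim S = (if S = {} then -1 else int (Sup {k. \<exists>Z :: nat \<Rightarrow> ('i \<Rightarrow> complex) set.
       (\<forall>i\<le>k. zirreducible (Z i)) \<and> (\<forall>i<k. Z i \<subset> Z (Suc i)) \<and> Z k \<subseteq> zclosure S}))"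

type_synonym coeffs = "nat \<times> nat \<Rightarrow> complex"

definition hom_eval :: "coeffs \<Rightarrow> nat \<Rightarrow> nat \<Rightarrow> complex \<times> complex \<Rightarrow> complex" where
  "hom_eval a d i p = (\<Sum>j\<le>d. a (i,j) * fst p ^ (d - j) * snd p ^ j)"

definition is_morphism :: "nat \<Rightarrow> nat \<Rightarrow> coeffs \<Rightarrow> bool" where
  "is_morphism n d a \<longleftrightarrow> (\<forall>i j. (n < i \<or> d < j) \<longrightarrow> a (i,j) = 0) \<and>
     (\<forall>p. p \<noteq> (0,0) \<longrightarrow> (\<exists>i\<le>n. hom_eval a d i p \<noteq> 0))"

definition nondegenerate :: "nat \<Rightarrow> nat \<Rightarrow> coeffs \<Rightarrow> bool" where
  "nondegenerate n d a \<longleftrightarrow> (\<forall>c :: nat \<Rightarrow> complex.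
     (\<forall>p. (\<Sum>i\<le>n. c i * hom_eval a d i p) = 0) \<longrightarrow> (\<forall>i\<le>n. c i = 0))"

definition Mnd :: "nat \<Rightarrow> nat \<Rightarrow> coeffs set" where
  "Mnd n d = {a. is_morphism n d a \<and> nondegenerate n d a}"

definition proportional :: "nat \<Rightarrow> (nat \<Rightarrow> complex) \<Rightarrow> (nat \<Rightarrow> complex) \<Rightarrow> bool" where
  "proportional n x y \<longleftrightarrow> (\<exists>c. c \<noteq> 0 \<and> (\<forall>i\<le>n. x i = c * y i))"

definition same_image :: "nat \<Rightarrow> nat \<Rightarrow> coeffs \<Rightarrow> nat \<Rightarrow> coeffs \<Rightarrow> bool" where
  "same_image n d a e b \<longleftrightarrow>
     (\<forall>p. p \<noteq> (0,0) \<longrightarrow> (\<exists>q. q \<noteq> (0,0) \<and> proportional n (\<lambda>i. hom_eval a d i p) (\<lambda>i. hom_eval b e i q))) \<and>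
     (\<forall>q. q \<noteq> (0,0) \<longrightarrow> (\<exists>p. p \<noteq> (0,0) \<and> proportional n (\<lambda>i. hom_eval a d i p) (\<lambda>i. hom_eval b e i q)))"

definition injective_morphism :: "nat \<Rightarrow> nat \<Rightarrow> coeffs \<Rightarrow> bool" where
  "injective_morphism n e b \<longleftrightarrow> (\<forall>p q. p \<noteq> (0,0) \<longrightarrow> q \<noteq> (0,0) \<longrightarrow>
     proportional n (\<lambda>i. hom_eval b e i p) (\<lambda>i. hom_eval b e i q) \<longrightarrow>
     (\<exists>c. c \<noteq> 0 \<and> p = (c * fst q, c * snd q)))"

text \<open>Local parametrization s |-> p + s*dir(p) of P^1 near p.\<close>
definition loc_dir :: "complex \<times> complex \<Rightarrow> complex \<times> complex" where
  "loc_dir p = (if snd p \<noteq> 0 then (1,0) else (0,1))"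

definition loc_series :: "coeffs \<Rightarrow> nat \<Rightarrow> complex \<times> complex \<Rightarrow> nat \<Rightarrow> complex fps" where
  "loc_series b e p i = (\<Sum>j\<le>e. fps_const (b (i,j)) *
      (fps_const (fst p) + fps_const (fst (loc_dir p)) * fps_X) ^ (e - j) *
      (fps_const (snd p) + fps_const (snd (loc_dir p)) * fps_X) ^ j)"

definition loc_coord :: "nat \<Rightarrow> coeffs \<Rightarrow> nat \<Rightarrow> complex \<times> complex \<Rightarrow> nat \<Rightarrow> complex fps" where
  "loc_coord n b e p i = (let j0 = (SOME j. j \<le> n \<and> hom_eval b e j p \<noteq> 0) in
      loc_series b e p i * inverse (loc_series b e p j0))"

inductive_set loc_alg :: "nat \<Rightarrow> coeffs \<Rightarrow> nat \<Rightarrow> complex \<times> complex \<Rightarrow> complex fps set"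
  for n b e p where
  la_const: "fps_const c \<in> loc_alg n b e p"
| la_coord: "i \<le> n \<Longrightarrow> loc_coord n b e p i \<in> loc_alg n b e p"
| la_add: "x \<in> loc_alg n b e p \<Longrightarrow> y \<in> loc_alg n b e p \<Longrightarrow> x + y \<in> loc_alg n b e p"
| la_mult: "x \<in> loc_alg n b e p \<Longrightarrow> y \<in> loc_alg n b e p \<Longrightarrow> x * y \<in> loc_alg n b e p"

definition value_semigroup :: "nat \<Rightarrow> coeffs \<Rightarrow> nat \<Rightarrow> complex \<times> complex \<Rightarrow> nat set" where
  "value_semigroup n b e p = {subdegree x | x. x \<in> loc_alg n b e p \<and> x \<noteq> 0}"

definition delta_inv :: "nat \<Rightarrow> coeffs \<Rightarrow> nat \<Rightarrow> complex \<times> complex \<Rightarrow> nat" where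
  "delta_inv n b e p = card (UNIV - value_semigroup n b e p)"

text \<open>Arithmetic genus of the image of an injective parametrization b: sum of delta invariants
  over the points of P^1 (affine points (t:1) together with (1:0)).\<close>
definition genus_param :: "nat \<Rightarrow> coeffs \<Rightarrow> nat \<Rightarrow> nat" where
  "genus_param n b e = (\<Sum>t\<in>{t. delta_inv n b e (t,1) \<noteq> 0}. delta_inv n b e (t,1))
                        + delta_inv n b e (1,0)"

text \<open>The locus V in M^n_{d,g}: image has only unibranch singularities (equivalently its
  normalization b is injective) and arithmetic genus g.\<close>
definition unibranch_locus :: "nat \<Rightarrow> nat \<Rightarrow> nat \<Rightarrow> coeffs set" where
  "unibranch_locus n d g = {a \<in> Mnd n d. \<exists>e b. 1 \<le> e \<and> is_morphism n e b \<and>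
      injective_morphism n e b \<and> same_image n d a e b \<and> genus_param n b e = g}"

end

theory Submission
  imports Defs "HOL-Computational_Algebra.Computational_Algebra" "HOL-Computational_Algebra.Field_as_Ring"
begin

text \<open>
  The dimension of a set is bounded by the number of parameters of a finite family of polynomial maps
  covering it: a chain of irreducible closed sets of length k gives k algebraically independent
  polynomials, and counting monomials shows that N parameters carry at most N of them.

  A morphism a whose image is unibranch factors as b(U, W) through the injective normalization b.
  If (U, W) has degree at least 2, then b, U and W have few enough coefficients. Otherwise a
  itself has singular points with value semigroups S of total delta invariant g. A local algebra with
  value semigroup S is generated, modulo a high power of the local parameter, by one series for each
  generator s of S, and this series can be normalized to have free coefficients only at the gaps above s.
  So the coordinates of a near the point depend on the number w of such pairs of a generator and a larger
  gap and on one coefficient for each non-gap. Imposing this at all points by Hermite interpolation gives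
  codimension n g - sum (w + 1), which is at least (n - 2) g as soon as w < 2 \<delta> for every
  semigroup with \<delta> gaps. For \<delta> at most 8 this is a finite check.
\<close>

section \<open>Dimension of polynomial images\<close>

text \<open>The strata need be neither closed nor disjoint and may contain morphisms outside the
  locus: finitely many polynomial maps with few parameters only have to cover it. Two devices keep
  the maps polynomial and finite in number. Near a point all coordinates share one unit factor; its
  jet is a free parameter and absorbs the denominators of the interpolation. Points are moved away
  from infinity by one of finitely many integer substitutions, since an arbitrary change of
  coordinates would cost parameters.

  All gaps of a semigroup with \<delta> gaps lie below 2 \<delta>, so jets of that length see the
  whole singularity. At one point they replace 2 \<delta> (n + 1) coefficients by 1 for its
  position, w for the generators, 2 \<delta> for the unit and n \<delta> for the ratios to a
  non-vanishing coordinate. The difference is n \<delta> - (w + 1).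

  The jets are independent only while their total length 2 g is at most d + 1, the number of
  coefficients of one form. The hypothesis on d just fails to ensure this: d = 2 g - 2 remains and
  needs a shortened jet and sharper bounds on w.\<close>

lemma polyfun_sum:
  assumes "\<And>i. i \<in> A \<Longrightarrow> f i \<in> polyfun"
  shows "(\<lambda>x. \<Sum>i\<in>A. f i x) \<in> polyfun"
  using assms
proof (induction A rule: infinite_finite_induct)
  case (insert i A)
  then show ?case using pf_add[of "f i" "\<lambda>x. \<Sum>i\<in>A. f i x"] by simp
qed (auto intro: pf_const)

lemma polyfun_prod:
  assumes "\<And>i. i \<in> A \<Longrightarrow> f i \<in> polyfun"
  shows "(\<lambda>x. \<Prod>i\<in>A. f i x) \<in> polyfun"
  using assms
proof (induction A rule: infinite_finite_induct)
  case (insert i A)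
  then show ?case using pf_mult[of "f i" "\<lambda>x. \<Prod>i\<in>A. f i x"] by simp
qed (auto intro: pf_const)

lemma polyfun_power:
  assumes "p \<in> polyfun"
  shows "(\<lambda>x. p x ^ k) \<in> polyfun"
proof (induction k)
  case 0 show ?case using pf_const[of 1] by simp
next
  case (Suc k) show ?case using pf_mult[OF assms Suc] by simp
qed

lemma polyfun_diff:
  assumes "p \<in> polyfun" "q \<in> polyfun"
  shows "(\<lambda>x. p x - q x) \<in> polyfun"
  using pf_add[OF assms(1) pf_mult[OF pf_const[of "-1"] assms(2)]] by simp

lemma polyfun_subst:
  assumes "p \<in> polyfun" and "\<And>i. (\<lambda>y. F y i) \<in> polyfun"
  shows "(\<lambda>y. p (F y)) \<in> polyfun"
  using assms(1)
proof induction
  case (pf_const c) show ?case by (rule polyfun.pf_const)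
next
  case (pf_coord i) show ?case by (rule assms(2))
next
  case (pf_add p q) then show ?case by (intro polyfun.pf_add)
next
  case (pf_mult p q) then show ?case by (intro polyfun.pf_mult)
qed

text \<open>Restriction to a line turns questions about zero sets in many variables into finiteness
  of the roots of one univariate polynomial. Both the irreducibility of coordinate subspaces and the
  density of \<open>Mnd\<close> rest on this.\<close>

lemma polyfun_on_line:
  assumes "p \<in> polyfun"
  shows "\<exists>P. \<forall>s. poly P s = p (\<lambda>i. u i + s * v i)"
  using assms
proof induction
  case (pf_const c)
  show ?case by (rule exI[of _ "[:c:]"]) simp
next
  case (pf_coord i)
  show ?case by (rule exI[of _ "[:u i, v i:]"]) simp
next
  case (pf_add p q)
  then show ?case by (metis poly_add)
next
  case (pf_mult p q)
  then show ?case by (metis poly_mult)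
qed

section \<open>Algebraic relations by counting monomials\<close>

lemma exists_kernel_vector:
  fixes c :: "'a \<Rightarrow> 'b \<Rightarrow> 'c::field"
  assumes "finite B" "finite A" "card B < card A"
  shows "\<exists>x. (\<exists>a\<in>A. x a \<noteq> 0) \<and> (\<forall>b\<in>B. (\<Sum>a\<in>A. x a * c a b) = 0)"
  using assms
proof (induction B arbitrary: A c rule: finite_induct)
  case empty
  then have "A \<noteq> {}" by auto
  then show ?case by (intro exI[of _ "\<lambda>_. 1"]) auto
next
  case (insert b B)
  show ?case
  proof (cases "\<forall>a\<in>A. c a b = 0")
    case True
    have "card B < card A" using insert by simp
    from insert.IH[OF insert.prems(1) this, of c] True show ?thesis by auto
  next
    case False
    then obtain a0 where a0: "a0 \<in> A" "c a0 b \<noteq> 0" by auto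
    let ?A = "A - {a0}"
    let ?c = "\<lambda>a b'. c a b' - c a b / c a0 b * c a0 b'"
    have "card B < card ?A" using insert a0 by (simp add: card_Diff_singleton)
    from insert.IH[of ?A ?c, OF _ this] insert.prems obtain x where
      x: "\<exists>a\<in>?A. x a \<noteq> 0" "\<forall>b'\<in>B. (\<Sum>a\<in>?A. x a * ?c a b') = 0" by auto
    \<comment> \<open>Gaussian elimination: the pivot unknown \<open>a0\<close> is solved from
      equation \<open>b\<close>, and \<open>?c\<close> consists of the other equations after
      substituting it.\<close>
    define y where "y = x(a0 := - (\<Sum>a\<in>?A. x a * c a b) / c a0 b)"
    have split: "(\<Sum>a\<in>A. y a * c a b') = y a0 * c a0 b' + (\<Sum>a\<in>?A. x a * c a b')" for b'
    proof -
      have "(\<Sum>a\<in>A. y a * c a b') = y a0 * c a0 b' + (\<Sum>a\<in>?A. y a * c a b')"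
        using a0 insert.prems by (simp add: sum.remove)
      also have "(\<Sum>a\<in>?A. y a * c a b') = (\<Sum>a\<in>?A. x a * c a b')"
        by (rule sum.cong) (auto simp: y_def)
      finally show ?thesis .
    qed
    have "(\<Sum>a\<in>A. y a * c a b) = 0"
      unfolding split using a0 by (simp add: y_def)
    moreover have "(\<Sum>a\<in>A. y a * c a b') = 0" if "b' \<in> B" for b'
    proof -
      have "0 = (\<Sum>a\<in>?A. x a * ?c a b')" using x that by auto
      also have "\<dots> = (\<Sum>a\<in>?A. x a * c a b') - (\<Sum>a\<in>?A. x a * c a b * (c a0 b' / c a0 b))"
        by (simp add: right_diff_distrib sum_subtractf mult_ac)
      also have "\<dots> = (\<Sum>a\<in>?A. x a * c a b') + y a0 * c a0 b'"
        by (simp add: sum_distrib_right sum_divide_distrib y_def)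
      finally show ?thesis unfolding split by (simp add: add.commute)
    qed
    moreover have "\<exists>a\<in>A. y a \<noteq> 0" using x(1) by (auto simp: y_def)
    ultimately show ?thesis by (intro exI[of _ y]) auto
  qed
qed

text \<open>Bounding each exponent separately, not the total degree, gives the exact count
  \<open>(D + 1) ^ N\<close> and makes the bounds additive under multiplication.\<close>

definition exponents :: "nat \<Rightarrow> nat \<Rightarrow> nat list set" where
  "exponents N D = {xs. set xs \<subseteq> {..D} \<and> length xs = N}"

text \<open>The head of an exponent list belongs to the variable of highest index.\<close>
fun monom_eval :: "(nat \<Rightarrow> complex) \<Rightarrow> nat list \<Rightarrow> complex" where
  "monom_eval v [] = 1"
| "monom_eval v (j # js) = v (length js) ^ j * monom_eval v js"

lemma finite_exponents [simp]: "finite (exponents N D)"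
  unfolding exponents_def by (rule finite_lists_length_eq) simp

lemma card_exponents: "card (exponents N D) = (D + 1) ^ N"
  unfolding exponents_def by (subst card_lists_length_eq) simp_all

lemma exponents_0 [simp]: "exponents 0 D = {[]}"
  by (auto simp: exponents_def)

lemma exponents_Suc: "exponents (Suc N) D = (\<lambda>(j, xs). j # xs) ` ({..D} \<times> exponents N D)"
  by (auto simp: exponents_def length_Suc_conv image_iff)

lemma sum_exponents_Suc:
  "(\<Sum>xs\<in>exponents (Suc N) D. f xs) = (\<Sum>j\<le>D. \<Sum>xs\<in>exponents N D. f (j # xs))"
proof -
  have "inj_on (\<lambda>(j, xs). j # xs) ({..D} \<times> exponents N D)" by (auto simp: inj_on_def)
  then show ?thesis
    unfolding exponents_Suc by (simp add: sum.reindex sum.cartesian_product case_prod_unfold)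
qed

lemma monom_eval_mult:
  assumes "length xs = length ys"
  shows "monom_eval v xs * monom_eval v ys = monom_eval v (map2 (+) xs ys)"
  using assms by (induction rule: list_induct2) (simp_all add: power_add mult_ac)

text \<open>Only points vanishing from coordinate \<open>N\<close> on are tested, so a polynomial
  function of infinitely many variables is treated as one of \<open>N\<close> variables.\<close>

definition monom_span :: "nat \<Rightarrow> nat \<Rightarrow> ((nat \<Rightarrow> complex) \<Rightarrow> complex) \<Rightarrow> bool" where
  "monom_span N D p \<longleftrightarrow> (\<exists>c. \<forall>y. (\<forall>i\<ge>N. y i = 0) \<longrightarrow>
     p y = (\<Sum>xs\<in>exponents N D. c xs * monom_eval y xs))"

lemma monom_span_add:
  assumes "monom_span N D p" "monom_span N D q"
  shows "monom_span N D (\<lambda>y. p y + q y)"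
proof -
  from assms obtain c c' where "\<forall>y. (\<forall>i\<ge>N. y i = 0) \<longrightarrow> p y = (\<Sum>xs\<in>exponents N D. c xs * monom_eval y xs)"
    "\<forall>y. (\<forall>i\<ge>N. y i = 0) \<longrightarrow> q y = (\<Sum>xs\<in>exponents N D. c' xs * monom_eval y xs)"
    unfolding monom_span_def by blast
  then show ?thesis unfolding monom_span_def
    by (intro exI[of _ "\<lambda>xs. c xs + c' xs"]) (auto simp: distrib_right sum.distrib)
qed

lemma monom_span_monom:
  assumes "xs \<in> exponents N D"
  shows "monom_span N D (\<lambda>y. c * monom_eval y xs)"
  unfolding monom_span_def
proof (intro exI[of _ "\<lambda>ys. if ys = xs then c else 0"] allI impI)
  fix y :: "nat \<Rightarrow> complex"
  have "(\<Sum>ys\<in>exponents N D. (if ys = xs then c else 0) * monom_eval y ys) =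
        (\<Sum>ys\<in>exponents N D. if ys = xs then c * monom_eval y ys else 0)"
    by (rule sum.cong) auto
  then show "c * monom_eval y xs = (\<Sum>ys\<in>exponents N D. (if ys = xs then c else 0) * monom_eval y ys)"
    using assms by simp
qed

lemma monom_span_0: "monom_span N D (\<lambda>y. 0)"
  unfolding monom_span_def by (intro exI[of _ "\<lambda>_. 0"]) simp

lemma monom_span_sum:
  assumes "\<And>i. i \<in> A \<Longrightarrow> monom_span N D (f i)"
  shows "monom_span N D (\<lambda>y. \<Sum>i\<in>A. f i y)"
  using assms
proof (induction A rule: infinite_finite_induct)
  case (insert i A)
  then show ?case using monom_span_add[of N D "f i" "\<lambda>y. \<Sum>i\<in>A. f i y"] by simp
qed (auto intro: monom_span_0)

lemma monom_span_cong:
  assumes "\<And>y. (\<forall>i\<ge>N. y i = 0) \<Longrightarrow> p y = q y" "monom_span N D p"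
  shows "monom_span N D q"
proof -
  from assms(2) obtain c where
    c: "\<And>y. (\<forall>i\<ge>N. y i = 0) \<Longrightarrow> p y = (\<Sum>xs\<in>exponents N D. c xs * monom_eval y xs)"
    unfolding monom_span_def by blast
  show ?thesis unfolding monom_span_def
    by (rule exI[of _ c]) (simp add: assms(1)[symmetric] c)
qed

lemma map2_add_in_exponents:
  assumes "xs \<in> exponents N D" "ys \<in> exponents N E"
  shows "map2 (+) xs ys \<in> exponents N (D + E)"
proof -
  have "a + b \<le> D + E" if "(a, b) \<in> set (zip xs ys)" for a b
    using assms set_zip_leftD[OF that] set_zip_rightD[OF that] by (intro add_mono) (auto simp: exponents_def)
  then show ?thesis using assms by (auto simp: exponents_def)
qed

lemma monom_span_mult:
  assumes "monom_span N D p" "monom_span N E q"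
  shows "monom_span N (D + E) (\<lambda>y. p y * q y)"
proof -
  from assms obtain c c' where
    c: "\<And>y. (\<forall>i\<ge>N. y i = 0) \<Longrightarrow> p y = (\<Sum>xs\<in>exponents N D. c xs * monom_eval y xs)"
    "\<And>y. (\<forall>i\<ge>N. y i = 0) \<Longrightarrow> q y = (\<Sum>xs\<in>exponents N E. c' xs * monom_eval y xs)"
    unfolding monom_span_def by blast
  have "monom_span N (D + E) (\<lambda>y. \<Sum>xs\<in>exponents N D. \<Sum>ys\<in>exponents N E.
          (c xs * c' ys) * monom_eval y (map2 (+) xs ys))"
    by (intro monom_span_sum monom_span_monom map2_add_in_exponents)
  then show ?thesis
  proof (rule monom_span_cong[rotated])
    fix y :: "nat \<Rightarrow> complex"
    assume y: "\<forall>i\<ge>N. y i = 0"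
    have "(\<Sum>xs\<in>exponents N D. \<Sum>ys\<in>exponents N E. (c xs * c' ys) * monom_eval y (map2 (+) xs ys)) =
      (\<Sum>xs\<in>exponents N D. \<Sum>ys\<in>exponents N E. (c xs * monom_eval y xs) * (c' ys * monom_eval y ys))"
      by (intro sum.cong refl, subst monom_eval_mult[symmetric]) (auto simp: exponents_def mult_ac)
    also have "\<dots> = p y * q y" using c y by (simp add: sum_product)
    finally show "(\<Sum>xs\<in>exponents N D. \<Sum>ys\<in>exponents N E. (c xs * c' ys) * monom_eval y (map2 (+) xs ys)) = p y * q y" .
  qed
qed

lemma monom_eval_replicate_0 [simp]: "monom_eval y (replicate N 0) = 1"
  by (induction N) auto

lemma monom_eval_single:
  "i < N \<Longrightarrow> monom_eval y (replicate (N - Suc i) 0 @ Suc 0 # replicate i 0) = y i"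
proof (induction N)
  case (Suc N)
  have "monom_eval y (replicate k 0 @ Suc 0 # replicate i 0) = y i" for k
    by (induction k) auto
  then show ?case by blast
qed simp

lemma monom_span_const: "monom_span N D (\<lambda>y. c)"
proof -
  have "monom_span N D (\<lambda>y. c * monom_eval y (replicate N 0))"
    by (rule monom_span_monom) (auto simp: exponents_def)
  then show ?thesis by simp
qed

lemma monom_span_mono: "monom_span N D p \<Longrightarrow> D \<le> E \<Longrightarrow> monom_span N E p"
  using monom_span_mult[OF _ monom_span_const[of N "E - D" 1], of D p] by simp

lemma polyfun_imp_monom_span:
  assumes "p \<in> polyfun"
  shows "\<exists>D. monom_span N D p"
  using assms
proof induction
  case (pf_const c)
  show ?case by (rule exI) (rule monom_span_const[of N 0])
next
  case (pf_coord i)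
  show ?case
  proof (cases "i < N")
    case True
    let ?xs = "replicate (N - Suc i) 0 @ Suc 0 # replicate i 0"
    have "monom_span N 1 (\<lambda>y. 1 * monom_eval y ?xs)"
      using True by (intro monom_span_monom) (auto simp: exponents_def)
    then show ?thesis unfolding monom_eval_single[OF True] mult_1 by blast
  next
    case False
    have "monom_span N 0 (\<lambda>y. y i)" by (rule monom_span_cong[OF _ monom_span_0]) (use False in auto)
    then show ?thesis by blast
  qed
next
  case (pf_add p q)
  then obtain D E where "monom_span N D p" "monom_span N E q" by auto
  then have "monom_span N (D + E) (\<lambda>x. p x + q x)"
    by (intro monom_span_add) (auto elim: monom_span_mono)
  then show ?case by blast
next
  case (pf_mult p q)
  then show ?case using monom_span_mult by blast
qed

lemma monom_span_power: "monom_span N m p \<Longrightarrow> monom_span N (k * m) (\<lambda>y. p y ^ k)"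
  by (induction k) (simp_all add: monom_span_const monom_span_mult)

lemma monom_span_monom_eval:
  assumes "\<And>i. i < k \<Longrightarrow> monom_span N m (p i)" "xs \<in> exponents k D"
  shows "monom_span N (k * (D * m)) (\<lambda>y. monom_eval (\<lambda>i. p i y) xs)"
  using assms
proof (induction k arbitrary: xs)
  case 0
  then show ?case by (simp add: monom_span_const)
next
  case (Suc k)
  then obtain j ys where xs: "xs = j # ys" "j \<le> D" "ys \<in> exponents k D"
    by (auto simp: exponents_Suc)
  have len: "length ys = k" using xs by (simp add: exponents_def)
  have "monom_span N (D * m) (\<lambda>y. p k y ^ j)"
    by (rule monom_span_mono[OF monom_span_power[OF Suc.prems(1)]]) (use xs in auto)
  from monom_span_mult[OF this Suc.IH[OF Suc.prems(1) xs(3)]] show ?case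
    using xs(1) len by simp
qed

definition relation_eval :: "nat \<Rightarrow> nat \<Rightarrow> (nat list \<Rightarrow> complex) \<Rightarrow> (nat \<Rightarrow> complex) \<Rightarrow> complex" where
  "relation_eval k D x v = (\<Sum>xs\<in>exponents k D. x xs * monom_eval v xs)"

lemma polyfun_relation_eval:
  assumes "\<And>i. i < k \<Longrightarrow> p i \<in> polyfun"
  shows "(\<lambda>z. relation_eval k D x (\<lambda>i. p i z)) \<in> polyfun"
proof -
  have "(\<lambda>z. monom_eval (\<lambda>i. p i z) xs) \<in> polyfun" if "length xs \<le> k" for xs
    using that
  proof (induction xs)
    case (Cons a xs)
    then show ?case using assms[of "length xs"] by (auto intro!: pf_mult polyfun_power)
  qed (auto intro: pf_const)
  then show ?thesis unfolding relation_eval_def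
    by (intro polyfun_sum pf_mult pf_const) (auto simp: exponents_def)
qed

text \<open>The monomials in the \<open>p i\<close> with exponents at most \<open>D\<close> number
  (D + 1)^k, while after substitution they lie in a space whose dimension grows only like D^N. For k
  > N and large \<open>D\<close> they must be dependent.\<close>

lemma exists_algebraic_relation:
  fixes p :: "nat \<Rightarrow> (nat \<Rightarrow> complex) \<Rightarrow> complex"
  assumes "\<And>i. i < k \<Longrightarrow> p i \<in> polyfun" and "N < k"
  shows "\<exists>D x. (\<exists>xs\<in>exponents k D. x xs \<noteq> 0) \<and>
     (\<forall>y. (\<forall>i\<ge>N. y i = 0) \<longrightarrow> relation_eval k D x (\<lambda>i. p i y) = 0)"
proof -
  have "\<forall>i. \<exists>D. i < k \<longrightarrow> monom_span N D (p i)"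
    using assms(1) polyfun_imp_monom_span by blast
  then obtain D0 where D0: "\<And>i. i < k \<Longrightarrow> monom_span N (D0 i) (p i)" by metis
  define m where "m = (\<Sum>i<k. D0 i)"
  have m: "monom_span N m (p i)" if "i < k" for i
    by (rule monom_span_mono[OF D0[OF that]]) (use that in \<open>auto simp: m_def intro: member_le_sum\<close>)
  \<comment> \<open>Chosen so that \<open>((k * m + 1) * (D + 1)) ^ N\<close> equals
    \<open>D * (D + 1) ^ N\<close>, which is just below \<open>(D + 1) ^ Suc N\<close>.\<close>
  define D where "D = (k * m + 1) ^ N"
  let ?A = "exponents k D" and ?B = "exponents N (k * (D * m))"
  have "\<forall>xs\<in>?A. \<exists>c. \<forall>y. (\<forall>i\<ge>N. y i = 0) \<longrightarrow>
      monom_eval (\<lambda>i. p i y) xs = (\<Sum>ys\<in>?B. c ys * monom_eval y ys)"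
    using monom_span_monom_eval[of k N m p _ D, OF m] unfolding monom_span_def by blast
  then obtain c where c: "\<And>xs y. xs \<in> ?A \<Longrightarrow> (\<forall>i\<ge>N. y i = 0) \<Longrightarrow>
      monom_eval (\<lambda>i. p i y) xs = (\<Sum>ys\<in>?B. c xs ys * monom_eval y ys)" by metis
  have "card ?B = (k * (D * m) + 1) ^ N" by (simp add: card_exponents)
  also have "\<dots> \<le> ((k * m + 1) * (D + 1)) ^ N"
    by (rule power_mono) (auto simp: algebra_simps)
  also have "\<dots> = D * (D + 1) ^ N" by (simp only: power_mult_distrib D_def[symmetric])
  also have "\<dots> < (D + 1) ^ Suc N" by simp
  also have "\<dots> \<le> (D + 1) ^ k" using assms(2) by (intro power_increasing) auto
  finally have "card ?B < card ?A" by (simp add: card_exponents)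
  from exists_kernel_vector[OF _ _ this, of c] obtain x where
    x: "\<exists>xs\<in>?A. x xs \<noteq> 0" "\<forall>ys\<in>?B. (\<Sum>xs\<in>?A. x xs * c xs ys) = 0" by auto
  have "relation_eval k D x (\<lambda>i. p i y) = 0" if "\<forall>i\<ge>N. y i = 0" for y
  proof -
    have "relation_eval k D x (\<lambda>i. p i y) = (\<Sum>xs\<in>?A. \<Sum>ys\<in>?B. x xs * c xs ys * monom_eval y ys)"
      using c that by (simp add: relation_eval_def sum_distrib_left mult.assoc)
    also have "\<dots> = (\<Sum>ys\<in>?B. (\<Sum>xs\<in>?A. x xs * c xs ys) * monom_eval y ys)"
      by (subst sum.swap) (simp add: sum_distrib_right)
    also have "\<dots> = 0" using x(2) by simp
    finally show ?thesis .
  qed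
  with x(1) show ?thesis by blast
qed

section \<open>Chains of irreducible closed sets\<close>

lemma zirreducible_mult_zero:
  assumes "zirreducible Z" "p \<in> polyfun" "q \<in> polyfun" "\<And>z. z \<in> Z \<Longrightarrow> p z * q z = 0"
  shows "(\<forall>z\<in>Z. p z = 0) \<or> (\<forall>z\<in>Z. q z = 0)"
proof -
  have "zariski_closed {x. p x = 0}" "zariski_closed {x. q x = 0}"
    unfolding zariski_closed_def using assms(2,3)
    by (intro exI[of _ "{p}"] exI[of _ "{q}"]; auto)+
  moreover have "Z \<subseteq> {x. p x = 0} \<union> {x. q x = 0}" using assms(4) by auto
  ultimately have "Z \<subseteq> {x. p x = 0} \<or> Z \<subseteq> {x. q x = 0}"
    using assms(1) unfolding zirreducible_def by blast
  then show ?thesis by blast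
qed

lemma zirreducible_prod_zero:
  assumes "zirreducible Z" "finite A" "\<And>c. c \<in> A \<Longrightarrow> p c \<in> polyfun"
    "\<And>z. z \<in> Z \<Longrightarrow> (\<Prod>c\<in>A. p c z) = 0"
  shows "\<exists>c\<in>A. \<forall>z\<in>Z. p c z = 0"
  using assms(2-4)
proof (induction A rule: finite_induct)
  case empty
  then show ?case using assms(1) by (auto simp: zirreducible_def)
next
  case (insert c A)
  have "(\<forall>z\<in>Z. p c z = 0) \<or> (\<forall>z\<in>Z. (\<Prod>c\<in>A. p c z) = 0)"
    by (rule zirreducible_mult_zero[OF assms(1)]) (use insert in \<open>auto intro: polyfun_prod\<close>)
  with insert show ?case by auto
qed

lemma zclosure_vanish:
  assumes "p \<in> polyfun" "\<And>x. x \<in> S \<Longrightarrow> p x = 0" "z \<in> zclosure S"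
  shows "p z = 0"
proof -
  have "zariski_closed {x. p x = 0}"
    unfolding zariski_closed_def using assms(1) by (intro exI[of _ "{p}"]) auto
  moreover have "S \<subseteq> {x. p x = 0}" using assms(2) by auto
  ultimately show ?thesis using assms(3) unfolding zclosure_def by blast
qed

lemma not_in_zclosure:
  assumes "z \<notin> zclosure S"
  shows "\<exists>p\<in>polyfun. (\<forall>x\<in>S. p x = 0) \<and> p z \<noteq> 0"
proof -
  from assms obtain Z where Z: "zariski_closed Z" "S \<subseteq> Z" "z \<notin> Z" unfolding zclosure_def by auto
  then obtain F where "F \<subseteq> polyfun" "Z = {x. \<forall>p\<in>F. p x = 0}" unfolding zariski_closed_def by auto
  with Z show ?thesis by blast
qed

lemma closed_not_subset:
  assumes "zariski_closed A" "\<not> B \<subseteq> A"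
  shows "\<exists>p\<in>polyfun. (\<forall>x\<in>A. p x = 0) \<and> (\<exists>x\<in>B. p x \<noteq> 0)"
proof -
  from assms obtain z where z: "z \<in> B" "z \<notin> A" by auto
  from assms(1) obtain F where "F \<subseteq> polyfun" "A = {x. \<forall>p\<in>F. p x = 0}" unfolding zariski_closed_def by auto
  with z show ?thesis by blast
qed

text \<open>Induction on the length of the chain. Write a relation as a polynomial in the last
  function \<open>p k\<close> and divide by the lowest power \<open>j0\<close> that occurs;
  irreducibility of \<open>Z (Suc k)\<close> allows this because \<open>p k\<close> is not
  identically zero there. Restricting the quotient \<open>Q\<close> to \<open>Z k\<close>, where
  \<open>p k\<close> vanishes, leaves its lowest coefficient, a non-trivial relation among the
  earlier functions.\<close>

lemma chain_algebraically_independent: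
  assumes "\<And>i. i \<le> k \<Longrightarrow> zirreducible (Z i)" "\<And>i. i < k \<Longrightarrow> Z i \<subset> Z (Suc i)"
    "\<And>i. i < k \<Longrightarrow> p i \<in> polyfun" "\<And>i z. i < k \<Longrightarrow> z \<in> Z i \<Longrightarrow> p i z = 0"
    "\<And>i. i < k \<Longrightarrow> \<exists>z\<in>Z (Suc i). p i z \<noteq> 0"
    and "\<exists>xs\<in>exponents k D. x xs \<noteq> 0"
  shows "\<exists>z\<in>Z k. relation_eval k D x (\<lambda>i. p i z) \<noteq> 0"
  using assms
proof (induction k arbitrary: x)
  case 0
  from 0(1)[of 0] obtain z where "z \<in> Z 0" by (auto simp: zirreducible_def)
  with 0 show ?case by (auto simp: relation_eval_def)
next
  case (Suc k)
  define R where "R j z = relation_eval k D (\<lambda>xs. x (j # xs)) (\<lambda>i. p i z)" for j z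
  have "(\<lambda>z. R j z) \<in> polyfun" for j
    unfolding R_def by (rule polyfun_relation_eval) (use Suc.prems(3) in auto)
  then have Rpoly: "R j \<in> polyfun" for j by simp
  have sum_eq: "relation_eval (Suc k) D x (\<lambda>i. p i z) = (\<Sum>j\<le>D. p k z ^ j * R j z)" for z
    unfolding relation_eval_def sum_exponents_Suc R_def sum_distrib_left
    by (intro sum.cong refl) (auto simp: exponents_def)
  define j0 where "j0 = (LEAST j. \<exists>xs\<in>exponents k D. x (j # xs) \<noteq> 0)"
  from Suc.prems(6) obtain j1 xs1 where j1: "j1 \<le> D" "xs1 \<in> exponents k D" "x (j1 # xs1) \<noteq> 0"
    by (auto simp: exponents_Suc)
  have j0: "\<exists>xs\<in>exponents k D. x (j0 # xs) \<noteq> 0" unfolding j0_def by (rule LeastI[of _ j1]) (use j1 in auto)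
  have "j0 \<le> j1" unfolding j0_def by (rule Least_le) (use j1 in auto)
  then have j0D: "j0 \<le> D" using j1 by simp
  have R0: "R j z = 0" if "j < j0" for j z
    using not_less_Least[OF that[unfolded j0_def]] by (auto simp: R_def relation_eval_def intro!: sum.neutral)
  define Q where "Q z = (\<Sum>j\<in>{j0..D}. p k z ^ (j - j0) * R j z)" for z
  have Qpoly: "Q \<in> polyfun"
  proof -
    have "(\<lambda>z. Q z) \<in> polyfun" unfolding Q_def
      by (intro polyfun_sum pf_mult polyfun_power Rpoly Suc.prems(3)) auto
    then show ?thesis by simp
  qed
  have fac: "(\<Sum>j\<le>D. p k z ^ j * R j z) = p k z ^ j0 * Q z" for z
  proof -
    have "(\<Sum>j\<le>D. p k z ^ j * R j z) = (\<Sum>j\<in>{j0..D}. p k z ^ j * R j z)"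
      by (rule sum.mono_neutral_right) (auto simp: R0)
    also have "\<dots> = p k z ^ j0 * Q z" unfolding Q_def sum_distrib_left
      by (rule sum.cong) (auto simp: mult.assoc[symmetric] power_add[symmetric])
    finally show ?thesis .
  qed
  show ?case
  proof (rule ccontr)
    assume "\<not> ?case"
    then have "p k z ^ j0 * Q z = 0" if "z \<in> Z (Suc k)" for z
      using that sum_eq fac by auto
    then have "(\<forall>z\<in>Z (Suc k). p k z ^ j0 = 0) \<or> (\<forall>z\<in>Z (Suc k). Q z = 0)"
      by (intro zirreducible_mult_zero[OF Suc.prems(1)[of "Suc k"]] polyfun_power Suc.prems(3) Qpoly) auto
    moreover obtain z1 where "z1 \<in> Z (Suc k)" "p k z1 \<noteq> 0" using Suc.prems(5)[of k] by auto
    ultimately have Q0: "\<forall>z\<in>Z (Suc k). Q z = 0" by auto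
    obtain z where z: "z \<in> Z k" "R j0 z \<noteq> 0"
      using Suc.IH[of "\<lambda>xs. x (j0 # xs)"] Suc.prems j0 unfolding R_def by auto
    have "z \<in> Z (Suc k)" using z(1) Suc.prems(2)[of k] by auto
    then have "Q z = 0" using Q0 by auto
    moreover have "p k z = 0" using Suc.prems(4)[of k z] z by simp
    then have "Q z = (\<Sum>j\<in>{j0..D}. if j = j0 then R j z else 0)"
      unfolding Q_def by (intro sum.cong) auto
    then have "Q z = R j0 z" using j0D by simp
    ultimately show False using z by simp
  qed
qed

text \<open>\<open>N\<close> parameters are sequences vanishing from index \<open>N\<close> on,
  which matches \<open>monom_span\<close>. Inclusion in the image suffices for upper bounds on the
  dimension.\<close>

definition poly_covered :: "nat \<Rightarrow> ('i \<Rightarrow> complex) set \<Rightarrow> bool" where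
  "poly_covered N S \<longleftrightarrow> (\<exists>F :: (nat \<Rightarrow> complex) \<Rightarrow> 'i \<Rightarrow> complex.
     (\<forall>i. (\<lambda>y. F y i) \<in> polyfun) \<and> S \<subseteq> F ` {y. \<forall>i\<ge>N. y i = 0})"

text \<open>Lets parameters be indexed by any finite set, so that the families below can use tagged
  tuples as names of parameters.\<close>

lemma poly_coveredI:
  fixes F :: "('j \<Rightarrow> complex) \<Rightarrow> 'i \<Rightarrow> complex"
  assumes "finite J" "card J \<le> N" and F: "\<And>i. (\<lambda>y. F y i) \<in> polyfun"
    and cov: "\<And>x. x \<in> S \<Longrightarrow> \<exists>y. (\<forall>j. j \<notin> J \<longrightarrow> y j = 0) \<and> x = F y"
  shows "poly_covered N S"
proof -
  obtain h where h: "bij_betw h J {..<card J}"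
    using assms(1) by (metis ex_bij_betw_finite_nat lessThan_atLeast0)
  define T :: "(nat \<Rightarrow> complex) \<Rightarrow> 'j \<Rightarrow> complex" where "T y j = (if j \<in> J then y (h j) else 0)" for y j
  have Tp: "(\<lambda>y. T y j) \<in> polyfun" for j
    unfolding T_def by (cases "j \<in> J") (auto intro: pf_const pf_coord)
  show ?thesis unfolding poly_covered_def
  proof (intro exI[of _ "\<lambda>y. F (T y)"] conjI allI subsetI)
    show "(\<lambda>y. F (T y) i) \<in> polyfun" for i using polyfun_subst[OF F Tp] by simp
    fix x assume "x \<in> S"
    then obtain y where y: "\<forall>j. j \<notin> J \<longrightarrow> y j = 0" "x = F y" using cov by blast
    define z where "z k = (if k < card J then y (inv_into J h k) else 0)" for k
    have "T z = y"
    proof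
      fix j show "T z j = y j"
        using y(1) h by (auto simp: T_def z_def bij_betw_def inv_into_f_f)
    qed
    moreover have "\<forall>i\<ge>N. z i = 0" using assms(2) by (auto simp: z_def)
    ultimately show "x \<in> (\<lambda>y. F (T y)) ` {y. \<forall>i\<ge>N. y i = 0}" using y(2) by force
  qed
qed

text \<open>The largest set \<open>Z k\<close> lies in the closure of a single piece
  \<open>T c\<close>: otherwise a product of polynomials, one vanishing on each piece but not on
  \<open>Z k\<close>, would vanish on \<open>Z k\<close>. An algebraic relation holding after
  pulling back to the \<open>N\<close> parameters of that piece then holds on its closure and
  contradicts independence along the chain.\<close>

lemma chain_length_le:
  assumes "finite C" "\<And>c. c \<in> C \<Longrightarrow> poly_covered N (T c)" "S \<subseteq> (\<Union>c\<in>C. T c)"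
    "\<forall>i\<le>k. zirreducible (Z i)" "\<forall>i<k. Z i \<subset> Z (Suc i)" "Z k \<subseteq> zclosure S"
  shows "k \<le> N"
proof (rule ccontr)
  assume "\<not> k \<le> N"
  have "\<exists>c\<in>C. Z k \<subseteq> zclosure (T c)"
  proof (rule ccontr)
    assume "\<not> ?thesis"
    then have "\<forall>c\<in>C. \<exists>p\<in>polyfun. (\<forall>x\<in>T c. p x = 0) \<and> (\<exists>z\<in>Z k. p z \<noteq> 0)"
      by (metis not_in_zclosure subsetI)
    then obtain p where p: "\<And>c. c \<in> C \<Longrightarrow> p c \<in> polyfun" "\<And>c x. c \<in> C \<Longrightarrow> x \<in> T c \<Longrightarrow> p c x = 0"
      "\<And>c. c \<in> C \<Longrightarrow> \<exists>z\<in>Z k. p c z \<noteq> 0" by metis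
    have "(\<Prod>c\<in>C. p c z) = 0" if "z \<in> Z k" for z
    proof (rule zclosure_vanish[where S = S and p = "\<lambda>z. \<Prod>c\<in>C. p c z"])
      show "(\<lambda>z. \<Prod>c\<in>C. p c z) \<in> polyfun" by (rule polyfun_prod) (rule p)
      show "z \<in> zclosure S" using that assms by auto
      show "(\<Prod>c\<in>C. p c x) = 0" if "x \<in> S" for x
        using that assms(1,3) p(2) by (intro prod_zero) blast+
    qed
    then obtain c where "c \<in> C" "\<forall>z\<in>Z k. p c z = 0"
      using zirreducible_prod_zero[of "Z k" C p] assms p(1) by blast
    then show False using p(3) by blast
  qed
  then obtain c where c: "c \<in> C" "Z k \<subseteq> zclosure (T c)" by auto
  obtain F where F: "\<And>i. (\<lambda>y. F y i) \<in> polyfun" "T c \<subseteq> F ` {y. \<forall>i\<ge>N. y i = 0}"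
    using assms(2)[OF c(1)] unfolding poly_covered_def by blast
  have "\<forall>i. \<exists>p. i < k \<longrightarrow> p \<in> polyfun \<and> (\<forall>x\<in>Z i. p x = 0) \<and> (\<exists>z\<in>Z (Suc i). p z \<noteq> 0)"
  proof (intro allI)
    fix i
    show "\<exists>p. i < k \<longrightarrow> p \<in> polyfun \<and> (\<forall>x\<in>Z i. p x = 0) \<and> (\<exists>z\<in>Z (Suc i). p z \<noteq> 0)"
    proof (cases "i < k")
      case True
      then have "zariski_closed (Z i)" "\<not> Z (Suc i) \<subseteq> Z i"
        using assms(4,5) by (auto simp: zirreducible_def)
      from closed_not_subset[OF this] show ?thesis by blast
    qed auto
  qed
  then obtain p where p: "\<And>i. i < k \<Longrightarrow> p i \<in> polyfun" "\<And>i z. i < k \<Longrightarrow> z \<in> Z i \<Longrightarrow> p i z = 0"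
    "\<And>i. i < k \<Longrightarrow> \<exists>z\<in>Z (Suc i). p i z \<noteq> 0" by metis
  have "\<exists>D x. (\<exists>xs\<in>exponents k D. x xs \<noteq> 0) \<and>
     (\<forall>y. (\<forall>i\<ge>N. y i = 0) \<longrightarrow> relation_eval k D x (\<lambda>i. p i (F y)) = 0)"
    by (rule exists_algebraic_relation[where p = "\<lambda>i y. p i (F y)"])
      (use \<open>\<not> k \<le> N\<close> polyfun_subst[OF p(1) F(1)] in auto)
  then obtain D x where x: "\<exists>xs\<in>exponents k D. x xs \<noteq> 0"
    "\<And>y. (\<forall>i\<ge>N. y i = 0) \<Longrightarrow> relation_eval k D x (\<lambda>i. p i (F y)) = 0" by blast
  have "relation_eval k D x (\<lambda>i. p i z) = 0" if "z \<in> Z k" for z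
    by (rule zclosure_vanish[where S = "T c" and p = "\<lambda>z. relation_eval k D x (\<lambda>i. p i z)"])
      (use polyfun_relation_eval[of k p] p(1) F(2) x(2) that c in auto)
  moreover have "\<exists>z\<in>Z k. relation_eval k D x (\<lambda>i. p i z) \<noteq> 0"
    by (rule chain_algebraically_independent) (use assms(4,5) p x(1) in auto)
  ultimately show False by blast
qed

lemma zdim_le:
  fixes S :: "('i \<Rightarrow> complex) set"
  assumes "finite C" "\<And>c. c \<in> C \<Longrightarrow> poly_covered N (T c)" "S \<subseteq> (\<Union>c\<in>C. T c)"
  shows "zdim S \<le> int N"
proof -
  let ?K = "{k. \<exists>Z :: nat \<Rightarrow> ('i \<Rightarrow> complex) set.
       (\<forall>i\<le>k. zirreducible (Z i)) \<and> (\<forall>i<k. Z i \<subset> Z (Suc i)) \<and> Z k \<subseteq> zclosure S}"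
  have "k \<le> N" if "k \<in> ?K" for k
    using that chain_length_le[OF assms] by blast
  \<comment> \<open>\<open>cSup_least\<close> needs a non-empty set; the empty one is settled by the
    convention for \<open>Sup\<close> on naturals.\<close>
  moreover have "Sup ({} :: nat set) = 0" by (simp add: Sup_nat_def)
  ultimately have "Sup ?K \<le> N"
    using cSup_least[of ?K N] by (metis (no_types, lifting) le0)
  then show ?thesis unfolding zdim_def by auto
qed

text \<open>The cover is needed for the lower bound too: a chain length is below
  \<open>Sup ?K\<close> only once \<open>?K\<close> is known to be bounded.\<close>

lemma zdim_ge:
  fixes S :: "('i \<Rightarrow> complex) set"
  assumes "finite C" "\<And>c. c \<in> C \<Longrightarrow> poly_covered N (T c)" "S \<subseteq> (\<Union>c\<in>C. T c)" "S \<noteq> {}"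
    "\<forall>i\<le>k. zirreducible (Z i)" "\<forall>i<k. Z i \<subset> Z (Suc i)" "Z k \<subseteq> zclosure S"
  shows "int k \<le> zdim S"
proof -
  let ?K = "{k. \<exists>Z :: nat \<Rightarrow> ('i \<Rightarrow> complex) set.
       (\<forall>i\<le>k. zirreducible (Z i)) \<and> (\<forall>i<k. Z i \<subset> Z (Suc i)) \<and> Z k \<subseteq> zclosure S}"
  have "l \<le> N" if "l \<in> ?K" for l
    using that chain_length_le[OF assms(1-3)] by blast
  then have "bdd_above ?K" by (auto simp: bdd_above_def)
  moreover have "k \<in> ?K" using assms(5-7) by blast
  ultimately have "k \<le> Sup ?K" by (intro cSup_upper)
  then show ?thesis using assms(4) unfolding zdim_def by auto
qed

section \<open>Coordinate subspaces\<close>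

definition supported_on :: "'i set \<Rightarrow> ('i \<Rightarrow> complex) set" where
  "supported_on I = {x. \<forall>i. i \<notin> I \<longrightarrow> x i = 0}"

lemma poly_covered_supported_on:
  assumes "finite I"
  shows "poly_covered (card I) (supported_on I)"
proof (rule poly_coveredI[of I _ "\<lambda>y. y"])
  show "\<exists>y. (\<forall>j. j \<notin> I \<longrightarrow> y j = 0) \<and> x = y" if "x \<in> supported_on I" for x
    using that by (simp add: supported_on_def)
qed (simp_all add: assms pf_coord)

text \<open>If neither \<open>A\<close> nor \<open>B\<close> contained the subspace, the line
  joining a point outside \<open>A\<close> to a point outside \<open>B\<close> would stay in the
  subspace, and a product of two non-zero univariate polynomials would vanish on all of it.\<close>

lemma zirreducible_supported_on: "zirreducible (supported_on I)"
  unfolding zirreducible_def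
proof (intro conjI allI impI)
  have "(\<lambda>i x. x i) ` (- I) \<subseteq> polyfun" by (auto simp: pf_coord)
  moreover have "supported_on I = {x. \<forall>p\<in>(\<lambda>i x. x i) ` (- I). p x = 0}"
    by (auto simp: supported_on_def)
  ultimately show "zariski_closed (supported_on I)" unfolding zariski_closed_def by blast
  have "(\<lambda>_. 0) \<in> supported_on I" by (simp add: supported_on_def)
  then show "supported_on I \<noteq> {}" by blast
  fix A B assume AB: "zariski_closed A" "zariski_closed B" "supported_on I \<subseteq> A \<union> B"
  show "supported_on I \<subseteq> A \<or> supported_on I \<subseteq> B"
  proof (rule ccontr)
    assume neg: "\<not> ?thesis"
    obtain p x where p: "p \<in> polyfun" "\<forall>x\<in>A. p x = 0" "x \<in> supported_on I" "p x \<noteq> 0"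
      using closed_not_subset[OF AB(1)] neg by blast
    obtain q y where q: "q \<in> polyfun" "\<forall>x\<in>B. q x = 0" "y \<in> supported_on I" "q y \<noteq> 0"
      using closed_not_subset[OF AB(2)] neg by blast
    let ?l = "\<lambda>s i. x i + s * (y i - x i)"
    obtain P where P: "\<And>s. poly P s = p (?l s)"
      using polyfun_on_line[OF p(1), of x "\<lambda>i. y i - x i"] by blast
    obtain Q where Q: "\<And>s. poly Q s = q (?l s)"
      using polyfun_on_line[OF q(1), of x "\<lambda>i. y i - x i"] by blast
    have "poly (P * Q) s = 0" for s
    proof -
      have "?l s \<in> supported_on I" using p(3) q(3) by (auto simp: supported_on_def)
      then show ?thesis using AB(3) p(2) q(2) P Q by auto
    qed
    then have "P * Q = 0" using poly_all_0_iff_0 by blast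
    moreover have "poly P 0 \<noteq> 0" "poly Q 1 \<noteq> 0" using P Q p q by auto
    ultimately show False by auto
  qed
qed

lemma supported_on_psubset:
  assumes "I \<subset> J" shows "supported_on I \<subset> supported_on J"
proof -
  obtain j where "j \<in> J" "j \<notin> I" using assms by blast
  then have "(\<lambda>i. if i = j then 1 else 0) \<in> supported_on J - supported_on I"
    by (auto simp: supported_on_def)
  then show ?thesis using assms by (auto simp: supported_on_def)
qed

text \<open>The flag that adds one coordinate at a time is a chain of length \<open>card I\<close>;
  the identity parametrization of the subspace gives the other inequality.\<close>

lemma zdim_dense_in_supported_on:
  assumes "finite I" "S \<subseteq> supported_on I" "supported_on I \<subseteq> zclosure S" "S \<noteq> {}"
  shows "zdim S = int (card I)"
proof (rule antisym)
  show "zdim S \<le> int (card I)"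
    by (rule zdim_le[of "{()}" _ "\<lambda>_. supported_on I"])
      (use assms poly_covered_supported_on in auto)
  obtain h where h: "bij_betw h {..<card I} I"
    using assms(1) by (metis ex_bij_betw_nat_finite lessThan_atLeast0)
  show "int (card I) \<le> zdim S"
  proof (rule zdim_ge[of "{()}" _ "\<lambda>_. supported_on I" _ _ "\<lambda>k. supported_on (h ` {..<k})"])
    show "\<forall>i<card I. supported_on (h ` {..<i}) \<subset> supported_on (h ` {..<Suc i})"
    proof (intro allI impI supported_on_psubset)
      fix i assume "i < card I"
      then have "h i \<notin> h ` {..<i}" using h
        by (auto simp: bij_betw_def dest!: inj_onD)
      then show "h ` {..<i} \<subset> h ` {..<Suc i}" by (auto simp: lessThan_Suc)
    qed
    show "supported_on (h ` {..<card I}) \<subseteq> zclosure S" using h assms(3) by (simp add: bij_betw_def)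
  qed (use assms poly_covered_supported_on zirreducible_supported_on in auto)
qed

section \<open>The space of nondegenerate morphisms\<close>

lemma poly_eq_0_if_cofinitely_many_roots:
  fixes p :: "complex poly"
  assumes "finite E" "\<And>t. t \<notin> E \<Longrightarrow> poly p t = 0"
  shows "p = 0"
proof (rule ccontr)
  assume "p \<noteq> 0"
  then have "finite {t. poly p t = 0}" by (rule poly_roots_finite)
  with assms(1) have "finite (E \<union> {t. poly p t = 0})" by simp
  moreover have "E \<union> {t. poly p t = 0} = UNIV" using assms(2) by auto
  ultimately show False using infinite_UNIV_char_0[where 'a = complex] by simp
qed

definition aff_poly :: "coeffs \<Rightarrow> nat \<Rightarrow> nat \<Rightarrow> complex poly" where
  "aff_poly a d i = (\<Sum>j\<le>d. monom (a (i, j)) (d - j))"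

lemma poly_aff_poly: "poly (aff_poly a d i) t = hom_eval a d i (t, 1)"
  by (simp add: aff_poly_def hom_eval_def poly_sum poly_monom)

lemma coeff_aff_poly: "j \<le> d \<Longrightarrow> coeff (aff_poly a d i) (d - j) = a (i, j)"
proof -
  assume j: "j \<le> d"
  have "coeff (aff_poly a d i) (d - j) = (\<Sum>l\<le>d. if l = j then a (i, l) else 0)"
    unfolding aff_poly_def coeff_sum coeff_monom by (rule sum.cong) (use j in auto)
  then show ?thesis using j by simp
qed

lemma degree_aff_poly: "degree (aff_poly a d i) \<le> d"
  unfolding aff_poly_def by (rule degree_sum_le) (auto intro: order_trans[OF degree_monom_le])

lemma hom_eval_scale: "hom_eval a d i (c * x, c * y) = c ^ d * hom_eval a d i (x, y)"
  unfolding hom_eval_def sum_distrib_left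
  by (rule sum.cong) (auto simp: power_mult_distrib mult_ac power_add[symmetric])

lemma hom_eval_infinity: "hom_eval a d i (1, 0) = a (i, 0)"
proof -
  have "hom_eval a d i (1, 0) = (\<Sum>j\<le>d. if j = 0 then a (i, j) else 0)"
    unfolding hom_eval_def by (rule sum.cong) auto
  then show ?thesis by simp
qed

lemma nondegenerate_iff:
  "nondegenerate n d a \<longleftrightarrow>
    (\<forall>c. (\<forall>j\<le>d. (\<Sum>i\<le>n. c i * a (i, j)) = 0) \<longrightarrow> (\<forall>i\<le>n. c i = 0))"
proof -
  have "(\<forall>p. (\<Sum>i\<le>n. c i * hom_eval a d i p) = 0) \<longleftrightarrow> (\<forall>j\<le>d. (\<Sum>i\<le>n. c i * a (i, j)) = 0)" for c
  proof
    assume L: "\<forall>p. (\<Sum>i\<le>n. c i * hom_eval a d i p) = 0"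
    let ?P = "\<Sum>i\<le>n. smult (c i) (aff_poly a d i)"
    have "poly ?P t = 0" for t using L by (simp add: poly_sum poly_aff_poly)
    then have "?P = 0" using poly_all_0_iff_0 by blast
    then have "coeff ?P (d - j) = 0" for j by simp
    moreover have "coeff ?P (d - j) = (\<Sum>i\<le>n. c i * a (i, j))" if "j \<le> d" for j
      using that by (simp add: coeff_sum coeff_aff_poly)
    ultimately show "\<forall>j\<le>d. (\<Sum>i\<le>n. c i * a (i, j)) = 0" by metis
  next
    assume R: "\<forall>j\<le>d. (\<Sum>i\<le>n. c i * a (i, j)) = 0"
    show "\<forall>p. (\<Sum>i\<le>n. c i * hom_eval a d i p) = 0"
    proof
      fix p
      have "(\<Sum>i\<le>n. c i * hom_eval a d i p) =
          (\<Sum>i\<le>n. \<Sum>j\<le>d. c i * a (i, j) * (fst p ^ (d - j) * snd p ^ j))"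
        by (simp add: hom_eval_def sum_distrib_left mult.assoc)
      also have "\<dots> = (\<Sum>j\<le>d. (\<Sum>i\<le>n. c i * a (i, j)) * (fst p ^ (d - j) * snd p ^ j))"
        by (subst sum.swap) (simp add: sum_distrib_right)
      also have "\<dots> = 0" using R by simp
      finally show "(\<Sum>i\<le>n. c i * hom_eval a d i p) = 0" .
    qed
  qed
  then show ?thesis unfolding nondegenerate_def by simp
qed

text \<open>Replaces Zariski openness by a metric condition at one base point: a polynomial
  vanishing on \<open>S\<close> has infinitely many roots on the line from \<open>a0\<close> to
  \<open>x\<close>, hence vanishes at \<open>x\<close>, the point with parameter 1.\<close>

lemma supported_on_subset_zclosure:
  fixes a0 :: "'i \<Rightarrow> complex"
  assumes "\<And>x. x \<in> supported_on I \<Longrightarrow> \<exists>\<epsilon>>0. \<forall>s. cmod s < \<epsilon> \<longrightarrow> (\<lambda>i. a0 i + s * (x i - a0 i)) \<in> S"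
  shows "supported_on I \<subseteq> zclosure S"
proof
  fix x assume x: "x \<in> supported_on I"
  show "x \<in> zclosure S"
  proof (rule ccontr)
    assume "x \<notin> zclosure S"
    then obtain p where p: "p \<in> polyfun" "\<forall>y\<in>S. p y = 0" "p x \<noteq> 0" using not_in_zclosure by blast
    obtain P where P: "\<And>s. poly P s = p (\<lambda>i. a0 i + s * (x i - a0 i))"
      using polyfun_on_line[OF p(1), of a0 "\<lambda>i. x i - a0 i"] by blast
    obtain \<epsilon> where eps: "\<epsilon> > 0" "\<And>s. cmod s < \<epsilon> \<Longrightarrow> (\<lambda>i. a0 i + s * (x i - a0 i)) \<in> S"
      using assms[OF x] by blast
    have "poly P 1 \<noteq> 0" using p(3) P by simp
    then have "finite {s. poly P s = 0}" using poly_roots_finite[of P] by force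
    moreover have "complex_of_real ` {0<..<\<epsilon>} \<subseteq> {s. poly P s = 0}"
      using eps(2) p(2) P by auto
    ultimately have "finite (complex_of_real ` {0<..<\<epsilon>})" by (rule rev_finite_subset)
    then have "finite {0<..<\<epsilon>}" by (rule finite_imageD) (auto simp: inj_on_def)
    then show False using eps(1) infinite_Ioo by blast
  qed
qed

text \<open>The monomial \<open>x ^ d\<close> dominates every other monomial of degree d, so a
  perturbation of relative size below 1 cannot cancel it. It serves for the first and last
  coordinates of the base morphism, with \<open>x\<close> the larger of the two homogeneous
  coordinates.\<close>

lemma perturbed_power_nonzero:
  fixes v :: "nat \<Rightarrow> complex"
  assumes "cmod y \<le> cmod x" "x \<noteq> 0" "(\<Sum>j\<le>d. cmod (v j)) \<le> K" "cmod s * K < 1"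
    and "\<And>j. j \<le> d \<Longrightarrow> cmod (m j) \<le> cmod x ^ d"
  shows "x ^ d + s * (\<Sum>j\<le>d. v j * m j) \<noteq> 0"
proof
  assume "x ^ d + s * (\<Sum>j\<le>d. v j * m j) = 0"
  then have "x ^ d = - (s * (\<Sum>j\<le>d. v j * m j))" by (simp add: add_eq_0_iff2)
  then have "cmod x ^ d = cmod s * cmod (\<Sum>j\<le>d. v j * m j)" by (metis norm_minus_cancel norm_mult norm_power)
  also have "\<dots> \<le> cmod s * (\<Sum>j\<le>d. cmod (v j) * cmod x ^ d)"
    by (intro mult_left_mono order_trans[OF norm_sum] sum_mono) (auto simp: norm_mult intro!: mult_left_mono assms)
  also have "\<dots> \<le> cmod s * (K * cmod x ^ d)"
    unfolding sum_distrib_right[symmetric] by (intro mult_left_mono mult_right_mono assms) auto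
  also have "\<dots> = (cmod s * K) * cmod x ^ d" by simp
  also have "\<dots> < 1 * cmod x ^ d" using assms by (intro mult_strict_right_mono) auto
  finally show False by simp
qed

lemma zdim_Mnd:
  assumes "1 \<le> n" "n \<le> d"
  shows "zdim (Mnd n d) = int ((n + 1) * (d + 1))"
proof -
  let ?I = "{..n} \<times> {..d}"
  \<comment> \<open>The base morphism has coordinates t^(d-i) u^i for i < n, and last coordinate
    u^d. Having both t^d and u^d excludes common zeros, and distinct columns give
    nondegeneracy.\<close>
  define col where "col i = (if i < n then i else d)" for i :: nat
  define a0 :: coeffs where "a0 = (\<lambda>(i, j). if i \<le> n \<and> j = col i then 1 else 0)"
  have col_inj: "i = k" if "i \<le> n" "k \<le> n" "col i = col k" for i k
    using that assms by (auto simp: col_def split: if_splits)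
  have col_le: "i \<le> n \<Longrightarrow> col i \<le> d" for i using assms by (auto simp: col_def)
  have near: "\<exists>\<epsilon>>0. \<forall>s. cmod s < \<epsilon> \<longrightarrow> (\<lambda>i. a0 i + s * (x i - a0 i)) \<in> Mnd n d"
    if x: "x \<in> supported_on ?I" for x
  proof -
    define v where "v = (\<lambda>i. x i - a0 i)"
    define K where "K = (\<Sum>i\<in>?I. cmod (v i))"
    have K0: "K \<ge> 0" unfolding K_def by (rule sum_nonneg) auto
    have a0_supp: "a0 (i, j) = 0" if "n < i \<or> d < j" for i j
      using that col_le[of i] by (auto simp: a0_def)
    have x_supp: "x (i, j) = 0" if "n < i \<or> d < j" for i j
      using that x by (auto simp: supported_on_def)
    have row: "(\<Sum>j\<le>d. cmod (v (i, j))) \<le> K" if "i \<le> n" for i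
    proof -
      have "(\<Sum>j\<le>d. cmod (v (i, j))) = (\<Sum>p\<in>(\<lambda>j. (i, j)) ` {..d}. cmod (v p))"
        by (subst sum.reindex) (auto simp: inj_on_def)
      also have "\<dots> \<le> K" unfolding K_def by (rule sum_mono2) (use that in auto)
      finally show ?thesis .
    qed
    have column: "(\<Sum>i\<le>n. cmod (v (i, j))) \<le> K" if "j \<le> d" for j
    proof -
      have "(\<Sum>i\<le>n. cmod (v (i, j))) = (\<Sum>p\<in>(\<lambda>i. (i, j)) ` {..n}. cmod (v p))"
        by (subst sum.reindex) (auto simp: inj_on_def)
      also have "\<dots> \<le> K" unfolding K_def by (rule sum_mono2) (use that in auto)
      finally show ?thesis .
    qed
    have "(\<lambda>i. a0 i + s * (x i - a0 i)) \<in> Mnd n d" if s: "cmod s < 1 / (K + 1)" for s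
    proof -
      define a where "a = (\<lambda>i. a0 i + s * v i)"
      have sK: "cmod s * K < 1"
      proof -
        have "cmod s * (K + 1) < 1" using s K0 by (simp add: field_simps)
        moreover have "cmod s * (K + 1) = cmod s * K + cmod s" by (simp add: distrib_left)
        ultimately show ?thesis using norm_ge_zero[of s] by linarith
      qed
      have he: "hom_eval a d i p = fst p ^ (d - col i) * snd p ^ col i
          + s * (\<Sum>j\<le>d. v (i, j) * (fst p ^ (d - j) * snd p ^ j))" if "i \<le> n" for i p
      proof -
        have "hom_eval a d i p = (\<Sum>j\<le>d. a0 (i, j) * (fst p ^ (d - j) * snd p ^ j))
           + s * (\<Sum>j\<le>d. v (i, j) * (fst p ^ (d - j) * snd p ^ j))"
          by (simp add: hom_eval_def a_def sum.distrib sum_distrib_left algebra_simps)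
        also have "(\<Sum>j\<le>d. a0 (i, j) * (fst p ^ (d - j) * snd p ^ j)) =
           (\<Sum>j\<le>d. if j = col i then fst p ^ (d - j) * snd p ^ j else 0)"
          by (rule sum.cong) (use that in \<open>auto simp: a0_def\<close>)
        finally show ?thesis using col_le[OF that] by simp
      qed
      have "is_morphism n d a" unfolding is_morphism_def
      proof (intro conjI allI impI)
        show "a (i, j) = 0" if "n < i \<or> d < j" for i j
          using that a0_supp x_supp by (simp add: a_def v_def)
        fix p :: "complex \<times> complex" assume p: "p \<noteq> (0, 0)"
        show "\<exists>i\<le>n. hom_eval a d i p \<noteq> 0"
        proof (cases "cmod (snd p) \<le> cmod (fst p)")
          case True
          then have "fst p \<noteq> 0" using p by (cases p) auto
          have "fst p ^ d + s * (\<Sum>j\<le>d. v (0, j) * (fst p ^ (d - j) * snd p ^ j)) \<noteq> 0"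
          proof (rule perturbed_power_nonzero[OF True \<open>fst p \<noteq> 0\<close> row sK])
            fix j assume "j \<le> d"
            have "cmod (fst p) ^ (d - j) * cmod (snd p) ^ j \<le> cmod (fst p) ^ (d - j) * cmod (fst p) ^ j"
              by (intro mult_left_mono power_mono True) auto
            then show "cmod (fst p ^ (d - j) * snd p ^ j) \<le> cmod (fst p) ^ d"
              using \<open>j \<le> d\<close> by (simp add: norm_mult norm_power power_add[symmetric])
          qed simp
          moreover have "col 0 = 0" using assms by (simp add: col_def)
          ultimately show ?thesis using he[of 0 p] by (intro exI[of _ 0]) simp
        next
          case False
          then have le: "cmod (fst p) \<le> cmod (snd p)" and "snd p \<noteq> 0" by auto
          have "snd p ^ d + s * (\<Sum>j\<le>d. v (n, j) * (fst p ^ (d - j) * snd p ^ j)) \<noteq> 0"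
          proof (rule perturbed_power_nonzero[OF le \<open>snd p \<noteq> 0\<close> row sK])
            fix j assume "j \<le> d"
            have "cmod (fst p) ^ (d - j) * cmod (snd p) ^ j \<le> cmod (snd p) ^ (d - j) * cmod (snd p) ^ j"
              by (intro mult_right_mono power_mono le) auto
            then show "cmod (fst p ^ (d - j) * snd p ^ j) \<le> cmod (snd p) ^ d"
              using \<open>j \<le> d\<close> by (simp add: norm_mult norm_power power_add[symmetric])
          qed simp
          then show ?thesis using he[of n p] by (intro exI[of _ n]) (simp add: col_def)
        qed
      qed
      moreover have "nondegenerate n d a" unfolding nondegenerate_iff
      proof (intro allI impI)
        fix c i assume c: "\<forall>j\<le>d. (\<Sum>i\<le>n. c i * a (i, j)) = 0" and "i \<le> n"
        \<comment> \<open>Diagonal dominance: for the largest entry of \<open>c\<close>, column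
          \<open>col k\<close> of the relation expresses \<open>c k\<close> by a perturbation
          strictly smaller than it.\<close>
        obtain k where k: "k \<le> n" "\<And>i. i \<le> n \<Longrightarrow> cmod (c i) \<le> cmod (c k)"
        proof -
          let ?M = "(\<lambda>i. cmod (c i)) ` {..n}"
          have "Max ?M \<in> ?M" by (rule Max_in) auto
          then obtain k where k: "Max ?M = cmod (c k)" "k \<in> {..n}" by (rule imageE)
          show ?thesis
          proof (rule that[of k])
            show "cmod (c i) \<le> cmod (c k)" if "i \<le> n" for i
              unfolding k(1)[symmetric] by (rule Max_ge) (use that in auto)
          qed (use k in simp)
        qed
        have "c k = 0"
        proof (rule ccontr)
          assume ck: "c k \<noteq> 0"
          have "0 = (\<Sum>i\<le>n. c i * a0 (i, col k)) + s * (\<Sum>i\<le>n. c i * v (i, col k))"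
            using c col_le[OF k(1)] by (simp add: a_def sum.distrib sum_distrib_left algebra_simps)
          also have "(\<Sum>i\<le>n. c i * a0 (i, col k)) = (\<Sum>i\<le>n. if i = k then c i else 0)"
            by (rule sum.cong) (use k col_inj in \<open>auto simp: a0_def\<close>)
          finally have "c k = - (s * (\<Sum>i\<le>n. c i * v (i, col k)))" using k by (simp add: eq_neg_iff_add_eq_0)
          then have "cmod (c k) = cmod s * cmod (\<Sum>i\<le>n. c i * v (i, col k))" by (metis norm_minus_cancel norm_mult)
          also have "\<dots> \<le> cmod s * (\<Sum>i\<le>n. cmod (c k) * cmod (v (i, col k)))"
            by (intro mult_left_mono order_trans[OF norm_sum] sum_mono)
               (auto simp: norm_mult intro!: mult_right_mono k)
          also have "\<dots> \<le> cmod s * (cmod (c k) * K)"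
            unfolding sum_distrib_left[symmetric] by (intro mult_left_mono column col_le k) auto
          also have "\<dots> = (cmod s * K) * cmod (c k)" by simp
          also have "\<dots> < 1 * cmod (c k)" using ck sK by (intro mult_strict_right_mono) auto
          finally show False by simp
        qed
        then show "c i = 0" using k(2)[OF \<open>i \<le> n\<close>] by simp
      qed
      ultimately show ?thesis by (simp add: Mnd_def a_def v_def)
    qed
    then show ?thesis using K0 by (intro exI[of _ "1 / (K + 1)"]) auto
  qed
  have "(\<lambda>_. 0) \<in> supported_on ?I" by (simp add: supported_on_def)
  from near[OF this] obtain \<epsilon> where "\<epsilon> > 0" "\<And>s. cmod s < \<epsilon> \<Longrightarrow> (\<lambda>i. a0 i + s * (0 - a0 i)) \<in> Mnd n d"
    by blast
  from this(2)[of 0] this(1) have "Mnd n d \<noteq> {}" by auto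
  have "Mnd n d \<subseteq> supported_on ?I"
    by (auto simp: Mnd_def is_morphism_def supported_on_def)
  from zdim_dense_in_supported_on[OF _ this supported_on_subset_zclosure[OF near] \<open>Mnd n d \<noteq> {}\<close>]
  show ?thesis by (simp add: card_cartesian_product)
qed

section \<open>Factorization through an injective parametrization\<close>

definition subst_poly :: "coeffs \<Rightarrow> nat \<Rightarrow> complex poly \<Rightarrow> complex poly \<Rightarrow> nat \<Rightarrow> complex poly" where
  "subst_poly b e U W i = (\<Sum>j\<le>e. smult (b (i, j)) (U ^ (e - j) * W ^ j))"

lemma poly_subst_poly: "poly (subst_poly b e U W i) t = hom_eval b e i (poly U t, poly W t)"
  by (simp add: subst_poly_def hom_eval_def poly_sum mult.assoc)

lemma proportional_iff_cross:
  assumes "\<exists>i\<le>n. x i \<noteq> 0" "\<exists>i\<le>n. y i \<noteq> (0::complex)"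
  shows "proportional n x y \<longleftrightarrow> (\<forall>i\<le>n. \<forall>j\<le>n. x i * y j = x j * y i)"
proof
  assume "proportional n x y"
  then show "\<forall>i\<le>n. \<forall>j\<le>n. x i * y j = x j * y i" by (auto simp: proportional_def)
next
  assume cross: "\<forall>i\<le>n. \<forall>j\<le>n. x i * y j = x j * y i"
  from assms(2) obtain k where k: "k \<le> n" "y k \<noteq> 0" by auto
  from assms(1) obtain l where l: "l \<le> n" "x l \<noteq> 0" by auto
  have "x k \<noteq> 0"
  proof
    assume "x k = 0"
    then have "x l * y k = 0" using cross k l by auto
    with k l show False by simp
  qed
  then show "proportional n x y" unfolding proportional_def
    using cross k by (intro exI[of _ "x k / y k"]) (auto simp: field_simps)
qed

lemma proportional_trans:
  "proportional n x y \<Longrightarrow> proportional n y z \<Longrightarrow> proportional n x z"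
  unfolding proportional_def by (metis mult.assoc mult_eq_0_iff)

lemma proportional_sym: "proportional n x y \<Longrightarrow> proportional n y x"
proof -
  assume "proportional n x y"
  then obtain c where "c \<noteq> 0" "\<forall>i\<le>n. x i = c * y i" by (auto simp: proportional_def)
  then show ?thesis unfolding proportional_def by (intro exI[of _ "1 / c"]) auto
qed

lemma coeff_mult_degree_le:
  fixes p q :: "complex poly"
  assumes "degree p \<le> k" "degree q \<le> l"
  shows "coeff (p * q) (k + l) = coeff p k * coeff q l"
proof -
  have "coeff (p * q) (k + l) = (\<Sum>i\<le>k + l. if i = k then coeff p k * coeff q l else 0)"
    unfolding coeff_mult
  proof (rule sum.cong[OF refl])
    fix i assume "i \<in> {..k + l}"
    consider "i < k" | "i = k" | "i > k" by linarith
    then show "coeff p i * coeff q (k + l - i) = (if i = k then coeff p k * coeff q l else 0)"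
      using assms by cases (auto simp: coeff_eq_0)
  qed
  then show ?thesis by simp
qed

lemma degree_power_bound:
  fixes p :: "complex poly"
  assumes "degree p \<le> k"
  shows "degree (p ^ m) \<le> m * k"
  by (metis assms degree_power_le mult.commute mult_le_mono1 order_trans)

lemma coeff_power_degree_le:
  fixes p :: "complex poly"
  assumes "degree p \<le> k"
  shows "coeff (p ^ m) (m * k) = coeff p k ^ m"
proof (induction m)
  case (Suc m)
  have "coeff (p * p ^ m) (k + m * k) = coeff p k * coeff (p ^ m) (m * k)"
    by (rule coeff_mult_degree_le[OF assms degree_power_bound[OF assms]])
  with Suc show ?case by simp
qed simp

lemma degree_subst_poly:
  assumes "degree U \<le> k" "degree W \<le> k"
  shows "degree (subst_poly b e U W i) \<le> e * k"
  unfolding subst_poly_def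
proof (rule degree_sum_le)
  fix j assume "j \<in> {..e}"
  have "degree (U ^ (e - j) * W ^ j) \<le> (e - j) * k + j * k"
    by (rule order_trans[OF degree_mult_le add_mono[OF degree_power_bound degree_power_bound]]) (rule assms)+
  also have "\<dots> = e * k" using \<open>j \<in> {..e}\<close> by (simp add: add_mult_distrib[symmetric])
  finally show "degree (smult (b (i, j)) (U ^ (e - j) * W ^ j)) \<le> e * k"
    using degree_smult_le order_trans by blast
qed simp

lemma coeff_subst_poly:
  assumes "degree U \<le> k" "degree W \<le> k"
  shows "coeff (subst_poly b e U W i) (e * k) = hom_eval b e i (coeff U k, coeff W k)"
  unfolding subst_poly_def hom_eval_def coeff_sum
proof (rule sum.cong[OF refl])
  fix j assume "j \<in> {..e}"
  then have "e * k = (e - j) * k + j * k" by (simp add: add_mult_distrib[symmetric])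
  then have "coeff (U ^ (e - j) * W ^ j) (e * k) = coeff U k ^ (e - j) * coeff W k ^ j"
    using coeff_mult_degree_le[OF degree_power_bound[OF assms(1)] degree_power_bound[OF assms(2)], of "e - j" j]
    by (simp add: coeff_power_degree_le assms)
  then show "coeff (smult (b (i, j)) (U ^ (e - j) * W ^ j)) (e * k) =
      b (i, j) * fst (coeff U k, coeff W k) ^ (e - j) * snd (coeff U k, coeff W k) ^ j" by simp
qed

text \<open>After cancelling the gcd of \<open>A j\<close> and \<open>H j\<close> the two cofactors
  have no common root. A root of \<open>x\<close> would be a common zero of all \<open>A i\<close>,
  a root of \<open>y\<close> one of all \<open>H i\<close>, so by the fundamental theorem of algebra
  both are constant.\<close>

lemma proportional_poly_tuples:
  fixes A H :: "nat \<Rightarrow> complex poly"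
  assumes cross: "\<And>i j. i \<le> n \<Longrightarrow> j \<le> n \<Longrightarrow> A i * H j = A j * H i"
    and A: "\<And>t. \<exists>i\<le>n. poly (A i) t \<noteq> 0" and H: "\<And>t. \<exists>i\<le>n. poly (H i) t \<noteq> 0"
  shows "\<exists>c. c \<noteq> 0 \<and> (\<forall>i\<le>n. A i = smult c (H i))"
proof -
  obtain j where j: "j \<le> n" "H j \<noteq> 0" using H[of 0] by (metis poly_0)
  obtain l where l: "l \<le> n" "A l \<noteq> 0" using A[of 0] by (metis poly_0)
  have Aj: "A j \<noteq> 0"
  proof
    assume "A j = 0"
    then have "A l * H j = 0" using cross[OF l(1) j(1)] by simp
    with l j show False by simp
  qed
  define D where "D = gcd (A j) (H j)"
  have D: "D \<noteq> 0" using j by (simp add: D_def)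
  obtain x y where x: "A j = x * D" and y: "H j = y * D" and xy: "coprime x y"
    using gcd_coprime_exists[of "A j" "H j"] j unfolding D_def by auto
  have rel: "A i * y = x * H i" if "i \<le> n" for i
  proof -
    have "D * (A i * y) = D * (x * H i)" using cross[OF that j(1)] x y by (simp add: mult_ac)
    then show ?thesis using D by simp
  qed
  have no_common: "\<not> (poly x z = 0 \<and> poly y z = 0)" for z
    using xy coprime_poly_0 by blast
  have "degree y = 0"
  proof (rule ccontr)
    assume "degree y \<noteq> 0"
    then have "\<not> constant (poly y)" by (simp add: constant_degree)
    then obtain z where z: "poly y z = 0" using fundamental_theorem_of_algebra by blast
    have "poly (H i) z = 0" if "i \<le> n" for i
      using rel[OF that] z no_common[of z] by (metis mult_eq_0_iff poly_mult)
    then show False using H[of z] by auto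
  qed
  moreover have "degree x = 0"
  proof (rule ccontr)
    assume "degree x \<noteq> 0"
    then have "\<not> constant (poly x)" by (simp add: constant_degree)
    then obtain z where z: "poly x z = 0" using fundamental_theorem_of_algebra by blast
    have "poly (A i) z = 0" if "i \<le> n" for i
      using rel[OF that] z no_common[of z] by (metis mult_eq_0_iff poly_mult)
    then show False using A[of z] by auto
  qed
  moreover have "x \<noteq> 0" "y \<noteq> 0" using x y j Aj by auto
  ultimately obtain x0 y0 where xy0: "x = [:x0:]" "y = [:y0:]" "x0 \<noteq> 0" "y0 \<noteq> 0"
    by (metis degree_eq_zeroE pCons_eq_0_iff)
  have "A i = smult (x0 / y0) (H i)" if "i \<le> n" for i
  proof -
    have "smult y0 (A i) = smult x0 (H i)" using rel[OF that] xy0 by (simp add: mult.commute)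
    then have "smult (1 / y0) (smult y0 (A i)) = smult (1 / y0) (smult x0 (H i))" by simp
    then show ?thesis using xy0 by simp
  qed
  then show ?thesis using xy0 by (intro exI[of _ "x0 / y0"]) auto
qed

text \<open>Such a polynomial is a constant times [:- w, 1:] to the power \<open>r\<close>. The
  formula recovers \<open>w\<close> rationally, whatever its multiplicity, because \<open>r\<close>
  is invertible in characteristic 0.\<close>

lemma single_root_coeff:
  fixes p :: "complex poly"
  assumes "degree p = r" "r > 0" "{z. poly p z = 0} = {w}"
  shows "coeff p (r - 1) = - (of_nat r * w * coeff p r)"
proof -
  have "p \<noteq> 0" using assms by auto
  have "p = smult (lead_coeff p) ([:- w, 1:] ^ order w p)"
    using complex_poly_decompose[of p] unfolding assms(3) by simp
  moreover from this have "degree p = order w p"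
    using \<open>p \<noteq> 0\<close> by (metis degree_linear_power degree_smult_eq leading_coeff_0_iff)
  ultimately have p: "p = smult (lead_coeff p) ([:- w, 1:] ^ r)" using assms(1) by simp
  have "coeff ([:- w, 1:] ^ r) (r - 1) = - (of_nat r * w)"
    using assms(2) coeff_linear_poly_power[of "r - 1" r "- w" 1] binomial_symmetric[of "r - 1" r]
    by (cases r) (auto simp del: power_Suc)
  then show ?thesis using assms(1) by (subst p) simp
qed

definition cross_eq :: "nat \<Rightarrow> (nat \<Rightarrow> complex poly) \<Rightarrow> (nat \<Rightarrow> complex poly) \<Rightarrow> complex \<Rightarrow> complex \<Rightarrow> bool" where
  "cross_eq n A B t s \<longleftrightarrow> (\<forall>i\<le>n. \<forall>j\<le>n. poly (A i) t * poly (B j) s = poly (A j) t * poly (B i) s)"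

text \<open>For generic t, the forms F i j (t, s) = A i (t) B j (s) - A j (t) B i (s) have exactly one
  common zero s = \<phi> t. A non-zero element P of minimal degree r in s of the ideal they generate has the
  same zeros for generic t, hence is a constant multiple of (s - \<phi> t) ^ r,
  and \<phi> is read off its two leading coefficients.\<close>
lemma unique_solution_rational:
  fixes A B :: "nat \<Rightarrow> complex poly"
  assumes E: "finite E" and ex: "\<And>t. t \<notin> E \<Longrightarrow> \<exists>s. cross_eq n A B t s"
    and uniq: "\<And>t s s'. cross_eq n A B t s \<Longrightarrow> cross_eq n A B t s' \<Longrightarrow> s = s'"
  shows "\<exists>U W E'. W \<noteq> 0 \<and> finite E' \<and>
     (\<forall>t. t \<notin> E' \<longrightarrow> poly W t \<noteq> 0 \<and> cross_eq n A B t (poly U t / poly W t))"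
proof -
  let ?R = "cross_eq n A B"
  \<comment> \<open>The outer variable of these bivariate polynomials is s and their coefficients
    are polynomials in t; \<open>lift\<close> views a polynomial in s as independent of t.\<close>
  define lift :: "complex poly \<Rightarrow> complex poly poly" where "lift q = (\<Sum>k\<le>degree q. monom [:coeff q k:] k)" for q
  define ev :: "complex poly poly \<Rightarrow> complex \<Rightarrow> complex \<Rightarrow> complex" where "ev G t s = poly (poly G [:s:]) t" for G t s
  define F where "F i j = smult (A i) (lift (B j)) - smult (A j) (lift (B i))" for i j
  have ev_lift: "ev (lift q) t s = poly q s" for q t s
    by (simp add: ev_def lift_def poly_sum poly_monom poly_altdef[of q])
  have ev_simps: "ev (G + H) t s = ev G t s + ev H t s" "ev (G - H) t s = ev G t s - ev H t s"
    "ev (G * H) t s = ev G t s * ev H t s" "ev (smult c G) t s = poly c t * ev G t s" "ev 0 t s = 0" for G H c t s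
    by (simp_all add: ev_def)
  have ev_F: "ev (F i j) t s = poly (A i) t * poly (B j) s - poly (A j) t * poly (B i) s" for i j t s
    by (simp add: F_def ev_simps ev_lift)
  have R_iff: "?R t s \<longleftrightarrow> (\<forall>i\<le>n. \<forall>j\<le>n. ev (F i j) t s = 0)" for t s
    by (simp add: cross_eq_def ev_F)
  define I where "I = {G. \<exists>h. G = (\<Sum>i\<le>n. \<Sum>j\<le>n. h i j * F i j)}"
  have ev_I: "ev G t s = 0" if "G \<in> I" "?R t s" for G t s
  proof -
    from that(1) obtain h where "G = (\<Sum>i\<le>n. \<Sum>j\<le>n. h i j * F i j)" by (auto simp: I_def)
    then have "ev G t s = (\<Sum>i\<le>n. \<Sum>j\<le>n. ev (h i j) t s * ev (F i j) t s)"
      by (simp add: ev_def poly_sum)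
    also have "\<dots> = 0" using that(2) by (intro sum.neutral) (auto simp: R_iff)
    finally show ?thesis .
  qed
  have F_I: "F i j \<in> I" if "i \<le> n" "j \<le> n" for i j
  proof -
    have "(\<Sum>k\<le>n. \<Sum>l\<le>n. (if k = i \<and> l = j then 1 else 0) * F k l) =
          (\<Sum>k\<le>n. if k = i then (\<Sum>l\<le>n. if l = j then F k l else 0) else 0)"
    proof (rule sum.cong[OF refl])
      fix k
      show "(\<Sum>l\<le>n. (if k = i \<and> l = j then 1 else 0) * F k l) =
          (if k = i then (\<Sum>l\<le>n. if l = j then F k l else 0) else 0)"
        by (cases "k = i") (simp_all add: if_distrib[of "\<lambda>x. x * _"] cong: if_cong)
    qed
    also have "\<dots> = F i j" using that by simp
    finally show ?thesis unfolding I_def mem_Collect_eq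
      by (intro exI[of _ "\<lambda>k l. if k = i \<and> l = j then 1 else 0"]) (rule sym)
  qed
  have I_comb: "smult c G - P * q \<in> I" if "G \<in> I" "P \<in> I" for c G P q
  proof -
    from that obtain g p where "G = (\<Sum>i\<le>n. \<Sum>j\<le>n. g i j * F i j)" "P = (\<Sum>i\<le>n. \<Sum>j\<le>n. p i j * F i j)"
      by (auto simp: I_def)
    then have "[:c:] * G - q * P = (\<Sum>i\<le>n. \<Sum>j\<le>n. ([:c:] * g i j - q * p i j) * F i j)"
      by (simp only: sum_distrib_left left_diff_distrib sum_subtractf mult.assoc)
    then have "smult c G - P * q = (\<Sum>i\<le>n. \<Sum>j\<le>n. ([:c:] * g i j - q * p i j) * F i j)"
      by (simp add: mult.commute)
    then show ?thesis unfolding I_def mem_Collect_eq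
      by (intro exI[of _ "\<lambda>i j. [:c:] * g i j - q * p i j"])
  qed
  \<comment> \<open>If all generators vanished, every pair (t, s) would be a solution, against
    uniqueness.\<close>
  have "\<exists>G. G \<in> I \<and> G \<noteq> 0"
  proof (rule ccontr)
    assume "\<not> ?thesis"
    then have "F i j = 0" if "i \<le> n" "j \<le> n" for i j using F_I that by blast
    then have "?R t s" for t s by (simp add: R_iff ev_simps)
    then have "(0::complex) = 1" using uniq[of 0 0 1] by blast
    then show False by simp
  qed
  then obtain P where P: "P \<in> I" "P \<noteq> 0" and Pmin: "\<And>G. G \<in> I \<Longrightarrow> G \<noteq> 0 \<Longrightarrow> degree P \<le> degree G"
    using ex_has_least_nat[of "\<lambda>G. G \<in> I \<and> G \<noteq> 0" _ degree] by blast
  define r where "r = degree P"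
  define lc where "lc = coeff P r"
  have lc0: "lc \<noteq> 0" using P(2) by (simp add: lc_def r_def)
  have root_R: "?R t s" if "poly lc t \<noteq> 0" "ev P t s = 0" for t s
    unfolding R_iff
  proof (intro allI impI)
    fix i j assume ij: "i \<le> n" "j \<le> n"
    \<comment> \<open>Pseudo-division avoids denominators in t. The remainder lies in the ideal and
      has smaller degree than \<open>P\<close>, so it is 0; hence zeros of \<open>P\<close> are
      solutions wherever \<open>lc\<close> does not vanish.\<close>
    obtain q m where qm: "pseudo_divmod (F i j) P = (q, m)" by fastforce
    let ?N = "Suc (degree (F i j)) - degree P"
    from pseudo_divmod[OF P(2) qm] have
      eq: "smult (lc ^ ?N) (F i j) = P * q + m" and m: "m = 0 \<or> degree m < degree P"
      by (auto simp: lc_def r_def)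
    have "m = smult (lc ^ ?N) (F i j) - P * q" using eq by simp
    then have "m \<in> I" using I_comb[OF F_I[OF ij] P(1)] by simp
    then have "m = 0" using m Pmin[of m] by (metis not_le)
    then have "ev (smult (lc ^ ?N) (F i j)) t s = ev (P * q) t s" using eq by simp
    then have "poly lc t ^ ?N * ev (F i j) t s = 0" using that(2) by (simp add: ev_simps)
    then show "ev (F i j) t s = 0" using that(1) by simp
  qed
  define E' where "E' = E \<union> {t. poly lc t = 0}"
  have finE': "finite E'" using E poly_roots_finite[OF lc0] by (simp add: E'_def)
  define Pt where "Pt t = (\<Sum>l\<le>r. monom (poly (coeff P l) t) l)" for t
  have coeff_Pt: "coeff (Pt t) l = (if l \<le> r then poly (coeff P l) t else 0)" for t l
    by (simp add: Pt_def coeff_sum)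
  have poly_Pt: "poly (Pt t) s = ev P t s" for t s
    by (simp add: Pt_def ev_def poly_sum poly_monom poly_altdef[of P] r_def)
  have degPt: "degree (Pt t) = r" if "t \<notin> E'" for t
  proof (rule antisym)
    show "degree (Pt t) \<le> r" by (rule degree_le) (simp add: coeff_Pt)
    show "r \<le> degree (Pt t)" by (rule le_degree) (use that in \<open>auto simp: coeff_Pt E'_def lc_def\<close>)
  qed
  have sol: "\<exists>s. ?R t s \<and> ev P t s = 0 \<and> {z. poly (Pt t) z = 0} = {s}" if t: "t \<notin> E'" for t
  proof -
    have tE: "t \<notin> E" "poly lc t \<noteq> 0" using t by (auto simp: E'_def)
    obtain s where s: "?R t s" using ex[OF tE(1)] by blast
    moreover have zero: "ev P t s = 0" using ev_I[OF P(1) s] .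
    moreover have "{z. poly (Pt t) z = 0} = {s}"
    proof (rule set_eqI)
      fix z
      show "z \<in> {z. poly (Pt t) z = 0} \<longleftrightarrow> z \<in> {s}"
        using uniq[OF root_R[OF tE(2), of z] s] zero unfolding poly_Pt by blast
    qed
    ultimately show ?thesis by blast
  qed
  have "r > 0"
  proof (rule ccontr)
    assume "\<not> r > 0"
    obtain t where t: "t \<notin> E'" using finE' infinite_UNIV_char_0[where 'a = complex] ex_new_if_finite by blast
    obtain s where "poly (Pt t) s = 0" using sol[OF t] poly_Pt by auto
    moreover have "degree (Pt t) = 0" using degPt[OF t] \<open>\<not> r > 0\<close> by simp
    moreover have "coeff (Pt t) 0 \<noteq> 0" using \<open>\<not> r > 0\<close> t by (auto simp: coeff_Pt E'_def lc_def)
    ultimately show False by (auto elim!: degree_eq_zeroE)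
  qed
  define U where "U = - coeff P (r - 1)"
  define W where "W = smult (of_nat r) lc"
  have "poly W t \<noteq> 0 \<and> ?R t (poly U t / poly W t)" if t: "t \<notin> E'" for t
  proof -
    obtain s where s: "?R t s" "{z. poly (Pt t) z = 0} = {s}" using sol[OF t] by blast
    have "coeff (Pt t) (r - 1) = - (of_nat r * s * coeff (Pt t) r)"
      by (rule single_root_coeff[OF degPt[OF t] \<open>r > 0\<close> s(2)])
    then have "poly U t = s * poly W t" by (simp add: coeff_Pt U_def W_def lc_def mult_ac)
    moreover have W: "poly W t \<noteq> 0" using t \<open>r > 0\<close> by (simp add: W_def E'_def)
    ultimately show ?thesis using s(1) by simp
  qed
  moreover have "W \<noteq> 0" using lc0 \<open>r > 0\<close> by (simp add: W_def)
  ultimately show ?thesis using finE'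
    by (intro exI[of _ U] exI[of _ W] exI[of _ E'] conjI) simp_all
qed

text \<open>Injectivity of \<open>b\<close> makes the lift of the image point to its parameter
  unique, hence a rational function U / W of t. Cleared of common factors, b(U, W) and
  \<open>a\<close> are proportional tuples without common zeros, so they differ by a
  constant.\<close>

lemma factor_through_injective:
  assumes n: "1 \<le> n" and a: "is_morphism n d a" "nondegenerate n d a"
    and b: "is_morphism n e b" "injective_morphism n e b"
    and cov: "\<And>p. p \<noteq> (0, 0) \<Longrightarrow>
      \<exists>q. q \<noteq> (0, 0) \<and> proportional n (\<lambda>i. hom_eval a d i p) (\<lambda>i. hom_eval b e i q)"
  shows "\<exists>U W k c. coprime U W \<and> degree U \<le> k \<and> degree W \<le> k \<and> (coeff U k, coeff W k) \<noteq> (0, 0) \<and>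
    c \<noteq> 0 \<and> (\<forall>i\<le>n. aff_poly a d i = smult c (subst_poly b e U W i)) \<and> d = e * k"
proof -
  have a_nz: "\<exists>i\<le>n. hom_eval a d i p \<noteq> 0" if "p \<noteq> (0, 0)" for p
    using a(1) that unfolding is_morphism_def by blast
  have b_nz: "\<exists>i\<le>n. hom_eval b e i p \<noteq> 0" if "p \<noteq> (0, 0)" for p
    using b(1) that unfolding is_morphism_def by blast
  let ?A = "aff_poly a d" and ?B = "aff_poly b e"
  \<comment> \<open>The parameters sent to the image of infinity under \<open>b\<close>, for which
    no affine lift s need exist.\<close>
  define E where "E = {t. proportional n (\<lambda>i. hom_eval a d i (t, 1)) (\<lambda>i. b (i, 0))}"
  have cross_iff: "proportional n (\<lambda>i. hom_eval a d i (t, 1)) (\<lambda>i. hom_eval b e i (s, 1)) \<longleftrightarrow>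
     cross_eq n ?A ?B t s" for t s
    using proportional_iff_cross[OF a_nz[of "(t, 1)"] b_nz[of "(s, 1)"]] by (simp add: cross_eq_def poly_aff_poly)
  \<comment> \<open>Infinitely many such parameters would force two coordinates of \<open>a\<close>
    to satisfy a linear relation, against nondegeneracy; the second index exists because n is at
    least 1.\<close>
  have finE: "finite E"
  proof (rule ccontr)
    assume inf: "infinite E"
    obtain j where j: "j \<le> n" "b (j, 0) \<noteq> 0" using b_nz[of "(1, 0)"] by (auto simp: hom_eval_infinity)
    define i where "i = (if j = 0 then 1 else 0 :: nat)"
    have i: "i \<le> n" "i \<noteq> j" using n by (auto simp: i_def)
    let ?Q = "smult (b (j, 0)) (?A i) - smult (b (i, 0)) (?A j)"
    have "E \<subseteq> {t. poly ?Q t = 0}"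
      using i(1) j(1) by (auto simp: E_def proportional_def poly_aff_poly)
    then have "?Q = 0" using inf poly_roots_finite[of ?Q] finite_subset by blast
    then have Q: "b (j, 0) * a (i, l) - b (i, 0) * a (j, l) = 0" if "l \<le> d" for l
      using coeff_aff_poly[OF that, of a] by (metis coeff_0 coeff_diff coeff_smult)
    define c where "c k = (if k = i then b (j, 0) else if k = j then - b (i, 0) else 0)" for k
    have "(\<Sum>k\<le>n. c k * a (k, l)) = 0" if "l \<le> d" for l
    proof -
      have "(\<Sum>k\<le>n. c k * a (k, l)) = (\<Sum>k\<in>{i, j}. c k * a (k, l))"
        by (rule sum.mono_neutral_right) (use i j in \<open>auto simp: c_def\<close>)
      also have "\<dots> = 0" using Q[OF that] i by (simp add: c_def)
      finally show ?thesis .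
    qed
    then have "c i = 0" using a(2) i(1) unfolding nondegenerate_iff by blast
    then show False using j by (simp add: c_def)
  qed
  have "\<exists>U W E'. W \<noteq> 0 \<and> finite E' \<and>
     (\<forall>t. t \<notin> E' \<longrightarrow> poly W t \<noteq> 0 \<and> cross_eq n ?A ?B t (poly U t / poly W t))"
  proof (rule unique_solution_rational[OF finE])
    fix t assume "t \<notin> E"
    obtain q where q: "q \<noteq> (0, 0)" "proportional n (\<lambda>i. hom_eval a d i (t, 1)) (\<lambda>i. hom_eval b e i q)"
      using cov[of "(t, 1)"] by auto
    have "snd q \<noteq> 0"
    proof
      assume "snd q = 0"
      then have fq: "fst q \<noteq> 0" and qq: "q = (fst q * 1, fst q * 0)" using q(1) by (cases q; auto)+
      have "hom_eval b e i q = fst q ^ e * b (i, 0)" for i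
        by (subst qq, subst hom_eval_scale) (simp add: hom_eval_infinity)
      then have "proportional n (\<lambda>i. hom_eval b e i q) (\<lambda>i. b (i, 0))"
        unfolding proportional_def by (intro exI[of _ "fst q ^ e"]) (simp add: fq)
      then show False using proportional_trans[OF q(2)] \<open>t \<notin> E\<close> by (simp add: E_def)
    qed
    then have qq: "q = (snd q * (fst q / snd q), snd q * 1)" by (cases q) auto
    have "hom_eval b e i q = snd q ^ e * hom_eval b e i (fst q / snd q, 1)" for i
      by (subst qq, subst hom_eval_scale) simp
    then have "proportional n (\<lambda>i. hom_eval b e i q) (\<lambda>i. hom_eval b e i (fst q / snd q, 1))"
      using \<open>snd q \<noteq> 0\<close> unfolding proportional_def by (intro exI[of _ "snd q ^ e"]) auto
    then show "\<exists>s. cross_eq n ?A ?B t s"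
      using proportional_trans[OF q(2)] cross_iff by blast
  next
    fix t s s'
    assume "cross_eq n ?A ?B t s" "cross_eq n ?A ?B t s'"
    from proportional_trans[OF proportional_sym[OF this(1)[folded cross_iff]] this(2)[folded cross_iff]]
    have "proportional n (\<lambda>i. hom_eval b e i (s, 1)) (\<lambda>i. hom_eval b e i (s', 1))" .
    then obtain c where "(s, 1) = (c * s', c * 1)"
      using b(2)[unfolded injective_morphism_def, rule_format, of "(s, 1)" "(s', 1)"] by auto
    then show "s = s'" by auto
  qed
  then obtain U0 W0 E' where UW0: "W0 \<noteq> 0" "finite E'" "\<And>t. t \<notin> E' \<Longrightarrow> poly W0 t \<noteq> 0"
    "\<And>t i j. t \<notin> E' \<Longrightarrow> i \<le> n \<Longrightarrow> j \<le> n \<Longrightarrow> poly (?A i) t * poly (?B j) (poly U0 t / poly W0 t) =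
                    poly (?A j) t * poly (?B i) (poly U0 t / poly W0 t)" unfolding cross_eq_def by blast
  define G where "G = gcd U0 W0"
  have G: "G \<noteq> 0" using UW0(1) by (simp add: G_def)
  obtain U W where U: "U0 = U * G" and W: "W0 = W * G" and UW: "coprime U W"
    using gcd_coprime_exists[of U0 W0] UW0(1) unfolding G_def by auto
  let ?H = "subst_poly b e U W"
  have cross: "?A i * ?H j = ?A j * ?H i" if ij: "i \<le> n" "j \<le> n" for i j
  proof -
    have "?A i * ?H j - ?A j * ?H i = 0"
    proof (rule poly_eq_0_if_cofinitely_many_roots[OF UW0(2)])
      fix t assume t: "t \<notin> E'"
      have nz: "poly W t \<noteq> 0" "poly G t \<noteq> 0" using UW0(3)[OF t] W by auto
      define s where "s = poly U0 t / poly W0 t"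
      have s: "poly U t = poly W t * s" using nz by (simp add: s_def U W)
      have "poly (?H k) t = poly W t ^ e * poly (?B k) s" for k
        unfolding poly_subst_poly poly_aff_poly s
        using hom_eval_scale[of b e k "poly W t" s 1] by simp
      then show "poly (?A i * ?H j - ?A j * ?H i) t = 0"
        using UW0(4)[OF t ij] by (simp add: s_def algebra_simps)
    qed
    then show ?thesis by simp
  qed
  have UWnz: "(poly U t, poly W t) \<noteq> (0, 0)" for t using UW coprime_poly_0 by blast
  have "\<exists>c. c \<noteq> 0 \<and> (\<forall>i\<le>n. ?A i = smult c (?H i))"
  proof (rule proportional_poly_tuples[OF cross])
    show "\<exists>i\<le>n. poly (?A i) t \<noteq> 0" for t using a_nz[of "(t, 1)"] by (simp add: poly_aff_poly)
    show "\<exists>i\<le>n. poly (?H i) t \<noteq> 0" for t using b_nz[OF UWnz] by (simp add: poly_subst_poly)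
  qed
  then obtain c where c: "c \<noteq> 0" "\<And>i. i \<le> n \<Longrightarrow> ?A i = smult c (?H i)" by blast
  define k where "k = max (degree U) (degree W)"
  have k: "degree U \<le> k" "degree W \<le> k" by (auto simp: k_def)
  \<comment> \<open>This pair is the value of (U : W) at infinity. Since \<open>b\<close> has no
    zero there, some coordinate of b(U, W) has degree exactly \<open>e * k\<close>; since
    \<open>a\<close> is non-zero at infinity, some coordinate of \<open>a\<close> has degree exactly
    \<open>d\<close>.\<close>
  have top: "(coeff U k, coeff W k) \<noteq> (0, 0)"
  proof -
    have "U \<noteq> 0 \<or> W \<noteq> 0" using UWnz[of 0] by auto
    then show ?thesis
      by (cases "degree U \<le> degree W") (use W UW0(1) in \<open>auto simp: k_def max_def\<close>)
  qed
  have "d \<le> e * k"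
  proof -
    obtain i where i: "i \<le> n" "a (i, 0) \<noteq> 0" using a_nz[of "(1, 0)"] by (auto simp: hom_eval_infinity)
    have "coeff (?A i) d \<noteq> 0" using coeff_aff_poly[of 0 d a i] i by simp
    then have "coeff (?H i) d \<noteq> 0" using c i by auto
    then have "d \<le> degree (?H i)" by (rule le_degree)
    then show ?thesis using degree_subst_poly[OF k] order_trans by blast
  qed
  moreover have "e * k \<le> d"
  proof -
    obtain i where i: "i \<le> n" "hom_eval b e i (coeff U k, coeff W k) \<noteq> 0" using b_nz[OF top] by blast
    then have "coeff (?A i) (e * k) \<noteq> 0" using c coeff_subst_poly[OF k] by simp
    then have "e * k \<le> degree (?A i)" by (rule le_degree)
    then show ?thesis using degree_aff_poly order_trans by blast
  qed
  ultimately show ?thesis using UW k top c by (intro exI[of _ U] exI[of _ W] exI[of _ k] exI[of _ c]) auto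
qed

section \<open>Subalgebras of the power series ring\<close>

definition generators :: "nat set \<Rightarrow> nat set" where
  "generators S = {s \<in> S. 0 < s \<and> (\<forall>u\<in>S. \<forall>v\<in>S. 0 < u \<longrightarrow> 0 < v \<longrightarrow> s \<noteq> u + v)}"

lemma exists_decomposition:
  assumes "s \<in> S"
  shows "\<exists>gs. set gs \<subseteq> generators S \<and> sum_list gs = s"
  using assms
proof (induction s rule: less_induct)
  case (less s)
  consider "s = 0" | "s \<in> generators S" | u v where "u \<in> S" "v \<in> S" "0 < u" "0 < v" "s = u + v"
    using less.prems unfolding generators_def by blast
  then show ?case
  proof cases
    case 1
    then show ?thesis by (intro exI[of _ "[]"]) simp
  next
    case 2
    then show ?thesis by (intro exI[of _ "[s]"]) simp
  next
    case 3
    then obtain gs hs where "set gs \<subseteq> generators S" "sum_list gs = u" "set hs \<subseteq> generators S" "sum_list hs = v"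
      using less.IH[of u] less.IH[of v] by auto
    then show ?thesis using 3 by (intro exI[of _ "gs @ hs"]) simp
  qed
qed

text \<open>A choice depending only on \<open>S\<close> and \<open>s\<close>, so that for all
  algebras with value set \<open>S\<close> the members of \<open>basis_series\<close> are the same
  polynomial expressions in the generator coefficients.\<close>

definition decomposition :: "nat set \<Rightarrow> nat \<Rightarrow> nat list" where
  "decomposition S s = (SOME gs. set gs \<subseteq> generators S \<and> sum_list gs = s)"

lemma decomposition:
  assumes "s \<in> S"
  shows "set (decomposition S s) \<subseteq> generators S" "sum_list (decomposition S s) = s"
  using someI_ex[OF exists_decomposition[OF assms]] unfolding decomposition_def by auto

definition gen_series :: "nat \<Rightarrow> nat set \<Rightarrow> (nat \<Rightarrow> nat \<Rightarrow> complex) \<Rightarrow> nat \<Rightarrow> complex fps" where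
  "gen_series N G c s = fps_X ^ s + (\<Sum>k\<in>{k\<in>G. s < k \<and> k < N}. fps_const (c s k) * fps_X ^ k)"

definition basis_series :: "nat \<Rightarrow> nat set \<Rightarrow> (nat \<Rightarrow> nat \<Rightarrow> complex) \<Rightarrow> nat \<Rightarrow> complex fps" where
  "basis_series N G c s = prod_list (map (gen_series N G c) (decomposition (- G) s))"

definition nongaps_below :: "nat \<Rightarrow> nat set \<Rightarrow> nat set" where
  "nongaps_below N G = {s. s \<notin> G \<and> s < N}"

definition expansion :: "nat \<Rightarrow> nat set \<Rightarrow> (nat \<Rightarrow> nat \<Rightarrow> complex) \<Rightarrow> (nat \<Rightarrow> complex) \<Rightarrow> complex fps" where
  "expansion N G c E = (\<Sum>s\<in>nongaps_below N G. fps_const (E s) * basis_series N G c s)"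

definition value_set :: "complex fps set \<Rightarrow> nat set" where
  "value_set A = {subdegree x | x. x \<in> A \<and> x \<noteq> 0}"

definition is_subalgebra :: "complex fps set \<Rightarrow> bool" where
  "is_subalgebra A \<longleftrightarrow> (\<forall>c. fps_const c \<in> A) \<and> (\<forall>x\<in>A. \<forall>y\<in>A. x + y \<in> A \<and> x * y \<in> A)"

definition eq_mod :: "nat \<Rightarrow> complex fps \<Rightarrow> complex fps \<Rightarrow> bool" where
  "eq_mod N f g \<longleftrightarrow> (\<forall>k<N. fps_nth f k = fps_nth g k)"

lemma eq_mod_refl: "eq_mod N f f" by (simp add: eq_mod_def)

lemma eq_mod_add: "eq_mod N f f' \<Longrightarrow> eq_mod N g g' \<Longrightarrow> eq_mod N (f + g) (f' + g')"
  by (simp add: eq_mod_def)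

lemma eq_mod_mult: "eq_mod N f f' \<Longrightarrow> eq_mod N g g' \<Longrightarrow> eq_mod N (f * g) (f' * g')"
  unfolding eq_mod_def by (auto simp: fps_mult_nth intro!: sum.cong)

lemma gen_series_nth:
  assumes "s \<notin> G" "k < N"
  shows "fps_nth (gen_series N G c s) k = (if k = s then 1 else if k \<in> G \<and> s < k then c s k else 0)"
proof -
  have "(\<Sum>l\<in>{l\<in>G. s < l \<and> l < N}. fps_nth (fps_const (c s l) * fps_X ^ l) k) =
      (\<Sum>l\<in>{l\<in>G. s < l \<and> l < N}. if l = k then c s k else 0)"
    by (rule sum.cong) (auto simp: fps_X_power_nth)
  also have "\<dots> = (if k \<in> G \<and> s < k then c s k else 0)" using assms by simp
  finally show ?thesis using assms by (auto simp: gen_series_def fps_sum_nth fps_X_power_nth)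
qed

definition leads_with :: "nat \<Rightarrow> complex fps \<Rightarrow> bool" where
  "leads_with s f \<longleftrightarrow> fps_nth f s = 1 \<and> (\<forall>k<s. fps_nth f k = 0)"

lemma leads_with_subdegree: "leads_with s f \<Longrightarrow> subdegree f = s"
  unfolding leads_with_def by (auto intro: subdegreeI)

lemma leads_with_mult:
  assumes "leads_with s f" "leads_with t g"
  shows "leads_with (s + t) (f * g)"
proof -
  have s: "subdegree f = s" "subdegree g = t" using assms by (auto simp: leads_with_subdegree)
  have "f \<noteq> 0" "g \<noteq> 0" using assms by (auto simp: leads_with_def)
  then have "subdegree (f * g) = s + t" using s by simp
  moreover have "fps_nth (f * g) (s + t) = 1"
    using nth_subdegree_mult[of f g] s assms by (simp add: leads_with_def)
  ultimately show ?thesis unfolding leads_with_def using nth_less_subdegree_zero[of _ "f * g"] by simp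
qed

lemma leads_with_prod_list:
  assumes "\<And>s. s \<in> set gs \<Longrightarrow> leads_with s (x s)"
  shows "leads_with (sum_list gs) (prod_list (map x gs))"
  using assms
proof (induction gs)
  case Nil
  then show ?case by (simp add: leads_with_def)
next
  case (Cons s gs)
  then show ?case by (simp add: leads_with_mult)
qed

text \<open>The order of quantifiers carries the count: \<open>c\<close> is common to the whole
  algebra and only \<open>E\<close> depends on \<open>f\<close>. Products of normalized generators
  provide one element with leading term X^s for every non-gap \<open>s\<close>, so the terms of
  \<open>f\<close> can be removed one by one from below; a remaining leading exponent is always a
  non-gap.\<close>

lemma subalgebra_representation:
  assumes A: "is_subalgebra A" and G: "value_set A = - G"
  shows "\<exists>c. \<forall>f\<in>A. \<exists>E. eq_mod N f (expansion N G c E)"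
proof -
  \<comment> \<open>The algebra modulo X^N. The truncated series \<open>gen_series\<close> lie in
    \<open>B\<close> even where they do not lie in \<open>A\<close>, and leading exponents below
    \<open>N\<close> are still non-gaps.\<close>
  define B where "B = {f. \<exists>f'\<in>A. eq_mod N f f'}"
  have B_const: "fps_const c \<in> B" for c using A eq_mod_refl unfolding B_def is_subalgebra_def by blast
  have B_add: "f + g \<in> B" if "f \<in> B" "g \<in> B" for f g
    using A that eq_mod_add unfolding B_def is_subalgebra_def by blast
  have B_mult: "f * g \<in> B" if "f \<in> B" "g \<in> B" for f g
    using A that eq_mod_mult unfolding B_def is_subalgebra_def by blast
  have B_diff: "f - fps_const c * g \<in> B" if "f \<in> B" "g \<in> B" for f g c
  proof -
    have "f + fps_const (- c) * g \<in> B" by (intro B_add B_mult B_const that)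
    then show ?thesis by (simp flip: fps_const_neg)
  qed
  have lead_nongap: "k \<notin> G" if f: "f \<in> B" "\<forall>j<k. fps_nth f j = 0" "k < N" "fps_nth f k \<noteq> 0" for f k
  proof -
    obtain f' where f': "f' \<in> A" "eq_mod N f f'" using f(1) by (auto simp: B_def)
    have "fps_nth f' k \<noteq> 0" "\<forall>j<k. fps_nth f' j = 0" using f' f(2-4) by (auto simp: eq_mod_def)
    then have "subdegree f' = k" "f' \<noteq> 0" by (auto intro: subdegreeI)
    then have "k \<in> value_set A" using f'(1) by (auto simp: value_set_def)
    then show ?thesis using G by simp
  qed
  have ex_lead: "\<exists>x\<in>B. leads_with s x" if "s \<notin> G" for s
  proof -
    have "s \<in> value_set A" using that G by simp
    then obtain y where y: "y \<in> A" "y \<noteq> 0" "subdegree y = s" by (auto simp: value_set_def)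
    have y0: "fps_nth y k = 0" if "k < s" for k using that y(3) nth_less_subdegree_zero by blast
    have ys: "fps_nth y s \<noteq> 0" using y by auto
    have "fps_const (1 / fps_nth y s) * y \<in> B"
      by (intro B_mult B_const) (use y(1) eq_mod_refl in \<open>auto simp: B_def\<close>)
    moreover have "leads_with s (fps_const (1 / fps_nth y s) * y)"
      using ys y0 by (simp add: leads_with_def)
    ultimately show ?thesis by blast
  qed
  \<comment> \<open>Induction clears the non-gap positions above \<open>s\<close> from left to
    right; subtracting a series that leads at \<open>s + K\<close> does not disturb earlier
    positions. The test \<open>K > 0\<close> in the step protects the leading coefficient
    itself.\<close>
  have ex_reduced: "\<exists>x\<in>B. leads_with s x \<and> (\<forall>k. k \<notin> G \<longrightarrow> s < k \<longrightarrow> k < s + K \<longrightarrow> fps_nth x k = 0)"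
    if "s \<notin> G" for s K
  proof (induction K)
    case 0
    then show ?case using ex_lead[OF that] by auto
  next
    case (Suc K)
    then obtain x where x: "x \<in> B" "leads_with s x" "\<And>k. k \<notin> G \<Longrightarrow> s < k \<Longrightarrow> k < s + K \<Longrightarrow> fps_nth x k = 0"
      by blast
    show ?case
    proof (cases "K > 0 \<and> s + K \<notin> G")
      case True
      then obtain y where y: "y \<in> B" "leads_with (s + K) y" using ex_lead by blast
      let ?x = "x - fps_const (fps_nth x (s + K)) * y"
      have low: "fps_nth ?x k = fps_nth x k" if "k < s + K" for k
        using y(2) that by (simp add: leads_with_def)
      have "fps_nth ?x (s + K) = 0" using y(2) by (simp add: leads_with_def)
      moreover have "leads_with s ?x" using x(2) low True by (simp add: leads_with_def)
      ultimately show ?thesis using B_diff[OF x(1) y(1)] x(3) low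
        by (intro bexI[of _ ?x] conjI) (auto simp: less_Suc_eq)
    next
      case False
      then show ?thesis using x by (intro bexI[of _ x] conjI) (auto simp: less_Suc_eq)
    qed
  qed
  have "\<forall>s. \<exists>x. s \<notin> G \<longrightarrow> x \<in> B \<and> leads_with s x \<and> (\<forall>k. k \<notin> G \<longrightarrow> s < k \<longrightarrow> k < s + N \<longrightarrow> fps_nth x k = 0)"
    using ex_reduced by blast
  then obtain x where x: "\<And>s. s \<notin> G \<Longrightarrow> x s \<in> B" "\<And>s. s \<notin> G \<Longrightarrow> leads_with s (x s)"
    "\<And>s k. s \<notin> G \<Longrightarrow> k \<notin> G \<Longrightarrow> s < k \<Longrightarrow> k < s + N \<Longrightarrow> fps_nth (x s) k = 0" by metis
  define c where "c s k = fps_nth (x s) k" for s k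
  let ?g = "gen_series N G c" and ?M = "basis_series N G c"
  have g_B: "?g s \<in> B" if s: "s \<notin> G" "s < N" for s
  proof -
    have "eq_mod N (?g s) (x s)" unfolding eq_mod_def
    proof (intro allI impI)
      fix k assume k: "k < N"
      consider "k < s" | "k = s" | "k > s" by linarith
      then show "fps_nth (?g s) k = fps_nth (x s) k"
        using x(2)[OF s(1)] x(3)[OF s(1), of k] k
        unfolding gen_series_nth[OF s(1) k] by cases (auto simp: c_def leads_with_def)
    qed
    moreover obtain f' where "f' \<in> A" "eq_mod N (x s) f'" using x(1)[OF s(1)] by (auto simp: B_def)
    ultimately show ?thesis unfolding B_def eq_mod_def by auto
  qed
  have g_lead: "leads_with s (?g s)" if s: "s \<notin> G" "s < N" for s
    unfolding leads_with_def using s by (auto simp: gen_series_nth)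
  have gens: "g \<notin> G \<and> g < N" if "s \<notin> G" "s < N" "g \<in> set (decomposition (- G) s)" for s g
  proof -
    have "g \<in> generators (- G)" using decomposition(1)[of s "- G"] that by auto
    moreover have "g \<le> s" using member_le_sum_list[OF that(3)] decomposition(2)[of s "- G"] that by simp
    ultimately show ?thesis using that by (auto simp: generators_def)
  qed
  have M_B: "?M s \<in> B" if s: "s \<notin> G" "s < N" for s
  proof -
    have "prod_list (map ?g gs) \<in> B" if "\<forall>g\<in>set gs. g \<notin> G \<and> g < N" for gs
      using that
    proof (induction gs)
      case Nil
      then show ?case using B_const[of 1] by simp
    next
      case (Cons g gs)
      then show ?case using B_mult g_B by simp
    qed
    then show ?thesis using gens[OF s] by (simp add: basis_series_def)
  qed
  have M_lead: "leads_with s (?M s)" if s: "s \<notin> G" "s < N" for s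
  proof -
    have "leads_with (sum_list (decomposition (- G) s)) (?M s)"
      unfolding basis_series_def by (rule leads_with_prod_list) (use gens[OF s] g_lead in auto)
    then show ?thesis using decomposition(2)[of s "- G"] s by simp
  qed
  let ?S = "{s. s \<notin> G \<and> s < N}"
  \<comment> \<open>\<open>K\<close> is the number of positions below \<open>N\<close> that may
    still be non-zero, so \<open>N - Suc K\<close> is the next one to remove.\<close>
  have rep: "\<exists>E. eq_mod N f (\<Sum>s\<in>?S. fps_const (E s) * ?M s)"
    if "f \<in> B" "\<forall>j<N - K. fps_nth f j = 0" "K \<le> N" for f K
    using that
  proof (induction K arbitrary: f)
    case 0
    then show ?case by (intro exI[of _ "\<lambda>_. 0"]) (simp add: eq_mod_def)
  next
    case (Suc K)
    let ?k = "N - Suc K"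
    have k: "?k < N" "N - K = Suc ?k" using Suc.prems(3) by auto
    show ?case
    proof (cases "fps_nth f ?k = 0")
      case True
      then have "\<forall>j<N - K. fps_nth f j = 0" using Suc.prems(2) k by (auto simp: less_Suc_eq)
      then show ?thesis using Suc.IH[OF Suc.prems(1)] Suc.prems(3) by simp
    next
      case False
      have kG: "?k \<notin> G" by (rule lead_nongap[OF Suc.prems(1,2) k(1) False])
      let ?f = "f - fps_const (fps_nth f ?k) * ?M ?k"
      have "\<forall>j<N - K. fps_nth ?f j = 0"
        using Suc.prems(2) k(2) M_lead[OF kG k(1)] by (auto simp: less_Suc_eq leads_with_def)
      then obtain E where E: "eq_mod N ?f (\<Sum>s\<in>?S. fps_const (E s) * ?M s)"
        using Suc.IH[OF B_diff[OF Suc.prems(1) M_B[OF kG k(1)]] _ Suc_leD[OF Suc.prems(3)]] by blast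
      define E' where "E' s = E s + (if s = ?k then fps_nth f ?k else 0)" for s
      have "(\<Sum>s\<in>?S. fps_const (E' s) * ?M s) =
          (\<Sum>s\<in>?S. fps_const (E s) * ?M s + (if s = ?k then fps_const (fps_nth f ?k) * ?M ?k else 0))"
        by (rule sum.cong) (auto simp: E'_def distrib_right simp flip: fps_const_add)
      also have "\<dots> = (\<Sum>s\<in>?S. fps_const (E s) * ?M s) + fps_const (fps_nth f ?k) * ?M ?k"
        using kG k by (simp add: sum.distrib)
      finally have "eq_mod N f (\<Sum>s\<in>?S. fps_const (E' s) * ?M s)"
        using eq_mod_add[OF E eq_mod_refl[of N "fps_const (fps_nth f ?k) * ?M ?k"]] by simp
      then show ?thesis by blast
    qed
  qed
  have "A \<subseteq> B" using eq_mod_refl by (auto simp: B_def)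
  then have "\<forall>f\<in>A. \<exists>E. eq_mod N f (\<Sum>s\<in>?S. fps_const (E s) * ?M s)"
    using rep[of _ N] by auto
  then show ?thesis unfolding expansion_def nongaps_below_def by blast
qed

section \<open>Hermite interpolation\<close>

lemma pcompose_power: "pcompose (p ^ k) q = pcompose p q ^ k" for p q :: "complex poly"
  by (induction k) (simp_all add: pcompose_mult pcompose_1)

lemma pcompose_shift_shift: "pcompose (pcompose p [:t, 1:]) [:- t, 1:] = p" for p :: "complex poly"
  by (simp flip: pcompose_assoc add: pcompose_pCons)

lemma linear_power_dvd_if_shift_coeffs_0:
  fixes p :: "complex poly"
  assumes "\<And>k. k < N \<Longrightarrow> coeff (pcompose p [:t, 1:]) k = 0"
  shows "[:- t, 1:] ^ N dvd p"
proof -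
  have "monom 1 N dvd pcompose p [:t, 1:]" using assms by (simp add: monom_1_dvd_iff')
  then obtain r where r: "pcompose p [:t, 1:] = [:0, 1:] ^ N * r" by (auto simp: monom_altdef elim!: dvdE)
  have "p = pcompose ([:0, 1:] ^ N * r) [:- t, 1:]" by (metis pcompose_shift_shift r)
  also have "\<dots> = [:- t, 1:] ^ N * pcompose r [:- t, 1:]"
    by (simp add: pcompose_mult pcompose_power pcompose_pCons)
  finally show ?thesis by (metis dvd_triv_left)
qed

lemma coprime_linear_powers:
  fixes s t :: complex
  assumes "s \<noteq> t"
  shows "coprime ([:- s, 1:] ^ k) ([:- t, 1:] ^ l)"
proof -
  have "coprime [:- s, 1:] [:- t, 1:]"
  proof (rule coprimeI)
    fix c assume "c dvd [:- s, 1:]" "c dvd [:- t, 1:]"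
    then have "c dvd [:- s, 1:] - [:- t, 1:]" by (rule dvd_diff)
    then have "c dvd [:t - s:]" by simp
    moreover have "[:t - s:] dvd 1" using assms by (simp add: is_unit_pCons_iff)
    ultimately show "is_unit c" using dvd_trans by blast
  qed
  then show ?thesis by simp
qed

lemma prod_dvd_if_coprime:
  fixes p :: "'a \<Rightarrow> complex poly"
  assumes "finite L" "\<And>l. l \<in> L \<Longrightarrow> p l dvd D" "\<And>l l'. l \<in> L \<Longrightarrow> l' \<in> L \<Longrightarrow> l \<noteq> l' \<Longrightarrow> coprime (p l) (p l')"
  shows "prod p L dvd D"
  using assms
proof (induction L rule: finite_induct)
  case (insert l L)
  have "coprime (p l) (prod p L)" by (rule prod_coprime_right) (use insert in auto)
  then have "p l * prod p L dvd D" using insert by (intro divides_mult) auto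
  then show ?case using insert by simp
qed simp

text \<open>The jet at \<open>t l\<close> is not \<open>Q l\<close> but \<open>Q l\<close> times the
  product of the other factors. Not dividing by that product keeps the expression polynomial in the
  nodes and in the data.\<close>

definition interp :: "nat \<Rightarrow> (nat \<Rightarrow> nat) \<Rightarrow> (nat \<Rightarrow> complex) \<Rightarrow> (nat \<Rightarrow> complex fps) \<Rightarrow> complex fps" where
  "interp m N t Q = (\<Sum>l<m. (\<Prod>l'\<in>{..<m} - {l}. (fps_X - fps_const (t l')) ^ N l') *
      (\<Sum>k<N l. fps_const (fps_nth (Q l) k) * (fps_X - fps_const (t l)) ^ k))"

definition cofactor_poly :: "nat \<Rightarrow> (nat \<Rightarrow> nat) \<Rightarrow> (nat \<Rightarrow> complex) \<Rightarrow> nat \<Rightarrow> complex poly" where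
  "cofactor_poly m N t l = (\<Prod>l'\<in>{..<m} - {l}. [:- t l', 1:] ^ N l')"

lemma fps_of_poly_monic_linear: "fps_of_poly [:- t, 1:] = fps_X - fps_const (t :: complex)"
  by (simp add: fps_of_poly_pCons flip: fps_const_neg)

text \<open>\<open>P\<close> minus the interpolant is divisible by coprime powers of linear factors,
  hence by their product \<open>T\<close>. The quotient has the stated number of free coefficients
  by degree; it is 0 when the jet lengths add up to \<open>d + 1\<close>.\<close>

lemma interp_exists:
  fixes P :: "complex poly"
  assumes deg: "degree P \<le> d" and N: "\<And>l. l < m \<Longrightarrow> 0 < N l" and sumN: "(\<Sum>l<m. N l) \<le> d + 1"
    and inj: "inj_on t {..<m}"
    and cong: "\<And>l. l < m \<Longrightarrow> eq_mod (N l) (fps_of_poly (pcompose P [:t l, 1:]))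
        (fps_of_poly (pcompose (cofactor_poly m N t l) [:t l, 1:]) * Q l)"
  shows "\<exists>R. fps_of_poly P = interp m N t Q + (\<Prod>l<m. (fps_X - fps_const (t l)) ^ N l) *
     (\<Sum>k<d + 1 - (\<Sum>l<m. N l). fps_const (R k) * fps_X ^ k)"
proof -
  define B where "B = cofactor_poly m N t"
  define q where "q l = (\<Sum>k<N l. smult (fps_nth (Q l) k) ([:- t l, 1:] ^ k))" for l
  define I where "I = (\<Sum>l<m. B l * q l)"
  define T where "T = (\<Prod>l<m. [:- t l, 1:] ^ N l)"
  have I: "fps_of_poly I = interp m N t Q"
    by (simp add: I_def interp_def B_def cofactor_poly_def q_def fps_of_poly_sum fps_of_poly_mult fps_of_poly_prod
        fps_of_poly_power fps_of_poly_monic_linear fps_of_poly_smult)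
  have T: "fps_of_poly T = (\<Prod>l<m. (fps_X - fps_const (t l)) ^ N l)"
    by (simp add: T_def fps_of_poly_prod fps_of_poly_power fps_of_poly_monic_linear)
  have T0: "T \<noteq> 0" by (simp add: T_def)
  have degT: "degree T = (\<Sum>l<m. N l)"
    by (simp add: T_def degree_prod_eq_sum_degree degree_linear_power)
  have degB: "degree (B l) + N l = (\<Sum>l<m. N l)" if "l < m" for l
  proof -
    have "degree (B l) = (\<Sum>l'\<in>{..<m} - {l}. N l')"
      by (simp add: B_def cofactor_poly_def degree_prod_eq_sum_degree degree_linear_power)
    then show ?thesis using that by (simp add: sum.remove[of "{..<m}" l N])
  qed
  have "degree I \<le> d" unfolding I_def
  proof (rule degree_sum_le)
    fix l assume "l \<in> {..<m}"
    then have l: "l < m" by simp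
    have "degree (q l) \<le> N l - 1" unfolding q_def
    proof (rule degree_sum_le)
      fix k assume "k \<in> {..<N l}"
      then show "degree (smult (fps_nth (Q l) k) ([:- t l, 1:] ^ k)) \<le> N l - 1"
        using degree_smult_le[of "fps_nth (Q l) k" "[:- t l, 1:] ^ k"] by (simp add: degree_linear_power)
    qed simp
    then have "degree (B l * q l) \<le> degree (B l) + (N l - 1)"
      using degree_mult_le[of "B l" "q l"] by linarith
    also have "\<dots> \<le> d" using degB[OF l] N[OF l] sumN by linarith
    finally show "degree (B l * q l) \<le> d" .
  qed simp
  then have degD: "degree (P - I) \<le> d" using deg by (intro degree_diff_le)
  have "[:- t l, 1:] ^ N l dvd P - I" if l: "l < m" for l
  proof -
    have "[:- t l, 1:] ^ N l dvd P - B l * q l"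
    proof (rule linear_power_dvd_if_shift_coeffs_0)
      fix k assume k: "k < N l"
      have "fps_of_poly (pcompose (q l) [:t l, 1:]) = (\<Sum>k<N l. fps_const (fps_nth (Q l) k) * fps_X ^ k)"
        by (simp add: q_def pcompose_sum pcompose_smult pcompose_power pcompose_pCons fps_of_poly_sum
            fps_of_poly_smult fps_of_poly_power fps_of_poly_pCons)
      then have "eq_mod (N l) (Q l) (fps_of_poly (pcompose (q l) [:t l, 1:]))"
        by (simp add: eq_mod_def fps_sum_nth fps_X_power_nth if_distrib[of "\<lambda>x. _ * x"] cong: if_cong)
      then have "eq_mod (N l) (fps_of_poly (pcompose (B l) [:t l, 1:]) * Q l)
          (fps_of_poly (pcompose (B l) [:t l, 1:]) * fps_of_poly (pcompose (q l) [:t l, 1:]))"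
        by (intro eq_mod_mult eq_mod_refl)
      then have "fps_nth (fps_of_poly (pcompose P [:t l, 1:])) k = fps_nth (fps_of_poly (pcompose (B l * q l) [:t l, 1:])) k"
        using cong[OF l] k by (simp add: eq_mod_def B_def pcompose_mult fps_of_poly_mult)
      then show "coeff (pcompose (P - B l * q l) [:t l, 1:]) k = 0"
        by (simp add: pcompose_diff)
    qed
    moreover have "[:- t l, 1:] ^ N l dvd (\<Sum>l'\<in>{..<m} - {l}. B l' * q l')"
    proof (intro dvd_sum dvd_mult2)
      fix l' assume "l' \<in> {..<m} - {l}"
      then show "[:- t l, 1:] ^ N l dvd B l'" unfolding B_def cofactor_poly_def
        by (intro dvd_prodI[of "{..<m} - {l'}" l "\<lambda>l. [:- t l, 1:] ^ N l"]) (use l in auto)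
    qed
    ultimately have "[:- t l, 1:] ^ N l dvd (P - B l * q l) - (\<Sum>l'\<in>{..<m} - {l}. B l' * q l')"
      by (rule dvd_diff)
    also have "\<dots> = P - I" using l by (simp add: I_def sum.remove[of "{..<m}" l] algebra_simps)
    finally show ?thesis .
  qed
  then have "T dvd P - I" unfolding T_def
    by (intro prod_dvd_if_coprime coprime_linear_powers) (use inj in \<open>auto simp: inj_on_def\<close>)
  then obtain r where r: "P - I = T * r" by (elim dvdE)
  have r0: "coeff r k = 0" if "k \<ge> d + 1 - (\<Sum>l<m. N l)" for k
  proof (cases "r = 0")
    case False
    then have "degree (P - I) = degree T + degree r" using r T0 by (simp add: degree_mult_eq)
    then have "degree r < k" using degD degT that sumN by linarith
    then show ?thesis by (rule coeff_eq_0)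
  qed simp
  have "fps_of_poly r = (\<Sum>k<d + 1 - (\<Sum>l<m. N l). fps_const (coeff r k) * fps_X ^ k)"
    by (rule fps_ext) (use r0 in \<open>auto simp: fps_sum_nth fps_X_power_nth if_distrib[of "\<lambda>x. _ * x"] cong: if_cong\<close>)
  moreover have "fps_of_poly P = fps_of_poly I + fps_of_poly T * fps_of_poly r"
    using r by (simp add: algebra_simps flip: fps_of_poly_mult fps_of_poly_add)
  ultimately show ?thesis unfolding I T by (intro exI[of _ "coeff r"]) simp
qed

lemma fps_const_sum: "fps_const (\<Sum>j\<in>A. x j) = (\<Sum>j\<in>A. fps_const (x j :: complex))"
  by (induction A rule: infinite_finite_induct) (simp_all flip: fps_const_add)

lemma interp_linear:
  "interp m N t (\<lambda>l. \<Sum>j\<in>A. fps_const (c j) * Q j l) = (\<Sum>j\<in>A. fps_const (c j) * interp m N t (Q j))"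
proof -
  have "interp m N t (\<lambda>l. \<Sum>j\<in>A. fps_const (c j) * Q j l) =
    (\<Sum>l<m. \<Sum>k<N l. \<Sum>j\<in>A. fps_const (c j) * ((\<Prod>l'\<in>{..<m} - {l}. (fps_X - fps_const (t l')) ^ N l') *
        (fps_const (fps_nth (Q j l) k) * (fps_X - fps_const (t l)) ^ k)))"
  proof -
    have "fps_const (fps_nth (\<Sum>j\<in>A. fps_const (c j) * Q j l) k) = (\<Sum>j\<in>A. fps_const (c j) * fps_const (fps_nth (Q j l) k))" for l k
      by (simp add: fps_sum_nth fps_const_sum)
    then show ?thesis
      by (simp only: interp_def sum_distrib_left sum_distrib_right mult_ac)
  qed
  also have "\<dots> = (\<Sum>l<m. \<Sum>j\<in>A. \<Sum>k<N l. fps_const (c j) * ((\<Prod>l'\<in>{..<m} - {l}. (fps_X - fps_const (t l')) ^ N l') *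
        (fps_const (fps_nth (Q j l) k) * (fps_X - fps_const (t l)) ^ k)))"
    by (intro sum.cong refl sum.swap)
  also have "\<dots> = (\<Sum>j\<in>A. fps_const (c j) * interp m N t (Q j))"
    by (subst sum.swap) (simp add: interp_def sum_distrib_left)
  finally show ?thesis .
qed

lemma interp_cong:
  assumes "\<And>l. l < m \<Longrightarrow> eq_mod (N l) (Q l) (Q' l)" "\<And>l. l < m \<Longrightarrow> t l = t' l"
  shows "interp m N t Q = interp m N t' Q'"
  unfolding interp_def using assms
  by (intro sum.cong refl arg_cong2[of _ _ _ _ "(*)"] prod.cong) (auto simp: eq_mod_def)

section \<open>Parametrization of curves with prescribed singularities\<close>

text \<open>Curves are handled as power series even where they are polynomials: coefficients of sums
  and products are then visibly polynomial in the parameters and no degrees need tracking.\<close>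

definition polyfun_series :: "(('i \<Rightarrow> complex) \<Rightarrow> complex fps) \<Rightarrow> bool" where
  "polyfun_series F \<longleftrightarrow> (\<forall>k. (\<lambda>y. fps_nth (F y) k) \<in> polyfun)"

lemma polyfun_series_const: "p \<in> polyfun \<Longrightarrow> polyfun_series (\<lambda>y. fps_const (p y))"
  unfolding polyfun_series_def
proof
  fix k assume "p \<in> polyfun"
  then show "(\<lambda>y. fps_nth (fps_const (p y)) k) \<in> polyfun"
    by (cases "k = 0") (simp_all add: pf_const)
qed

lemma polyfun_series_fixed: "polyfun_series (\<lambda>y. f)"
  unfolding polyfun_series_def using pf_const by blast

lemma polyfun_series_add:
  assumes "polyfun_series F" "polyfun_series H"
  shows "polyfun_series (\<lambda>y. F y + H y)"
  using assms unfolding polyfun_series_def fps_add_nth by (intro allI pf_add) auto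

lemma polyfun_series_diff:
  assumes "polyfun_series F" "polyfun_series H"
  shows "polyfun_series (\<lambda>y. F y - H y)"
  using assms unfolding polyfun_series_def fps_sub_nth by (intro allI polyfun_diff) auto

lemma polyfun_series_mult:
  assumes "polyfun_series F" "polyfun_series H"
  shows "polyfun_series (\<lambda>y. F y * H y)"
  using assms unfolding polyfun_series_def fps_mult_nth by (intro allI polyfun_sum pf_mult) auto

lemma polyfun_series_power:
  assumes "polyfun_series F"
  shows "polyfun_series (\<lambda>y. F y ^ k)"
  by (induction k) (simp_all add: polyfun_series_fixed polyfun_series_mult assms)

lemma polyfun_series_sum:
  assumes "\<And>i. i \<in> A \<Longrightarrow> polyfun_series (F i)"
  shows "polyfun_series (\<lambda>y. \<Sum>i\<in>A. F i y)"
  using assms unfolding polyfun_series_def fps_sum_nth by (intro allI polyfun_sum) auto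

lemma polyfun_series_prod:
  assumes "\<And>i. i \<in> A \<Longrightarrow> polyfun_series (F i)"
  shows "polyfun_series (\<lambda>y. \<Prod>i\<in>A. F i y)"
  using assms
  by (induction A rule: infinite_finite_induct) (simp_all add: polyfun_series_fixed polyfun_series_mult)

lemma polyfun_series_prod_list:
  assumes "\<And>i. polyfun_series (F i)"
  shows "polyfun_series (\<lambda>y. prod_list (map (\<lambda>i. F i y) xs))"
  by (induction xs) (simp_all add: polyfun_series_fixed polyfun_series_mult assms)

lemma polyfun_series_nth: "polyfun_series F \<Longrightarrow> (\<lambda>y. fps_nth (F y) k) \<in> polyfun"
  by (simp add: polyfun_series_def)

lemmas polyfun_series_intros = polyfun_series_add polyfun_series_diff polyfun_series_mult
  polyfun_series_power polyfun_series_sum polyfun_series_prod polyfun_series_prod_list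

text \<open>Only coefficients at pairs of a generator and a larger gap enter, so only these become
  parameters.\<close>

lemma basis_series_cong:
  assumes "s \<notin> G"
    and "\<And>g k. g \<in> generators (- G) \<Longrightarrow> k \<in> G \<Longrightarrow> g < k \<Longrightarrow> k < N \<Longrightarrow> c g k = c' g k"
  shows "basis_series N G c s = basis_series N G c' s"
proof -
  have "gen_series N G c g = gen_series N G c' g" if "g \<in> set (decomposition (- G) s)" for g
    unfolding gen_series_def using decomposition(1)[of s "- G"] assms that
    by (intro arg_cong2[of _ _ _ _ "(+)"] refl sum.cong) auto
  then show ?thesis unfolding basis_series_def by (metis map_cong)
qed

type_synonym param = "nat \<times> nat \<times> nat \<times> nat"

text \<open>Coordinates are taken relative to a coordinate \<open>j0 l\<close> that does not vanish
  at the point. Its own ratio is 1 and costs no parameter, leaving n expansions per point.\<close>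

definition local_factor :: "(nat \<Rightarrow> nat) \<Rightarrow> (nat \<Rightarrow> nat set) \<Rightarrow> (nat \<Rightarrow> nat) \<Rightarrow> (param \<Rightarrow> complex) \<Rightarrow> nat \<Rightarrow> nat \<Rightarrow> complex fps" where
  "local_factor N G j0 y j l = (if j = j0 l then 1 else
     expansion (N l) (G l) (\<lambda>s k. y (1, l, s, k)) (\<lambda>s. y (3, l, j, s)))"

definition jet_factor :: "(nat \<Rightarrow> nat) \<Rightarrow> (param \<Rightarrow> complex) \<Rightarrow> nat \<Rightarrow> complex fps" where
  "jet_factor N y l = (\<Sum>k<N l. fps_const (y (2, l, k, 0)) * fps_X ^ k)"

text \<open>The first entry of a parameter index is a tag: 0 for the singular points, 1 for the coefficients of
  the generators of the local algebras, 2 for the jets of the non-vanishing coordinate, 3 for the expansions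
  of the other coordinates in the local algebras, and 4 for the quotient of the interpolation.\<close>
definition curve_series :: "nat \<Rightarrow> (nat \<Rightarrow> nat) \<Rightarrow> (nat \<Rightarrow> nat set) \<Rightarrow> (nat \<Rightarrow> nat) \<Rightarrow> nat \<Rightarrow> (param \<Rightarrow> complex) \<Rightarrow> nat \<Rightarrow> complex fps" where
  "curve_series m N G j0 M y j =
     interp m N (\<lambda>l. y (0, l, 0, 0)) (\<lambda>l. jet_factor N y l * local_factor N G j0 y j l)
     + (\<Prod>l<m. (fps_X - fps_const (y (0, l, 0, 0))) ^ N l) * (\<Sum>k<M. fps_const (y (4, j, k, 0)) * fps_X ^ k)"

lemma polyfun_series_curve_series: "polyfun_series (\<lambda>y. curve_series m N G j0 M y j)"
proof -
  have coord: "polyfun_series (\<lambda>y. fps_const (y i))" for i :: param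
    by (rule polyfun_series_const) (rule pf_coord)
  have "polyfun_series (\<lambda>y :: param \<Rightarrow> complex. basis_series K H (\<lambda>s k. y (1, l, s, k)) s)" for K H l s
    unfolding basis_series_def gen_series_def
    by (intro polyfun_series_intros polyfun_series_fixed coord)
  then have lf: "polyfun_series (\<lambda>y. local_factor N G j0 y j l)" for l
    unfolding local_factor_def expansion_def
    by (cases "j = j0 l") (auto intro!: polyfun_series_intros polyfun_series_fixed coord)
  have uf: "polyfun_series (\<lambda>y. jet_factor N y l)" for l
    unfolding jet_factor_def by (intro polyfun_series_intros polyfun_series_fixed coord)
  show ?thesis unfolding curve_series_def interp_def
    by (intro polyfun_series_intros polyfun_series_fixed coord polyfun_series_const
        polyfun_series_nth[OF polyfun_series_mult[OF uf lf]])
qed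

text \<open>For large \<open>N\<close> its cardinality is the number w of the overview.\<close>

definition gen_gap_pairs :: "nat \<Rightarrow> nat set \<Rightarrow> (nat \<times> nat) set" where
  "gen_gap_pairs N G = {(s, k). s \<in> generators (- G) \<and> k \<in> G \<and> s < k \<and> k < N}"

lemma finite_gen_gap_pairs [simp]: "finite (gen_gap_pairs N G)"
  by (rule finite_subset[of _ "{..<N} \<times> {..<N}"]) (auto simp: gen_gap_pairs_def)

lemma finite_nongaps_below [simp]: "finite (nongaps_below N G)"
  by (simp add: nongaps_below_def)

definition param_index :: "nat \<Rightarrow> nat \<Rightarrow> (nat \<Rightarrow> nat) \<Rightarrow> (nat \<Rightarrow> nat set) \<Rightarrow> (nat \<Rightarrow> nat) \<Rightarrow> nat \<Rightarrow> param set" where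
  "param_index n m N G j0 M =
     (\<lambda>l. (0, l, 0, 0)) ` {..<m} \<union>
     (\<lambda>(l, s, k). (1, l, s, k)) ` (SIGMA l:{..<m}. gen_gap_pairs (N l) (G l)) \<union>
     (\<lambda>(l, k). (2, l, k, 0)) ` (SIGMA l:{..<m}. {..<N l}) \<union>
     (\<lambda>(l, j, s). (3, l, j, s)) ` (SIGMA l:{..<m}. ({..n} - {j0 l}) \<times> nongaps_below (N l) (G l)) \<union>
     (\<lambda>(j, k). (4, j, k, 0)) ` ({..n} \<times> {..<M})"

lemma finite_param_index: "finite (param_index n m N G j0 M)"
  by (simp add: param_index_def)

lemma card_param_index:
  assumes "\<And>l. l < m \<Longrightarrow> j0 l \<le> n"
  shows "card (param_index n m N G j0 M) \<le>
    (\<Sum>l<m. 1 + card (gen_gap_pairs (N l) (G l)) + N l + n * card (nongaps_below (N l) (G l))) + (n + 1) * M"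
proof -
  let ?A = "(\<lambda>l. (0, l, 0, 0)) ` {..<m} :: param set"
  let ?B = "(\<lambda>(l, s, k). (1, l, s, k)) ` (SIGMA l:{..<m}. gen_gap_pairs (N l) (G l)) :: param set"
  let ?C = "(\<lambda>(l, k). (2, l, k, 0)) ` (SIGMA l:{..<m}. {..<N l}) :: param set"
  let ?D = "(\<lambda>(l, j, s). (3, l, j, s)) ` (SIGMA l:{..<m}. ({..n} - {j0 l}) \<times> nongaps_below (N l) (G l)) :: param set"
  let ?E = "(\<lambda>(j, k). (4, j, k, 0)) ` ({..n} \<times> {..<M}) :: param set"
  have A: "card ?A \<le> (\<Sum>l<m. 1)" using card_image_le[of "{..<m}" "\<lambda>l. (0, l, 0, 0) :: param"] by simp
  have B: "card ?B \<le> (\<Sum>l<m. card (gen_gap_pairs (N l) (G l)))"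
    by (rule order_trans[OF card_image_le]) (simp_all add: card_SigmaI)
  have C: "card ?C \<le> (\<Sum>l<m. N l)"
    by (rule order_trans[OF card_image_le]) (simp_all add: card_SigmaI)
  have "card ?D \<le> (\<Sum>l<m. card (({..n} - {j0 l}) \<times> nongaps_below (N l) (G l)))"
    by (rule order_trans[OF card_image_le]) (simp_all add: card_SigmaI)
  also have "\<dots> = (\<Sum>l<m. n * card (nongaps_below (N l) (G l)))"
    by (rule sum.cong) (use assms in \<open>auto simp: card_cartesian_product\<close>)
  finally have D: "card ?D \<le> (\<Sum>l<m. n * card (nongaps_below (N l) (G l)))" .
  have E: "card ?E \<le> (n + 1) * M"
    by (rule order_trans[OF card_image_le]) (simp_all add: card_cartesian_product)
  have "card (param_index n m N G j0 M) \<le> card ?A + card ?B + card ?C + card ?D + card ?E"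
    unfolding param_index_def
    by (intro order_trans[OF card_Un_le] add_mono order_refl)
  also have "\<dots> \<le> (\<Sum>l<m. 1) + (\<Sum>l<m. card (gen_gap_pairs (N l) (G l))) + (\<Sum>l<m. N l)
       + (\<Sum>l<m. n * card (nongaps_below (N l) (G l))) + (n + 1) * M"
    by (intro add_mono A B C D E)
  also have "\<dots> = (\<Sum>l<m. 1 + card (gen_gap_pairs (N l) (G l)) + N l + n * card (nongaps_below (N l) (G l))) + (n + 1) * M"
    by (simp only: sum.distrib)
  finally show ?thesis .
qed

lemma curve_series_exists:
  fixes P :: "nat \<Rightarrow> complex poly"
  assumes deg: "\<And>j. j \<le> n \<Longrightarrow> degree (P j) \<le> d"
    and N: "\<And>l. l < m \<Longrightarrow> 0 < N l" and sumN: "(\<Sum>l<m. N l) \<le> d + 1"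
    and inj: "inj_on t {..<m}"
    and A: "\<And>l. l < m \<Longrightarrow> is_subalgebra (A l)" "\<And>l. l < m \<Longrightarrow> value_set (A l) = - G l"
    and loc: "\<And>l j. l < m \<Longrightarrow> j \<le> n \<Longrightarrow> fps_of_poly (pcompose (P j) [:t l, 1:]) = u l * f l j"
    and f: "\<And>l j. l < m \<Longrightarrow> j \<le> n \<Longrightarrow> f l j \<in> A l" "\<And>l. l < m \<Longrightarrow> f l (j0 l) = 1"
  shows "\<exists>y. (\<forall>i. i \<notin> param_index n m N G j0 (d + 1 - (\<Sum>l<m. N l)) \<longrightarrow> y i = 0) \<and>
    (\<forall>j\<le>n. fps_of_poly (P j) = curve_series m N G j0 (d + 1 - (\<Sum>l<m. N l)) y j)"
proof -
  let ?M = "d + 1 - (\<Sum>l<m. N l)"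
  have "\<forall>l. \<exists>c. l < m \<longrightarrow> (\<forall>h\<in>A l. \<exists>E. eq_mod (N l) h (expansion (N l) (G l) c E))"
    using subalgebra_representation[OF A(1) A(2)] by blast
  then obtain c where c: "\<And>l h. l < m \<Longrightarrow> h \<in> A l \<Longrightarrow> \<exists>E. eq_mod (N l) h (expansion (N l) (G l) (c l) E)" by metis
  have "\<forall>l j. \<exists>E. l < m \<longrightarrow> j \<le> n \<longrightarrow> eq_mod (N l) (f l j)
      (expansion (N l) (G l) (c l) E)"
    using c f(1) by blast
  then obtain E where E: "\<And>l j. l < m \<Longrightarrow> j \<le> n \<Longrightarrow> eq_mod (N l) (f l j)
      (expansion (N l) (G l) (c l) (E l j))" by metis
  define \<beta> where "\<beta> l = fps_of_poly (pcompose (cofactor_poly m N t l) [:t l, 1:])" for l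
  have \<beta>0: "fps_nth (\<beta> l) 0 \<noteq> 0" if "l < m" for l
  proof -
    have "fps_nth (\<beta> l) 0 = poly (cofactor_poly m N t l) (t l)"
      by (simp add: \<beta>_def flip: poly_0_coeff_0) (simp add: poly_pcompose)
    also have "\<dots> \<noteq> 0" using inj that by (auto simp: cofactor_poly_def poly_prod inj_on_def)
    finally show ?thesis .
  qed
  \<comment> \<open>The jet of the common factor \<open>u l\<close> is arbitrary anyway, so dividing
    it by the cofactor series \<open>\<beta> l\<close>, as \<open>interp\<close> requires, costs no
    parameter.\<close>
  define v where "v l = u l * inverse (\<beta> l)" for l
  define Q where "Q j l = v l * f l j" for j l
  have "\<forall>j. \<exists>R. j \<le> n \<longrightarrow> fps_of_poly (P j) = interp m N t (Q j) + (\<Prod>l<m. (fps_X - fps_const (t l)) ^ N l) *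
     (\<Sum>k<?M. fps_const (R k) * fps_X ^ k)"
  proof (intro allI)
    fix j
    show "\<exists>R. j \<le> n \<longrightarrow> fps_of_poly (P j) = interp m N t (Q j) + (\<Prod>l<m. (fps_X - fps_const (t l)) ^ N l) *
     (\<Sum>k<?M. fps_const (R k) * fps_X ^ k)"
    proof (cases "j \<le> n")
      case True
      have "eq_mod (N l) (fps_of_poly (pcompose (P j) [:t l, 1:]))
        (fps_of_poly (pcompose (cofactor_poly m N t l) [:t l, 1:]) * Q j l)" if "l < m" for l
      proof -
        have "\<beta> l * Q j l = (inverse (\<beta> l) * \<beta> l) * (u l * f l j)" by (simp add: Q_def v_def mult_ac)
        also have "\<dots> = fps_of_poly (pcompose (P j) [:t l, 1:])"
          using inverse_mult_eq_1[OF \<beta>0[OF that]] loc[OF that True] by simp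
        finally show ?thesis by (simp add: \<beta>_def eq_mod_refl)
      qed
      from interp_exists[OF deg[OF True] N sumN inj this] show ?thesis by blast
    qed simp
  qed
  from choice[OF this] obtain R where R: "\<And>j. j \<le> n \<Longrightarrow> fps_of_poly (P j) = interp m N t (Q j) +
     (\<Prod>l<m. (fps_X - fps_const (t l)) ^ N l) * (\<Sum>k<?M. fps_const (R j k) * fps_X ^ k)" by blast
  define J where "J = param_index n m N G j0 ?M"
  define z :: "param \<Rightarrow> complex" where "z = (\<lambda>(i, l, p, q).
     if i = 0 then t l else if i = 1 then c l p q else if i = 2 then fps_nth (v l) p
     else if i = 3 then E l p q else R l p)"
  define y where "y i = (if i \<in> J then z i else 0)" for i
  have y0: "y (0, l, 0, 0) = t l" if "l < m" for l
    using that by (auto simp: y_def z_def J_def param_index_def)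
  have y1: "y (1, l, s, k) = c l s k" if "l < m" "(s, k) \<in> gen_gap_pairs (N l) (G l)" for l s k
    using that by (force simp: y_def z_def J_def param_index_def)
  have y2: "y (2, l, k, 0) = fps_nth (v l) k" if "l < m" "k < N l" for l k
    using that by (force simp: y_def z_def J_def param_index_def)
  have y3: "y (3, l, j, s) = E l j s" if "l < m" "j \<le> n" "j \<noteq> j0 l" "s \<in> nongaps_below (N l) (G l)" for l j s
    using that by (force simp: y_def z_def J_def param_index_def)
  have y4: "y (4, j, k, 0) = R j k" if "j \<le> n" "k < ?M" for j k
    using that by (force simp: y_def z_def J_def param_index_def)
  have "fps_of_poly (P j) = curve_series m N G j0 ?M y j" if j: "j \<le> n" for j
  proof -
    have "interp m N t (Q j) = interp m N (\<lambda>l. y (0, l, 0, 0)) (\<lambda>l. jet_factor N y l * local_factor N G j0 y j l)"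
    proof (rule interp_cong)
      fix l assume l: "l < m"
      show "t l = y (0, l, 0, 0)" using y0[OF l] by simp
      have "eq_mod (N l) (v l) (jet_factor N y l)"
        using y2[OF l] by (auto simp: eq_mod_def jet_factor_def fps_sum_nth fps_X_power_nth
            if_distrib[of "\<lambda>x. _ * x"] cong: if_cong)
      moreover have "eq_mod (N l) (f l j) (local_factor N G j0 y j l)"
      proof (cases "j = j0 l")
        case True
        then show ?thesis using f(2)[OF l] by (simp add: local_factor_def eq_mod_refl)
      next
        case False
        have "expansion (N l) (G l) (c l) (E l j) = expansion (N l) (G l) (\<lambda>s k. y (1, l, s, k)) (\<lambda>s. y (3, l, j, s))"
          unfolding expansion_def
        proof (rule sum.cong[OF refl])
          fix s assume s: "s \<in> nongaps_below (N l) (G l)"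
          have "basis_series (N l) (G l) (c l) s = basis_series (N l) (G l) (\<lambda>s k. y (1, l, s, k)) s"
            by (rule basis_series_cong) (use s y1[OF l] in \<open>auto simp: gen_gap_pairs_def nongaps_below_def\<close>)
          then show "fps_const (E l j s) * basis_series (N l) (G l) (c l) s =
            fps_const (y (3, l, j, s)) * basis_series (N l) (G l) (\<lambda>s k. y (1, l, s, k)) s"
            using y3[OF l j False s] by simp
        qed
        then show ?thesis using E[OF l j] False by (simp add: local_factor_def)
      qed
      ultimately show "eq_mod (N l) (Q j l) (jet_factor N y l * local_factor N G j0 y j l)"
        unfolding Q_def by (rule eq_mod_mult)
    qed
    moreover have "(\<Prod>l<m. (fps_X - fps_const (t l)) ^ N l) = (\<Prod>l<m. (fps_X - fps_const (y (0, l, 0, 0))) ^ N l)"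
      by (rule prod.cong) (simp_all add: y0)
    moreover have "(\<Sum>k<?M. fps_const (R j k) * fps_X ^ k) = (\<Sum>k<?M. fps_const (y (4, j, k, 0)) * fps_X ^ k)"
      by (rule sum.cong) (simp_all add: y4[OF j])
    ultimately show ?thesis using R[OF j] by (simp add: curve_series_def)
  qed
  then show ?thesis by (intro exI[of _ y]) (auto simp: y_def J_def)
qed

text \<open>Without a quotient term the coordinate polynomials depend linearly on their expansion
  coefficients at the points, one for each non-gap below \<open>N l\<close>. With more coordinates
  than such coefficients, some combination of the coordinates would vanish.\<close>

lemma curve_series_independent_le:
  assumes eq: "\<And>j. j \<le> n \<Longrightarrow> fps_of_poly (P j) = curve_series m N G j0 0 y j"
    and N: "\<And>l. l < m \<Longrightarrow> 0 < N l" "\<And>l. l < m \<Longrightarrow> 0 \<notin> G l"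
    and indep: "\<And>c. (\<Sum>j\<le>n. smult (c j) (P j)) = 0 \<Longrightarrow> \<forall>j\<le>n. c j = 0"
  shows "n + 1 \<le> (\<Sum>l<m. card (nongaps_below (N l) (G l)))"
proof (rule ccontr)
  let ?B = "SIGMA l:{..<m}. nongaps_below (N l) (G l)"
  assume "\<not> ?thesis"
  then have "card ?B < card {..n}" by (simp add: card_SigmaI)
  let ?b = "\<lambda>l s. basis_series (N l) (G l) (\<lambda>s k. y (1, l, s, k)) s"
  define e where "e j = (\<lambda>(l, s). if j = j0 l then (if s = 0 then 1 else 0) else y (3, l, j, s))" for j
  from exists_kernel_vector[OF _ _ \<open>card ?B < card {..n}\<close>, of e] obtain c where
    c: "\<exists>j\<le>n. c j \<noteq> 0" "\<And>l s. l < m \<Longrightarrow> s \<in> nongaps_below (N l) (G l) \<Longrightarrow> (\<Sum>j\<le>n. c j * e j (l, s)) = 0"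
    by fastforce
  have lf: "local_factor N G j0 y j l = (\<Sum>s\<in>nongaps_below (N l) (G l). fps_const (e j (l, s)) * ?b l s)"
    if l: "l < m" for j l
  proof (cases "j = j0 l")
    case True
    \<comment> \<open>Generators are positive, so the basis series for exponent 0 is the empty
      product 1. This lets the non-vanishing coordinate, whose local factor is 1, be expanded in the
      same basis as the others.\<close>
    have "decomposition (- G l) 0 = []"
    proof -
      have "set (decomposition (- G l) 0) \<subseteq> generators (- G l)" "sum_list (decomposition (- G l) 0) = 0"
        using decomposition[of 0 "- G l"] N(2)[OF l] by auto
      then show ?thesis by (cases "decomposition (- G l) 0") (auto simp: generators_def)
    qed
    then have "?b l 0 = 1" by (simp add: basis_series_def)
    have "(\<Sum>s\<in>nongaps_below (N l) (G l). fps_const (e j (l, s)) * ?b l s) =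
        (\<Sum>s\<in>nongaps_below (N l) (G l). if s = 0 then ?b l 0 else 0)"
      by (rule sum.cong) (auto simp: e_def True)
    also have "\<dots> = 1" using N[OF l] \<open>?b l 0 = 1\<close> by (simp add: nongaps_below_def)
    finally show ?thesis using True by (simp add: local_factor_def)
  next
    case False
    then show ?thesis by (simp add: local_factor_def expansion_def e_def)
  qed
  have "fps_of_poly (\<Sum>j\<le>n. smult (c j) (P j)) = (\<Sum>j\<le>n. fps_const (c j) * curve_series m N G j0 0 y j)"
    by (simp add: fps_of_poly_sum fps_of_poly_smult eq)
  also have "\<dots> = interp m N (\<lambda>l. y (0, l, 0, 0))
      (\<lambda>l. \<Sum>j\<le>n. fps_const (c j) * (jet_factor N y l * local_factor N G j0 y j l))"
    unfolding interp_linear by (simp add: curve_series_def)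
  also have "\<dots> = interp m N (\<lambda>l. y (0, l, 0, 0)) (\<lambda>l. 0)"
  proof (rule interp_cong)
    fix l assume l: "l < m"
    have "(\<Sum>j\<le>n. fps_const (c j) * (jet_factor N y l * local_factor N G j0 y j l)) =
        jet_factor N y l * (\<Sum>j\<le>n. \<Sum>s\<in>nongaps_below (N l) (G l). fps_const (c j * e j (l, s)) * ?b l s)"
      by (simp add: lf[OF l] sum_distrib_left mult_ac flip: fps_const_mult)
    also have "(\<Sum>j\<le>n. \<Sum>s\<in>nongaps_below (N l) (G l). fps_const (c j * e j (l, s)) * ?b l s) =
       (\<Sum>s\<in>nongaps_below (N l) (G l). fps_const (\<Sum>j\<le>n. c j * e j (l, s)) * ?b l s)"
      by (subst sum.swap) (simp add: sum_distrib_right fps_const_sum)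
    also have "\<dots> = 0" using c(2)[OF l] by simp
    finally show "eq_mod (N l) (\<Sum>j\<le>n. fps_const (c j) * (jet_factor N y l * local_factor N G j0 y j l)) 0"
      by (simp add: eq_mod_refl)
  qed simp
  also have "\<dots> = 0" by (simp add: interp_def)
  finally have "(\<Sum>j\<le>n. smult (c j) (P j)) = 0"
    using fps_of_poly_eq_iff[of "\<Sum>j\<le>n. smult (c j) (P j)" 0] by simp
  then show False using indep c(1) by blast
qed

section \<open>Numerical semigroups with few gaps\<close>

text \<open>With \<open>xs\<close> listing the status of 1, ..., k - 1, zipping against the reverse
  pairs i with k - i: the test asks whether k is a sum of two positive non-gaps and so cannot be a
  gap.\<close>

definition forced :: "bool list \<Rightarrow> bool" where
  "forced xs = list_ex (\<lambda>(a, b). a \<and> b) (zip xs (rev xs))"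

text \<open>Three bounds for three uses: the first for jets of full length, the second for the
  points that are not shortened when d = 2 g - 2, the third for the shortened point.
  \<open>hd xs\<close> concerns \<open>2 * h - 1\<close>; if that is a gap, it accounts for
  \<open>c\<close> of the \<open>w\<close> pairs.\<close>

definition weight_ok :: "nat \<Rightarrow> bool list \<Rightarrow> nat \<Rightarrow> nat \<Rightarrow> bool" where
  "weight_ok h xs c w \<longleftrightarrow> w < 2 * h \<and> (h \<le> 4 \<longrightarrow> w < h) \<and> (\<not> hd xs \<longrightarrow> w < h + c)"

text \<open>Exhaustive search over the numerical semigroups with h gaps: xs lists, newest first, which of
  the numbers 1, 2, ... belong to the semigroup, a gaps and b non-gaps are still to be placed below
  2 * h, c generators have been seen, and w is the number of pairs of a generator and a larger gap.\<close>
fun search_ok :: "nat \<Rightarrow> bool list \<Rightarrow> nat \<Rightarrow> nat \<Rightarrow> nat \<Rightarrow> nat \<Rightarrow> bool" where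
  "search_ok h xs 0 0 c w = weight_ok h xs c w"
| "search_ok h xs 0 (Suc b) c w = search_ok h (True # xs) 0 b (if forced xs then c else Suc c) w"
| "search_ok h xs (Suc a) 0 c w = (forced xs \<or> search_ok h (False # xs) a 0 c (w + c))"
| "search_ok h xs (Suc a) (Suc b) c w =
    (search_ok h (True # xs) (Suc a) b (if forced xs then c else Suc c) w \<and>
     (forced xs \<or> search_ok h (False # xs) a (Suc b) c (w + c)))"

lemma search_ok_gap:
  "search_ok h xs (Suc a) b c w \<Longrightarrow> \<not> forced xs \<Longrightarrow> search_ok h (False # xs) a b c (w + c)"
  by (cases b) auto

lemma search_ok_nongap:
  "search_ok h xs a (Suc b) c w \<Longrightarrow> search_ok h (True # xs) a b (if forced xs then c else Suc c) w"
  by (cases a) auto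

text \<open>Of the numbers from 1 to \<open>2 * h - 1\<close>, \<open>h\<close> are gaps and the
  other \<open>h - 1\<close> are not. The cases are evaluated by computation; this is where the
  bound 8 on the genus is used.\<close>

lemma search_ok_upto_8:
  assumes "0 < h" "h \<le> 8"
  shows "search_ok h [] h (h - 1) 0 0"
proof -
  have "\<forall>h\<in>{1, 2, 3, 4, 5, 6, 7, 8}. search_ok h [] h (h - 1) 0 0" by code_simp
  moreover have "h \<in> {1, 2, 3, 4, 5, 6, 7, 8}" using assms by auto
  ultimately show ?thesis by blast
qed

section \<open>Correctness of the semigroup search\<close>

definition semigroup_gaps :: "nat set \<Rightarrow> bool" where
  "semigroup_gaps G \<longleftrightarrow> finite G \<and> 0 \<notin> G \<and> (\<forall>u v. u \<notin> G \<longrightarrow> v \<notin> G \<longrightarrow> u + v \<notin> G)"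

text \<open>If \<open>k\<close> is a gap, then for every i between 0 and \<open>k\<close> one of i
  and k - i is a gap, so \<open>k\<close> is at most \<open>2 * card G - 1\<close>. This fixes the
  length of the search and of the jets.\<close>

lemma gap_less:
  assumes "semigroup_gaps G" "k \<in> G"
  shows "k < 2 * card G"
proof -
  have fin: "finite G" using assms by (simp add: semigroup_gaps_def)
  have "{1..k} \<subseteq> G \<union> (\<lambda>u. k - u) ` (G - {k})"
  proof
    fix i assume i: "i \<in> {1..k}"
    show "i \<in> G \<union> (\<lambda>u. k - u) ` (G - {k})"
    proof (cases "i \<in> G")
      case False
      then have "k - i \<in> G" using assms i unfolding semigroup_gaps_def by (metis atLeastAtMost_iff le_add_diff_inverse)
      moreover have "k - i \<noteq> k" using i by auto
      ultimately show ?thesis using i by (intro UnI2 image_eqI[of _ _ "k - i"]) auto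
    qed simp
  qed
  then have "card {1..k} \<le> card (G \<union> (\<lambda>u. k - u) ` (G - {k}))" using fin by (intro card_mono) auto
  also have "\<dots> \<le> card G + card (G - {k})"
    using fin card_Un_le[of G "(\<lambda>u. k - u) ` (G - {k})"] card_image_le[of "G - {k}" "\<lambda>u. k - u"]
    by (simp add: order_trans)
  also have "card (G - {k}) < card G" using fin assms(2) by (rule card_Diff1_less)
  finally show ?thesis by simp
qed

lemma gaps_below_eq:
  assumes "semigroup_gaps G"
  shows "{k \<in> G. k < 2 * card G} = G"
  using gap_less[OF assms] by auto

lemma card_nongaps_below:
  assumes "finite G"
  shows "card (nongaps_below N G) + card {k \<in> G. k < N} = N"
proof -
  have "card (nongaps_below N G \<union> {k \<in> G. k < N}) = card (nongaps_below N G) + card {k \<in> G. k < N}"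
    using assms by (intro card_Un_disjoint) (auto simp: nongaps_below_def)
  moreover have "nongaps_below N G \<union> {k \<in> G. k < N} = {..<N}" by (auto simp: nongaps_below_def)
  ultimately show ?thesis by simp
qed

lemma forced_iff:
  "forced (rev (map (\<lambda>i. i \<notin> G) [1..<k])) \<longleftrightarrow> (\<exists>u v. 0 < u \<and> 0 < v \<and> u \<notin> G \<and> v \<notin> G \<and> k = u + v)"
proof -
  let ?xs = "rev (map (\<lambda>i. i \<notin> G) [1..<k])"
  have nth: "?xs ! i = (k - 1 - i \<notin> G)" "rev ?xs ! i = (i + 1 \<notin> G)" if "i < k - 1" for i
    using that Suc_diff_Suc[of "Suc i" k] by (auto simp: rev_nth)
  have "forced ?xs \<longleftrightarrow> (\<exists>i<k - 1. ?xs ! i \<and> rev ?xs ! i)"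
    unfolding forced_def list_ex_iff set_zip by (auto simp del: rev_rev_ident)
  also have "\<dots> \<longleftrightarrow> (\<exists>i<k - 1. k - 1 - i \<notin> G \<and> i + 1 \<notin> G)" using nth by blast
  also have "\<dots> \<longleftrightarrow> (\<exists>u v. 0 < u \<and> 0 < v \<and> u \<notin> G \<and> v \<notin> G \<and> k = u + v)"
  proof
    assume "\<exists>i<k - 1. k - 1 - i \<notin> G \<and> i + 1 \<notin> G"
    then obtain i where i: "i < k - 1" "k - 1 - i \<notin> G" "i + 1 \<notin> G" by blast
    then show "\<exists>u v. 0 < u \<and> 0 < v \<and> u \<notin> G \<and> v \<notin> G \<and> k = u + v"
      by (intro exI[of _ "k - 1 - i"] exI[of _ "i + 1"]) auto
  next
    assume "\<exists>u v. 0 < u \<and> 0 < v \<and> u \<notin> G \<and> v \<notin> G \<and> k = u + v"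
    then obtain u v where uv: "0 < u" "0 < v" "u \<notin> G" "v \<notin> G" "k = u + v" by blast
    then show "\<exists>i<k - 1. k - 1 - i \<notin> G \<and> i + 1 \<notin> G"
      by (intro exI[of _ "v - 1"]) auto
  qed
  finally show ?thesis .
qed

lemma card_gen_gap_pairs_Suc:
  assumes "k \<in> G"
  shows "card (gen_gap_pairs (Suc k) G) = card (gen_gap_pairs k G) + card {s \<in> generators (- G). s < k}"
proof -
  let ?X = "{s \<in> generators (- G). s < k} \<times> {k}"
  have "gen_gap_pairs (Suc k) G = gen_gap_pairs k G \<union> ?X"
    using assms by (auto simp: gen_gap_pairs_def less_Suc_eq)
  moreover have "gen_gap_pairs k G \<inter> ?X = {}" by (auto simp: gen_gap_pairs_def)
  ultimately have "card (gen_gap_pairs (Suc k) G) = card (gen_gap_pairs k G) + card ?X"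
    by (simp add: card_Un_disjoint)
  then show ?thesis by (simp add: card_cartesian_product)
qed

text \<open>Follows the one branch of the search that spells out \<open>G\<close>, with the true
  counts at position \<open>k\<close> as its arguments. Forced positions are never gaps, unforced
  non-gaps are exactly the generators, and each new gap adds one pair for every generator
  seen.\<close>

lemma search_ok_complete:
  assumes G: "semigroup_gaps G" and h: "card G = h" and k: "1 \<le> k" "k \<le> 2 * h"
    and "search_ok h (rev (map (\<lambda>i. i \<notin> G) [1..<k])) (card {i \<in> G. k \<le> i}) (card {i. i \<notin> G \<and> k \<le> i \<and> i < 2 * h})
        (card {s \<in> generators (- G). s < k}) (card (gen_gap_pairs k G))"
  shows "weight_ok h (rev (map (\<lambda>i. i \<notin> G) [1..<2 * h]))
     (card {s \<in> generators (- G). s < 2 * h}) (card (gen_gap_pairs (2 * h) G))"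
  using k(2,1) assms(5)
proof (induction k rule: inc_induct)
  case base
  have "{i \<in> G. 2 * h \<le> i} = {}" using gap_less[OF G] h by fastforce
  then have a: "card {i \<in> G. 2 * h \<le> i} = 0" by (simp only: card.empty)
  have "{i. i \<notin> G \<and> 2 * h \<le> i \<and> i < 2 * h} = {}" by auto
  then have b: "card {i. i \<notin> G \<and> 2 * h \<le> i \<and> i < 2 * h} = 0" by (simp only: card.empty)
  show ?case using base(2) unfolding a b search_ok.simps(1) .
next
  case (step k)
  have finG: "finite G" using G by (simp add: semigroup_gaps_def)
  let ?xs = "rev (map (\<lambda>i. i \<notin> G) [1..<k])"
  let ?f = "forced ?xs"
  have xs: "rev (map (\<lambda>i. i \<notin> G) [1..<Suc k]) = (k \<notin> G) # ?xs" using step by simp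
  have kpos: "0 < k" using step.prems(1) by simp
  have f_gap: "\<not> ?f" if "k \<in> G" using that G unfolding forced_iff semigroup_gaps_def by metis
  have gen: "k \<in> generators (- G) \<longleftrightarrow> k \<notin> G \<and> \<not> ?f"
    using kpos unfolding generators_def forced_iff by blast
  have gens: "{s \<in> generators (- G). s < Suc k} =
     (if k \<notin> G \<and> \<not> ?f then insert k {s \<in> generators (- G). s < k} else {s \<in> generators (- G). s < k})"
    using gen by (auto simp: less_Suc_eq)
  have IH: "search_ok h ((k \<notin> G) # ?xs) (card {i \<in> G. Suc k \<le> i}) (card {i. i \<notin> G \<and> Suc k \<le> i \<and> i < 2 * h})
        (card {s \<in> generators (- G). s < Suc k}) (card (gen_gap_pairs (Suc k) G)) \<Longrightarrow> ?case"
    using step.IH unfolding xs by simp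
  show ?case
  proof (cases "k \<in> G")
    case True
    have "{i \<in> G. k \<le> i} = insert k {i \<in> G. Suc k \<le> i}" using True by (auto simp: not_less_eq_eq[symmetric] le_Suc_eq)
    then have a: "card {i \<in> G. k \<le> i} = Suc (card {i \<in> G. Suc k \<le> i})" using finG by simp
    have b: "{i. i \<notin> G \<and> k \<le> i \<and> i < 2 * h} = {i. i \<notin> G \<and> Suc k \<le> i \<and> i < 2 * h}"
      using True by (auto simp: Suc_le_eq le_less)
    show ?thesis
    proof (rule IH)
      show "search_ok h ((k \<notin> G) # ?xs) (card {i \<in> G. Suc k \<le> i}) (card {i. i \<notin> G \<and> Suc k \<le> i \<and> i < 2 * h})
        (card {s \<in> generators (- G). s < Suc k}) (card (gen_gap_pairs (Suc k) G))"
        using search_ok_gap[OF step.prems(2)[unfolded a b] f_gap[OF True]] True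
        unfolding card_gen_gap_pairs_Suc[OF True] gens by simp
    qed
  next
    case False
    have a: "{i \<in> G. k \<le> i} = {i \<in> G. Suc k \<le> i}" using False by (auto simp: Suc_le_eq le_less)
    have "{i. i \<notin> G \<and> k \<le> i \<and> i < 2 * h} = insert k {i. i \<notin> G \<and> Suc k \<le> i \<and> i < 2 * h}"
      using False step.hyps by (auto simp: Suc_le_eq le_less)
    moreover have "finite {i. i \<notin> G \<and> Suc k \<le> i \<and> i < 2 * h}" by simp
    ultimately have b: "card {i. i \<notin> G \<and> k \<le> i \<and> i < 2 * h} = Suc (card {i. i \<notin> G \<and> Suc k \<le> i \<and> i < 2 * h})"
      by simp
    have pairs: "gen_gap_pairs (Suc k) G = gen_gap_pairs k G"
      using False by (auto simp: gen_gap_pairs_def less_Suc_eq)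
    have g: "card {s \<in> generators (- G). s < Suc k} =
        (if ?f then card {s \<in> generators (- G). s < k} else Suc (card {s \<in> generators (- G). s < k}))"
      unfolding gens using False by simp
    show ?thesis
    proof (rule IH)
      show "search_ok h ((k \<notin> G) # ?xs) (card {i \<in> G. Suc k \<le> i}) (card {i. i \<notin> G \<and> Suc k \<le> i \<and> i < 2 * h})
        (card {s \<in> generators (- G). s < Suc k}) (card (gen_gap_pairs (Suc k) G))"
        using search_ok_nongap[OF step.prems(2)[unfolded a b]] False unfolding g pairs by simp
    qed
  qed
qed

lemma gap_weight_bounds:
  assumes G: "semigroup_gaps G" and h: "card G = h" "0 < h" "h \<le> 8"
  shows "card (gen_gap_pairs (2 * h) G) < 2 * h"
    and "h \<le> 4 \<Longrightarrow> card (gen_gap_pairs (2 * h) G) < h"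
    and "2 * h - 1 \<in> G \<Longrightarrow> card (gen_gap_pairs (2 * h - 1) G) < h"
proof -
  have finG: "finite G" "0 \<notin> G" using G by (auto simp: semigroup_gaps_def)
  have "{i \<in> G. 1 \<le> i} = G" using finG(2) by (auto simp: Suc_le_eq intro: gr0I)
  then have a: "card {i \<in> G. 1 \<le> i} = h" using h by simp
  have "{i. i \<notin> G \<and> 1 \<le> i \<and> i < 2 * h} = nongaps_below (2 * h) G - {0}" by (auto simp: nongaps_below_def)
  moreover have "card (nongaps_below (2 * h) G) = h"
    using card_nongaps_below[OF finG(1), of "2 * h"] gaps_below_eq[OF G] h(1) by simp
  moreover have "0 \<in> nongaps_below (2 * h) G" using finG h by (auto simp: nongaps_below_def)
  ultimately have b: "card {i. i \<notin> G \<and> 1 \<le> i \<and> i < 2 * h} = h - 1" by simp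
  have g: "{s \<in> generators (- G). s < 1} = {}" by (auto simp: generators_def)
  have w: "gen_gap_pairs 1 G = {}" by (auto simp: gen_gap_pairs_def)
  have ok: "weight_ok h (rev (map (\<lambda>i. i \<notin> G) [1..<2 * h]))
     (card {s \<in> generators (- G). s < 2 * h}) (card (gen_gap_pairs (2 * h) G))"
  proof (rule search_ok_complete[OF G h(1), of 1])
    show "search_ok h (rev (map (\<lambda>i. i \<notin> G) [1..<1])) (card {i \<in> G. 1 \<le> i}) (card {i. i \<notin> G \<and> 1 \<le> i \<and> i < 2 * h})
        (card {s \<in> generators (- G). s < 1}) (card (gen_gap_pairs 1 G))"
      unfolding a b g w using search_ok_upto_8[OF h(2,3)] by simp
  qed (use h(2) in auto)
  then show "card (gen_gap_pairs (2 * h) G) < 2 * h"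
    and "h \<le> 4 \<Longrightarrow> card (gen_gap_pairs (2 * h) G) < h"
    by (auto simp: weight_ok_def)
  assume top: "2 * h - 1 \<in> G"
  define k where "k = 2 * h - 1"
  have k: "2 * h = Suc k" using h(2) by (simp add: k_def)
  have kpos: "1 \<le> k" using h(2) by (simp add: k_def)
  have "\<not> hd (rev (map (\<lambda>i. i \<notin> G) [1..<2 * h]))" using top kpos unfolding k k_def[symmetric] by simp
  then have lt: "card (gen_gap_pairs (Suc k) G) < h + card {s \<in> generators (- G). s < Suc k}"
    using ok unfolding weight_ok_def k by blast
  \<comment> \<open>Shortening the range by the top gap removes exactly one pair per generator,
    turning the bound \<open>h + c\<close> of \<open>weight_ok\<close> into
    \<open>h\<close>.\<close>
  have "card (gen_gap_pairs (Suc k) G) = card (gen_gap_pairs k G) + card {s \<in> generators (- G). s < k}"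
    by (rule card_gen_gap_pairs_Suc) (use top in \<open>simp add: k_def\<close>)
  moreover have "{s \<in> generators (- G). s < Suc k} = {s \<in> generators (- G). s < k}"
    using top unfolding k_def[symmetric] by (auto simp: less_Suc_eq generators_def)
  ultimately show "card (gen_gap_pairs (2 * h - 1) G) < h" using lt unfolding k_def[symmetric] by simp
qed

section \<open>Transfer of local algebras\<close>

lemma loc_series_0: "fps_nth (loc_series b e p i) 0 = hom_eval b e i p"
  by (simp add: loc_series_def hom_eval_def fps_sum_nth fps_mult_nth fps_power_zeroth)

text \<open>Exposes the index hidden in the choice operator of \<open>loc_coord\<close>: all
  coordinate series are one common factor times elements of the local algebra, the form needed for
  \<open>curve_series_exists\<close>.\<close>

lemma loc_coord_pivot:
  assumes "is_morphism n e b" "p \<noteq> (0, 0)"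
  obtains j0 where "j0 \<le> n" "loc_coord n b e p j0 = 1"
    "\<And>i. loc_series b e p i = loc_series b e p j0 * loc_coord n b e p i"
proof -
  define j0 where "j0 = (SOME j. j \<le> n \<and> hom_eval b e j p \<noteq> 0)"
  have "\<exists>j. j \<le> n \<and> hom_eval b e j p \<noteq> 0" using assms unfolding is_morphism_def by blast
  then have j0: "j0 \<le> n \<and> hom_eval b e j0 p \<noteq> 0" unfolding j0_def by (rule someI_ex)
  have lc: "loc_coord n b e p i = loc_series b e p i * inverse (loc_series b e p j0)" for i
    by (simp add: loc_coord_def Let_def j0_def)
  have inv: "inverse (loc_series b e p j0) * loc_series b e p j0 = 1"
    by (rule inverse_mult_eq_1) (use j0 in \<open>simp add: loc_series_0\<close>)
  show ?thesis
  proof (rule that[of j0])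
    show "loc_coord n b e p j0 = 1" using inv lc[of j0] by (simp add: mult.commute)
    show "loc_series b e p i = loc_series b e p j0 * loc_coord n b e p i" for i
    proof -
      have "loc_series b e p j0 * loc_coord n b e p i =
          (inverse (loc_series b e p j0) * loc_series b e p j0) * loc_series b e p i"
        unfolding lc by (simp only: mult_ac)
      then show ?thesis unfolding inv by simp
    qed
  qed (use j0 in simp)
qed

lemma is_subalgebra_loc_alg: "is_subalgebra (loc_alg n b e p)"
  unfolding is_subalgebra_def by (auto intro: loc_alg.intros)

lemma is_subalgebra_compose:
  assumes "is_subalgebra A" "fps_nth h 0 = 0"
  shows "is_subalgebra ((\<lambda>x. x oo h) ` A)"
  unfolding is_subalgebra_def
proof (intro conjI allI ballI)
  show "fps_const c \<in> (\<lambda>x. x oo h) ` A" for c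
    using assms(1) by (intro image_eqI[of _ _ "fps_const c"]) (simp_all add: is_subalgebra_def)
  fix x y assume "x \<in> (\<lambda>x. x oo h) ` A" "y \<in> (\<lambda>x. x oo h) ` A"
  then obtain x' y' where xy: "x' \<in> A" "y' \<in> A" "x = x' oo h" "y = y' oo h" by auto
  show "x + y \<in> (\<lambda>x. x oo h) ` A"
    using assms(1) xy by (intro image_eqI[of _ _ "x' + y'"]) (simp_all add: fps_compose_add_distrib is_subalgebra_def)
  show "x * y \<in> (\<lambda>x. x oo h) ` A"
    using assms xy by (intro image_eqI[of _ _ "x' * y'"]) (simp_all add: fps_compose_mult_distrib is_subalgebra_def)
qed

text \<open>Substituting a series of order 1 is a change of local parameter and preserves orders of
  vanishing.\<close>

lemma value_set_compose:
  assumes "fps_nth h 0 = 0" "fps_nth h 1 \<noteq> 0"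
  shows "value_set ((\<lambda>x. x oo h) ` A) = value_set A"
proof -
  have "h \<noteq> 0" using assms(2) by auto
  have "subdegree h = 1" using assms by (intro subdegreeI) auto
  then have sub: "subdegree (x oo h) = subdegree x" for x using assms(1) by simp
  have nz: "x oo h \<noteq> 0 \<longleftrightarrow> x \<noteq> 0" for x using fps_compose_eq_0_iff[OF assms(1), of x] \<open>h \<noteq> 0\<close> by simp
  show ?thesis unfolding value_set_def
  proof (intro set_eqI iffI)
    fix k assume "k \<in> {subdegree x | x. x \<in> (\<lambda>x. x oo h) ` A \<and> x \<noteq> 0}"
    then obtain x where "x \<in> A" "x oo h \<noteq> 0" "k = subdegree (x oo h)" by blast
    then show "k \<in> {subdegree x | x. x \<in> A \<and> x \<noteq> 0}" using sub nz by auto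
  next
    fix k assume "k \<in> {subdegree x | x. x \<in> A \<and> x \<noteq> 0}"
    then obtain x where x: "x \<in> A" "x \<noteq> 0" "k = subdegree x" by blast
    then have "x oo h \<in> (\<lambda>x. x oo h) ` A" "x oo h \<noteq> 0" "k = subdegree (x oo h)" using sub nz by auto
    then show "k \<in> {subdegree x | x. x \<in> (\<lambda>x. x oo h) ` A \<and> x \<noteq> 0}" by blast
  qed
qed

lemma value_set_loc_alg: "value_set (loc_alg n b e p) = value_semigroup n b e p"
  by (simp add: value_set_def value_semigroup_def)

text \<open>One representative for each point of the projective line, the same ones over which
  \<open>genus_param\<close> sums.\<close>

definition std_points :: "(complex \<times> complex) set" where
  "std_points = insert (1, 0) (range (\<lambda>t. (t, 1)))"

definition local_model :: "nat \<Rightarrow> (nat \<Rightarrow> complex poly) \<Rightarrow> complex \<Rightarrow> nat set \<Rightarrow> complex fps set \<Rightarrow> complex fps \<Rightarrow> (nat \<Rightarrow> complex fps) \<Rightarrow> nat \<Rightarrow> bool" where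
  "local_model n P t S A u f j0 \<longleftrightarrow> is_subalgebra A \<and> value_set A = S \<and> j0 \<le> n \<and> f j0 = 1 \<and>
    (\<forall>i\<le>n. f i \<in> A \<and> fps_of_poly (pcompose (P i) [:t, 1:]) = u * f i)"

text \<open>The local parameter at q is pulled back along the linear fractional map (U : W): up to the
  common factor \<nu>, the point (U, W) near t0 is q + h * dir q for a series h of order 1.\<close>
lemma local_algebra_transfer:
  fixes x1 x0 z1 z0 t0 s :: complex
  assumes b: "is_morphism n e b" and q: "q \<in> std_points"
    and det: "x1 * z0 - x0 * z1 \<noteq> 0" and s: "s \<noteq> 0"
    and U: "x0 + x1 * t0 = s * fst q" and W: "z0 + z1 * t0 = s * snd q"
  shows "\<exists>A u f j0. local_model n (subst_poly b e [:x0, x1:] [:z0, z1:]) t0 (value_semigroup n b e q) A u f j0"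
proof -
  have "\<exists>\<nu> h. fps_nth h 0 = 0 \<and> fps_nth h 1 \<noteq> 0 \<and>
     fps_const (s * fst q) + fps_const x1 * fps_X = \<nu> * (fps_const (fst q) + fps_const (fst (loc_dir q)) * h) \<and>
     fps_const (s * snd q) + fps_const z1 * fps_X = \<nu> * (fps_const (snd q) + fps_const (snd (loc_dir q)) * h)"
  proof (cases "snd q = 0")
    case True
    then have qq: "q = (1, 0)" using q by (auto simp: std_points_def)
    have z1: "z1 \<noteq> 0"
    proof
      assume "z1 = 0"
      then have "z0 = 0" using W qq by simp
      then show False using det \<open>z1 = 0\<close> by simp
    qed
    \<comment> \<open>At infinity the local parameter is W / U, so the common factor is U and h is W
      / U.\<close>
    define L where "L = fps_const s + fps_const x1 * fps_X"
    have "fps_nth L 0 \<noteq> 0" using s by (simp add: L_def)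
    then have inv: "L * inverse L = 1" by (metis inverse_mult_eq_1 mult.commute)
    define h where "h = fps_const z1 * fps_X * inverse L"
    have "fps_nth h 0 = 0" by (simp add: h_def)
    moreover have "fps_nth h 1 \<noteq> 0" using z1 s by (simp add: h_def mult.assoc L_def)
    moreover have "L * h = fps_const z1 * fps_X"
    proof -
      have "L * h = fps_const z1 * fps_X * (L * inverse L)" by (simp add: h_def mult_ac)
      then show ?thesis using inv by simp
    qed
    ultimately show ?thesis unfolding qq by (intro exI[of _ L] exI[of _ h]) (simp add: loc_dir_def L_def)
  next
    case False
    then obtain x where qq: "q = (x, 1)" using q by (auto simp: std_points_def)
    have x0: "x0 = s * x - x1 * t0" and z0: "z0 = s - z1 * t0" using U W qq by (auto simp: eq_diff_eq)
    have "x1 * z0 - x0 * z1 = s * (x1 - x * z1)" unfolding x0 z0 by (simp add: algebra_simps)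
    then have nz: "x1 - x * z1 \<noteq> 0" using det by auto
    \<comment> \<open>At an affine point x the common factor is W, and h is U / W - x; its linear
      coefficient is non-zero by the determinant condition.\<close>
    define L where "L = fps_const s + fps_const z1 * fps_X"
    have "fps_nth L 0 \<noteq> 0" using s by (simp add: L_def)
    then have inv: "L * inverse L = 1" by (metis inverse_mult_eq_1 mult.commute)
    define h where "h = fps_const (x1 - x * z1) * fps_X * inverse L"
    have "fps_nth h 0 = 0" by (simp add: h_def)
    moreover have "fps_nth h 1 \<noteq> 0" using nz s by (simp add: h_def mult.assoc L_def)
    moreover have "L * (fps_const x + h) = fps_const (s * x) + fps_const x1 * fps_X"
    proof -
      have "L * h = fps_const (x1 - x * z1) * fps_X * (L * inverse L)" by (simp add: h_def mult_ac)
      then have "L * (fps_const x + h) = L * fps_const x + fps_const (x1 - x * z1) * fps_X"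
        using inv by (simp add: distrib_left)
      also have "\<dots> = fps_const (s * x) + (fps_const (z1 * x) + fps_const (x1 - x * z1)) * fps_X"
        by (simp add: L_def distrib_right mult_ac flip: fps_const_mult)
      also have "fps_const (z1 * x) + fps_const (x1 - x * z1) = fps_const x1" by (simp add: mult.commute)
      finally show ?thesis .
    qed
    ultimately show ?thesis unfolding qq by (intro exI[of _ L] exI[of _ h]) (simp add: loc_dir_def L_def)
  qed
  then obtain \<nu> h where h: "fps_nth h 0 = 0" "fps_nth h 1 \<noteq> 0"
    and eU: "fps_const (s * fst q) + fps_const x1 * fps_X = \<nu> * (fps_const (fst q) + fps_const (fst (loc_dir q)) * h)"
    and eW: "fps_const (s * snd q) + fps_const z1 * fps_X = \<nu> * (fps_const (snd q) + fps_const (snd (loc_dir q)) * h)"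
    by blast
  have pU: "fps_of_poly (pcompose [:x0, x1:] [:t0, 1:]) = fps_const (s * fst q) + fps_const x1 * fps_X"
    unfolding U[symmetric] by (simp add: pcompose_pCons fps_of_poly_pCons mult_ac)
  have pW: "fps_of_poly (pcompose [:z0, z1:] [:t0, 1:]) = fps_const (s * snd q) + fps_const z1 * fps_X"
    unfolding W[symmetric] by (simp add: pcompose_pCons fps_of_poly_pCons mult_ac)
  have series: "fps_of_poly (pcompose (subst_poly b e [:x0, x1:] [:z0, z1:] i) [:t0, 1:]) =
      \<nu> ^ e * (loc_series b e q i oo h)" for i
  proof -
    let ?u = "fps_const (fst q) + fps_const (fst (loc_dir q)) * h"
    let ?w = "fps_const (snd q) + fps_const (snd (loc_dir q)) * h"
    have "fps_of_poly (pcompose (subst_poly b e [:x0, x1:] [:z0, z1:] i) [:t0, 1:]) =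
        (\<Sum>j\<le>e. fps_const (b (i, j)) * ((\<nu> * ?u) ^ (e - j) * (\<nu> * ?w) ^ j))"
      unfolding eU[symmetric] eW[symmetric] pU[symmetric] pW[symmetric]
      by (simp add: subst_poly_def pcompose_sum pcompose_smult pcompose_mult pcompose_power fps_of_poly_sum
          fps_of_poly_smult fps_of_poly_mult fps_of_poly_power)
    also have "\<dots> = (\<Sum>j\<le>e. \<nu> ^ e * (fps_const (b (i, j)) * ?u ^ (e - j) * ?w ^ j))"
    proof (rule sum.cong[OF refl])
      fix j assume "j \<in> {..e}"
      then have "\<nu> ^ e = \<nu> ^ (e - j) * \<nu> ^ j" by (simp flip: power_add)
      then show "fps_const (b (i, j)) * ((\<nu> * ?u) ^ (e - j) * (\<nu> * ?w) ^ j) =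
          \<nu> ^ e * (fps_const (b (i, j)) * ?u ^ (e - j) * ?w ^ j)"
        by (simp only: power_mult_distrib mult_ac)
    qed
    also have "\<dots> = \<nu> ^ e * (loc_series b e q i oo h)"
      by (simp add: loc_series_def fps_compose_sum_distrib fps_compose_mult_distrib[OF h(1)]
          fps_compose_power[OF h(1), symmetric] fps_compose_add_distrib h(1) sum_distrib_left)
    finally show ?thesis .
  qed
  have "q \<noteq> (0, 0)" using q by (auto simp: std_points_def)
  from loc_coord_pivot[OF b this] obtain j0 where j0: "j0 \<le> n" "loc_coord n b e q j0 = 1"
    "\<And>i. loc_series b e q i = loc_series b e q j0 * loc_coord n b e q i" by blast
  let ?A = "(\<lambda>x. x oo h) ` loc_alg n b e q"
  let ?f = "\<lambda>i. loc_coord n b e q i oo h"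
  let ?u = "\<nu> ^ e * (loc_series b e q j0 oo h)"
  have "is_subalgebra ?A" by (rule is_subalgebra_compose[OF is_subalgebra_loc_alg h(1)])
  moreover have "value_set ?A = value_semigroup n b e q"
    by (simp add: value_set_compose[OF h] value_set_loc_alg)
  moreover have "?f i \<in> ?A" if "i \<le> n" for i using that by (intro imageI la_coord)
  moreover have "fps_of_poly (pcompose (subst_poly b e [:x0, x1:] [:z0, z1:] i) [:t0, 1:]) = ?u * ?f i" for i
    unfolding series by (subst j0(3)) (simp add: fps_compose_mult_distrib[OF h(1)] mult.assoc)
  ultimately show ?thesis using j0(1,2) unfolding local_model_def
    by (intro exI[of _ ?A] exI[of _ ?u] exI[of _ ?f] exI[of _ j0]) auto
qed

section \<open>Singular points and their position relative to infinity\<close>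

lemma semigroup_gaps_value_semigroup:
  assumes "0 < delta_inv n b e p"
  shows "semigroup_gaps (- value_semigroup n b e p)"
proof -
  let ?S = "value_semigroup n b e p"
  \<comment> \<open>A positive cardinality implies finiteness, since \<open>card\<close> of an
    infinite set is 0.\<close>
  have "finite (- ?S)" using assms unfolding delta_inv_def Compl_eq_Diff_UNIV by (rule card_ge_0_finite)
  moreover have "0 \<in> ?S" unfolding value_semigroup_def
    using la_const[of 1] by (intro CollectI exI[of _ "1 :: complex fps"]) simp
  moreover have "u + v \<in> ?S" if "u \<in> ?S" "v \<in> ?S" for u v
  proof -
    from that obtain x y where xy: "x \<in> loc_alg n b e p" "x \<noteq> 0" "u = subdegree x"
      "y \<in> loc_alg n b e p" "y \<noteq> 0" "v = subdegree y" unfolding value_semigroup_def by blast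
    then have "x * y \<in> loc_alg n b e p" "x * y \<noteq> 0" "u + v = subdegree (x * y)" by (auto intro: la_mult)
    then show ?thesis unfolding value_semigroup_def by blast
  qed
  ultimately show ?thesis by (simp add: semigroup_gaps_def)
qed

text \<open>If infinitely many affine points had positive delta invariant, the sum over them would be 0 by
  convention; in that case the point at infinity alone accounts for the genus.\<close>
lemma genus_points:
  assumes "0 < genus_param n b e"
  shows "\<exists>Q. finite Q \<and> Q \<subseteq> std_points \<and> (\<forall>q\<in>Q. 0 < delta_inv n b e q) \<and>
     (\<Sum>q\<in>Q. delta_inv n b e q) = genus_param n b e"
proof -
  let ?D = "delta_inv n b e"
  define T where "T = (if finite {t. ?D (t, 1) \<noteq> 0} then {t. ?D (t, 1) \<noteq> 0} else {})"
  define I where "I = (if ?D (1, 0) \<noteq> 0 then {(1, 0)} else {} :: (complex \<times> complex) set)"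
  have finT: "finite T" by (auto simp: T_def)
  have "(\<Sum>q\<in>(\<lambda>t. (t, 1)) ` T \<union> I. ?D q) = (\<Sum>q\<in>(\<lambda>t. (t, 1)) ` T. ?D q) + (\<Sum>q\<in>I. ?D q)"
    by (rule sum.union_disjoint) (auto simp: finT I_def)
  also have "(\<Sum>q\<in>(\<lambda>t. (t, 1)) ` T. ?D q) = (\<Sum>t\<in>T. ?D (t, 1))"
    by (subst sum.reindex) (auto simp: inj_on_def)
  also have "\<dots> = (\<Sum>t\<in>{t. ?D (t, 1) \<noteq> 0}. ?D (t, 1))" by (auto simp: T_def)
  also have "(\<Sum>q\<in>I. ?D q) = ?D (1, 0)" by (auto simp: I_def)
  finally have "(\<Sum>q\<in>(\<lambda>t. (t, 1)) ` T \<union> I. ?D q) = genus_param n b e"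
    by (simp add: genus_param_def)
  moreover have "\<forall>q\<in>(\<lambda>t. (t, 1)) ` T \<union> I. 0 < ?D q" by (auto simp: T_def I_def split: if_splits)
  moreover have "(\<lambda>t. (t, 1)) ` T \<union> I \<subseteq> std_points" by (auto simp: I_def std_points_def)
  moreover have "finite ((\<lambda>t. (t, 1)) ` T \<union> I)" by (simp add: finT I_def)
  ultimately show ?thesis by (intro exI[of _ "(\<lambda>t. (t, 1)) ` T \<union> I"] conjI)
qed

text \<open>Undoes the substitution u \<mapsto> u + c t, which moves the point at infinity.\<close>
definition unshift :: "complex \<Rightarrow> nat \<Rightarrow> complex fps \<Rightarrow> complex fps" where
  "unshift c d p = (\<Sum>k\<le>d. fps_const (fps_nth p k) * (fps_X ^ k * (1 - fps_const c * fps_X) ^ (d - k)))"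

text \<open>With z = x / (1 - c x), the form x0 + x1 x equals (1 - c x) (x0 + (x1 + c x0) z), and
  likewise for the second form. Homogeneity of degree \<open>d\<close> yields the identity wherever
  1 - c x is non-zero, hence as polynomials.\<close>

lemma unshift_subst_poly:
  "fps_of_poly (subst_poly b d [:x0, x1:] [:z0, z1:] i) =
    unshift c d (fps_of_poly (subst_poly b d [:x0, x1 + c * x0:] [:z0, z1 + c * z0:] i))"
proof -
  let ?P = "subst_poly b d [:x0, x1 + c * x0:] [:z0, z1 + c * z0:] i"
  let ?Q = "\<Sum>k\<le>d. smult (coeff ?P k) ([:0, 1:] ^ k * [:1, - c:] ^ (d - k))"
  have deg: "degree ?P \<le> d"
    using degree_subst_poly[of "[:x0, x1 + c * x0:]" 1 "[:z0, z1 + c * z0:]" b d i] by simp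
  have "subst_poly b d [:x0, x1:] [:z0, z1:] i - ?Q = 0"
  proof (rule poly_eq_0_if_cofinitely_many_roots)
    show "finite {x. 1 - c * x = 0}" using poly_roots_finite[of "[:1, - c:]"] by (simp add: mult.commute)
    fix x assume "x \<notin> {x. 1 - c * x = 0}"
    then have x: "1 - c * x \<noteq> 0" by simp
    define z where "z = x / (1 - c * x)"
    have z: "(1 - c * x) * z = x" using x by (simp add: z_def)
    have "poly ?Q x = (\<Sum>k\<le>d. coeff ?P k * (x ^ k * (1 - c * x) ^ (d - k)))"
      by (simp add: poly_sum mult.commute)
    also have "\<dots> = (\<Sum>k\<le>d. (1 - c * x) ^ d * (coeff ?P k * z ^ k))"
    proof (rule sum.cong[OF refl])
      fix k assume "k \<in> {..d}"
      then have "(1 - c * x) ^ d = (1 - c * x) ^ k * (1 - c * x) ^ (d - k)" by (simp flip: power_add)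
      moreover have "x ^ k = (1 - c * x) ^ k * z ^ k" unfolding power_mult_distrib[symmetric] z ..
      ultimately show "coeff ?P k * (x ^ k * (1 - c * x) ^ (d - k)) = (1 - c * x) ^ d * (coeff ?P k * z ^ k)"
        by (simp only: mult_ac)
    qed
    also have "\<dots> = (1 - c * x) ^ d * (\<Sum>k\<le>d. coeff ?P k * z ^ k)" by (simp add: sum_distrib_left)
    also have "(\<Sum>k\<le>d. coeff ?P k * z ^ k) = poly ?P z"
      unfolding poly_altdef by (rule sum.mono_neutral_right) (use deg in \<open>auto simp: coeff_eq_0\<close>)
    also have "(1 - c * x) ^ d * poly ?P z =
      hom_eval b d i ((1 - c * x) * (x0 + (x1 + c * x0) * z), (1 - c * x) * (z0 + (z1 + c * z0) * z))"
      unfolding hom_eval_scale by (simp add: poly_subst_poly mult.commute)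
    also have "(1 - c * x) * (x0 + (x1 + c * x0) * z) = (1 - c * x) * x0 + (x1 + c * x0) * ((1 - c * x) * z)"
      by (simp add: algebra_simps)
    also have "\<dots> = x0 + x1 * x" unfolding z by (simp add: algebra_simps)
    also have "(1 - c * x) * (z0 + (z1 + c * z0) * z) = (1 - c * x) * z0 + (z1 + c * z0) * ((1 - c * x) * z)"
      by (simp add: algebra_simps)
    also have "\<dots> = z0 + z1 * x" unfolding z by (simp add: algebra_simps)
    finally show "poly (subst_poly b d [:x0, x1:] [:z0, z1:] i - ?Q) x = 0"
      by (simp add: poly_subst_poly mult.commute)
  qed
  then have "subst_poly b d [:x0, x1:] [:z0, z1:] i = ?Q" by simp
  moreover have lin: "fps_of_poly [:1, - c:] = 1 - fps_const c * fps_X"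
    by (simp add: fps_of_poly_pCons flip: fps_const_neg)
  have "fps_of_poly ?Q = unshift c d (fps_of_poly ?P)"
    by (simp only: unshift_def fps_of_poly_sum fps_of_poly_smult fps_of_poly_mult fps_of_poly_power lin
        fps_of_poly_fps_X fps_of_poly_nth)
  ultimately show ?thesis by simp
qed

text \<open>Pigeonhole: by the determinant condition, different \<open>c\<close> put different
  points at infinity, so each point of \<open>Q\<close> excludes at most one of the
  \<open>card Q + 1\<close> candidates. Bounded integers \<open>c\<close> keep the strata finite in
  number.\<close>

lemma exists_shift:
  fixes x1 x0 z1 z0 :: complex
  assumes "finite Q" "Q \<subseteq> std_points" "x1 * z0 - x0 * z1 \<noteq> 0"
  shows "\<exists>c\<le>card Q. \<forall>q\<in>Q. snd q * (x1 + of_nat c * x0) - fst q * (z1 + of_nat c * z0) \<noteq> 0"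
proof (rule ccontr)
  assume "\<not> ?thesis"
  then have "\<forall>c\<in>{..card Q}. \<exists>q\<in>Q. snd q * (x1 + of_nat c * x0) - fst q * (z1 + of_nat c * z0) = 0" by auto
  then obtain h where h: "\<And>c. c \<le> card Q \<Longrightarrow> h c \<in> Q"
    "\<And>c. c \<le> card Q \<Longrightarrow> snd (h c) * (x1 + of_nat c * x0) - fst (h c) * (z1 + of_nat c * z0) = 0" by (metis atMost_iff)
  have "inj_on h {..card Q}"
  proof (rule inj_onI, rule ccontr)
    fix c c' assume cc: "c \<in> {..card Q}" "c' \<in> {..card Q}" "h c = h c'" "c \<noteq> c'"
    define q where "q = h c"
    have e1: "snd q * (x1 + of_nat c * x0) - fst q * (z1 + of_nat c * z0) = 0"
      and e2: "snd q * (x1 + of_nat c' * x0) - fst q * (z1 + of_nat c' * z0) = 0"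
      using h(2)[of c] h(2)[of c'] cc by (auto simp: q_def)
    have "(of_nat c - of_nat c') * (snd q * x0 - fst q * z0) = 0"
    proof -
      have "(of_nat c - of_nat c') * (snd q * x0 - fst q * z0) =
        (snd q * (x1 + of_nat c * x0) - fst q * (z1 + of_nat c * z0)) -
        (snd q * (x1 + of_nat c' * x0) - fst q * (z1 + of_nat c' * z0))"
        by (simp add: algebra_simps)
      then show ?thesis unfolding e1 e2 by simp
    qed
    then have B: "snd q * x0 = fst q * z0" using cc(4) by simp
    have A: "snd q * x1 = fst q * z1"
    proof -
      have "snd q * (x1 + of_nat c * x0) - fst q * (z1 + of_nat c * z0) =
        snd q * x1 - fst q * z1 + of_nat c * (snd q * x0 - fst q * z0)" by (simp add: algebra_simps)
      then show ?thesis using e1 B by simp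
    qed
    have "snd q * (x1 * z0 - x0 * z1) = (snd q * x1) * z0 - (snd q * x0) * z1" by (simp add: algebra_simps)
    also have "\<dots> = 0" unfolding A B by simp
    finally have "snd q * (x1 * z0 - x0 * z1) = 0" .
    moreover have "fst q * (x1 * z0 - x0 * z1) = x1 * (fst q * z0) - x0 * (fst q * z1)" by (simp add: algebra_simps)
    then have "fst q * (x1 * z0 - x0 * z1) = 0" unfolding A[symmetric] B[symmetric] by simp
    ultimately have "q = (0, 0)" using assms(3) by (cases q) auto
    moreover have "q \<in> std_points" using h(1)[of c] cc assms(2) by (auto simp: q_def)
    ultimately show False by (auto simp: std_points_def)
  qed
  then have "card {..card Q} \<le> card Q" using h(1) assms(1) by (intro card_inj_on_le[of h]) auto
  then show False by simp
qed

lemma exists_preimage: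
  fixes x1 x0 z1 z0 :: complex
  assumes q: "q \<in> std_points" and det: "x1 * z0 - x0 * z1 \<noteq> 0" and nz: "snd q * x1 - fst q * z1 \<noteq> 0"
  shows "\<exists>t s. s \<noteq> 0 \<and> x0 + x1 * t = s * fst q \<and> z0 + z1 * t = s * snd q"
proof -
  let ?D = "snd q * x1 - fst q * z1"
  \<comment> \<open>Cramer's rule for the two equations in \<open>t\<close> and \<open>s\<close>;
    the denominator is non-zero because \<open>q\<close> is not the image of infinity.\<close>
  let ?t = "(fst q * z0 - snd q * x0) / ?D" and ?m = "(x1 * z0 - x0 * z1) / ?D"
  have "x0 + x1 * ?t = ?m * fst q" "z0 + z1 * ?t = ?m * snd q"
    using nz by (simp_all add: field_simps)
  moreover have "?m \<noteq> 0" using det nz by simp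
  ultimately show ?thesis by blast
qed

lemma std_points_eqI:
  assumes "q \<in> std_points" "q' \<in> std_points" "s \<noteq> 0" "s' \<noteq> 0"
    "s * fst q = s' * fst q'" "s * snd q = s' * snd q'"
  shows "q = q'"
  using assms by (auto simp: std_points_def)

section \<open>Strata and their dimension counts\<close>

text \<open>Tag 0 names the coefficients of \<open>b\<close>, which also absorb the constant factor;
  tag 1 names those of U (second entry 0) and W (second entry 1).\<close>

definition multiple_cover_map :: "nat \<Rightarrow> nat \<Rightarrow> nat \<Rightarrow> nat \<Rightarrow> (nat \<times> nat \<times> nat \<Rightarrow> complex) \<Rightarrow> coeffs" where
  "multiple_cover_map n d e k y = (\<lambda>(i, j). if i \<le> n \<and> j \<le> d then
     fps_nth (\<Sum>l\<le>e. fps_const (y (0, i, l)) * ((\<Sum>r\<le>k. fps_const (y (1, 0, r)) * fps_X ^ r) ^ (e - l) *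
        (\<Sum>r\<le>k. fps_const (y (1, 1, r)) * fps_X ^ r) ^ l)) (d - j) else 0)"

lemma fps_of_poly_degree_le:
  fixes p :: "complex poly"
  assumes "degree p \<le> k"
  shows "fps_of_poly p = (\<Sum>r\<le>k. fps_const (coeff p r) * fps_X ^ r)"
proof (rule fps_ext)
  fix m
  have "fps_nth (\<Sum>r\<le>k. fps_const (coeff p r) * fps_X ^ r) m = (\<Sum>r\<le>k. if r = m then coeff p r else 0)"
    unfolding fps_sum_nth by (rule sum.cong) (auto simp: fps_X_power_nth)
  then show "fps_nth (fps_of_poly p) m = fps_nth (\<Sum>r\<le>k. fps_const (coeff p r) * fps_X ^ r) m"
    using assms by (simp add: coeff_eq_0)
qed

lemma coeffs_eqI:
  assumes "is_morphism n d a" "\<And>i. i \<le> n \<Longrightarrow> fps_of_poly (aff_poly a d i) = p i"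
  shows "a = (\<lambda>(i, j). if i \<le> n \<and> j \<le> d then fps_nth (p i) (d - j) else 0)"
proof (rule ext, clarify)
  fix i j
  show "a (i, j) = (if i \<le> n \<and> j \<le> d then fps_nth (p i) (d - j) else 0)"
    using assms(1) coeff_aff_poly[of j d a i] assms(2)[of i, symmetric] by (auto simp: is_morphism_def)
qed

lemma poly_covered_multiple_covers:
  assumes "(n + 1) * (e + 1) + 2 * (k + 1) \<le> K"
  shows "poly_covered K {a. is_morphism n d a \<and>
     (\<exists>b U W c. degree U \<le> k \<and> degree W \<le> k \<and> (\<forall>i\<le>n. aff_poly a d i = smult c (subst_poly b e U W i)))}"
    (is "poly_covered K ?S")
proof -
  let ?J = "(\<lambda>(i, l). (0, i, l)) ` ({..n} \<times> {..e}) \<union> (\<lambda>(s, r). (1, s, r)) ` ({..1} \<times> {..k}) :: (nat \<times> nat \<times> nat) set"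
  have fin: "finite ?J" by simp
  have "card ?J \<le> card ((\<lambda>(i, l). (0, i, l)) ` ({..n} \<times> {..e}) :: (nat \<times> nat \<times> nat) set)
      + card ((\<lambda>(s, r). (1, s, r)) ` ({..1} \<times> {..k}) :: (nat \<times> nat \<times> nat) set)" by (rule card_Un_le)
  also have "\<dots> \<le> card ({..n} \<times> {..e}) + card ({..1::nat} \<times> {..k})"
    by (intro add_mono card_image_le) auto
  also have "\<dots> \<le> K" using assms by (simp add: card_cartesian_product)
  finally have card: "card ?J \<le> K" .
  show ?thesis
  proof (rule poly_coveredI[OF fin card, of "multiple_cover_map n d e k"])
    fix ij :: "nat \<times> nat"
    have coord: "polyfun_series (\<lambda>y. fps_const (y i))" for i :: "nat \<times> nat \<times> nat"
      by (rule polyfun_series_const) (rule pf_coord)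
    show "(\<lambda>y. multiple_cover_map n d e k y ij) \<in> polyfun"
    proof (cases "fst ij \<le> n \<and> snd ij \<le> d")
      case True
      then show ?thesis unfolding multiple_cover_map_def case_prod_unfold
        by (simp only: if_True simp_thms) (intro polyfun_series_nth polyfun_series_intros polyfun_series_fixed coord)
    next
      case False
      then show ?thesis unfolding multiple_cover_map_def case_prod_unfold by (simp only: if_False pf_const)
    qed
  next
    fix a assume "a \<in> ?S"
    then obtain b U W c where a: "is_morphism n d a" and UW: "degree U \<le> k" "degree W \<le> k"
      and eq: "\<And>i. i \<le> n \<Longrightarrow> aff_poly a d i = smult c (subst_poly b e U W i)" by blast
    define y :: "nat \<times> nat \<times> nat \<Rightarrow> complex" where "y = (\<lambda>(s, i, l).
       if (s, i, l) \<in> ?J then (if s = 0 then c * b (i, l) else if i = 0 then coeff U l else coeff W l) else 0)"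
    have y0: "y (0, i, l) = c * b (i, l)" if "i \<le> n" "l \<le> e" for i l using that by (auto simp: y_def)
    have yU: "y (1, 0, r) = coeff U r" "y (1, 1, r) = coeff W r" if "r \<le> k" for r
      using that by (auto simp: y_def)
    have "fps_of_poly (aff_poly a d i) =
      (\<Sum>l\<le>e. fps_const (y (0, i, l)) * ((\<Sum>r\<le>k. fps_const (y (1, 0, r)) * fps_X ^ r) ^ (e - l) *
        (\<Sum>r\<le>k. fps_const (y (1, 1, r)) * fps_X ^ r) ^ l))" if i: "i \<le> n" for i
    proof -
      have "(\<Sum>r\<le>k. fps_const (y (1, 0, r)) * fps_X ^ r) = fps_of_poly U"
        "(\<Sum>r\<le>k. fps_const (y (1, 1, r)) * fps_X ^ r) = fps_of_poly W"
        unfolding fps_of_poly_degree_le[OF UW(1)] fps_of_poly_degree_le[OF UW(2)]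
        by (intro sum.cong refl; simp add: yU[unfolded One_nat_def])+
      then show ?thesis unfolding eq[OF i] subst_poly_def
        by (simp add: fps_of_poly_sum fps_of_poly_smult fps_of_poly_mult fps_of_poly_power sum_distrib_left
            y0[OF i] mult.assoc flip: fps_const_mult)
    qed
    from coeffs_eqI[OF a this] have "a = multiple_cover_map n d e k y" by (simp only: multiple_cover_map_def)
    moreover have "\<forall>i. i \<notin> ?J \<longrightarrow> y i = 0" by (simp only: y_def split: prod.split) simp
    ultimately show "\<exists>y. (\<forall>i. i \<notin> ?J \<longrightarrow> y i = 0) \<and> a = multiple_cover_map n d e k y" by blast
  qed
qed

definition cover_map :: "nat \<Rightarrow> nat \<Rightarrow> nat \<Rightarrow> nat \<Rightarrow> (nat \<Rightarrow> nat) \<Rightarrow> (nat \<Rightarrow> nat set) \<Rightarrow> (nat \<Rightarrow> nat) \<Rightarrow> (param \<Rightarrow> complex) \<Rightarrow> coeffs" where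
  "cover_map n d c m N G j0 y = (\<lambda>(i, j). if i \<le> n \<and> j \<le> d then
     fps_nth (unshift (of_nat c) d (curve_series m N G j0 (d + 1 - (\<Sum>l<m. N l)) y i)) (d - j) else 0)"

definition cuspidal_stratum :: "nat \<Rightarrow> nat \<Rightarrow> nat \<Rightarrow> nat \<Rightarrow> (nat \<Rightarrow> nat) \<Rightarrow> (nat \<Rightarrow> nat set) \<Rightarrow> (nat \<Rightarrow> nat) \<Rightarrow> coeffs set" where
  "cuspidal_stratum n d c m N G j0 = cover_map n d c m N G j0 `
     {y. \<forall>i. i \<notin> param_index n m N G j0 (d + 1 - (\<Sum>l<m. N l)) \<longrightarrow> y i = 0}"

text \<open>Per point: its position, the generator coefficients, the jet of the common unit and n
  expansions; then the coefficients of the n + 1 interpolation quotients.\<close>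

definition dim_count :: "nat \<Rightarrow> nat \<Rightarrow> nat \<Rightarrow> (nat \<Rightarrow> nat) \<Rightarrow> (nat \<Rightarrow> nat set) \<Rightarrow> nat" where
  "dim_count n d m N G = (\<Sum>l<m. 1 + card (gen_gap_pairs (N l) (G l)) + N l + n * card (nongaps_below (N l) (G l)))
     + (n + 1) * (d + 1 - (\<Sum>l<m. N l))"

lemma poly_covered_cuspidal_stratum:
  assumes "\<And>l. l < m \<Longrightarrow> j0 l \<le> n" "dim_count n d m N G \<le> K"
  shows "poly_covered K (cuspidal_stratum n d c m N G j0)"
proof (rule poly_coveredI[OF finite_param_index, of n m N G j0 "d + 1 - (\<Sum>l<m. N l)" _ "cover_map n d c m N G j0"])
  show "card (param_index n m N G j0 (d + 1 - (\<Sum>l<m. N l))) \<le> K"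
    by (rule order_trans[OF card_param_index[OF assms(1)] assms(2)[unfolded dim_count_def]])
  have u: "polyfun_series (\<lambda>y. unshift c' d (curve_series m N G j0 M y i))" for c' i M
    unfolding unshift_def
    by (intro polyfun_series_intros polyfun_series_fixed polyfun_series_const
        polyfun_series_nth[OF polyfun_series_curve_series])
  show "(\<lambda>y. cover_map n d c m N G j0 y ij) \<in> polyfun" for ij
  proof (cases "fst ij \<le> n \<and> snd ij \<le> d")
    case True
    then show ?thesis unfolding cover_map_def case_prod_unfold
      by (simp only: if_True simp_thms polyfun_series_nth[OF u])
  next
    case False
    then show ?thesis unfolding cover_map_def case_prod_unfold by (simp only: if_False pf_const)
  qed
qed (auto simp: cuspidal_stratum_def)

lemma unshift_sum:
  "unshift c d (\<Sum>j\<in>A. fps_const (x j) * p j) = (\<Sum>j\<in>A. fps_const (x j) * unshift c d (p j))"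
proof -
  have "fps_const (fps_nth (\<Sum>j\<in>A. fps_const (x j) * p j) k) = (\<Sum>j\<in>A. fps_const (x j) * fps_const (fps_nth (p j) k))" for k
    by (simp add: fps_sum_nth fps_const_sum)
  then have "unshift c d (\<Sum>j\<in>A. fps_const (x j) * p j) =
     (\<Sum>k\<le>d. \<Sum>j\<in>A. fps_const (x j) * (fps_const (fps_nth (p j) k) * (fps_X ^ k * (1 - fps_const c * fps_X) ^ (d - k))))"
    by (simp only: unshift_def sum_distrib_right mult.assoc)
  also have "\<dots> = (\<Sum>j\<in>A. fps_const (x j) * unshift c d (p j))"
    by (subst sum.swap) (simp only: unshift_def sum_distrib_left)
  finally show ?thesis .
qed

lemma nondegenerate_aff_poly:
  assumes "nondegenerate n d a" "(\<Sum>i\<le>n. smult (c i) (aff_poly a d i)) = 0"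
  shows "\<forall>i\<le>n. c i = 0"
proof -
  have "(\<Sum>i\<le>n. c i * a (i, j)) = 0" if "j \<le> d" for j
  proof -
    have "coeff (\<Sum>i\<le>n. smult (c i) (aff_poly a d i)) (d - j) = (\<Sum>i\<le>n. c i * a (i, j))"
      using that by (simp add: coeff_sum coeff_aff_poly)
    then show ?thesis using assms(2) by simp
  qed
  then show ?thesis using assms(1) unfolding nondegenerate_iff by blast
qed

text \<open>For \<open>e < n\<close> the \<open>n + 1\<close> coefficient rows of \<open>b\<close>,
  of length \<open>e + 1\<close>, are dependent, and the dependence carries over to
  \<open>a\<close>.\<close>

lemma degree_ge_if_nondegenerate:
  assumes a: "nondegenerate n d a" and eq: "\<And>i. i \<le> n \<Longrightarrow> aff_poly a d i = smult c0 (subst_poly b e U W i)"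
  shows "n \<le> e"
proof (rule ccontr)
  assume "\<not> n \<le> e"
  then have "card {..e} < card {..n}" by simp
  from exists_kernel_vector[OF _ _ this, of "\<lambda>i j. b (i, j)"] obtain c where
    c: "\<exists>i\<le>n. c i \<noteq> 0" "\<And>j. j \<le> e \<Longrightarrow> (\<Sum>i\<le>n. c i * b (i, j)) = 0" by auto
  have "(\<Sum>i\<le>n. smult (c i) (subst_poly b e U W i)) = (\<Sum>i\<le>n. \<Sum>j\<le>e. smult (c i * b (i, j)) (U ^ (e - j) * W ^ j))"
  proof (rule sum.cong[OF refl])
    fix i
    have "[:c i:] * subst_poly b e U W i = (\<Sum>j\<le>e. [:c i:] * smult (b (i, j)) (U ^ (e - j) * W ^ j))"
      unfolding subst_poly_def by (rule sum_distrib_left)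
    then show "smult (c i) (subst_poly b e U W i) = (\<Sum>j\<le>e. smult (c i * b (i, j)) (U ^ (e - j) * W ^ j))"
      by (simp add: mult.commute)
  qed
  also have "\<dots> = (\<Sum>j\<le>e. smult (\<Sum>i\<le>n. c i * b (i, j)) (U ^ (e - j) * W ^ j))"
    by (subst sum.swap) (simp add: smult_sum)
  also have "\<dots> = 0" using c(2) by simp
  finally have 0: "(\<Sum>i\<le>n. smult (c i) (subst_poly b e U W i)) = 0" .
  have "(\<Sum>i\<le>n. smult (c i) (aff_poly a d i)) = [:c0:] * (\<Sum>i\<le>n. smult (c i) (subst_poly b e U W i))"
    unfolding sum_distrib_left by (rule sum.cong) (auto simp: eq mult.commute)
  then show False using 0 nondegenerate_aff_poly[OF a, of c] c(1) by auto
qed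

text \<open>Here \<open>b\<close> has degree at most half of \<open>d\<close>, which saves enough
  coefficients without any condition on singularities; the genus enters only through
  \<open>2 * g \<le> d + 2\<close>. Writing n = p + 2 and k = l + 2 removes the natural
  subtraction.\<close>

lemma multiple_cover_count:
  fixes n e k g d :: nat
  assumes "3 \<le> n" "n \<le> e" "2 \<le> k" "d = e * k" "2 * g \<le> d + 2"
  shows "(n + 1) * (e + 1) + 2 * (k + 1) + (n - 2) * g \<le> (n + 1) * (d + 1)"
proof -
  obtain p where p: "n = p + 2" using assms(1) by (metis add.commute le_Suc_ex numeral_3_eq_3 Suc_leD numeral_2_eq_2)
  obtain l where l: "k = l + 2" using assms(3) by (metis add.commute le_Suc_ex)
  have "p * (2 * g) \<le> p * (e * (l + 2) + 2)" using assms(4,5) l by (intro mult_le_mono) auto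
  then have 1: "2 * (p * g) \<le> p * (e * l) + 2 * (p * e) + 2 * p" by (simp add: algebra_simps)
  have "1 * l \<le> e * l" using assms(1,2) by (intro mult_le_mono) auto
  then have 2: "l \<le> e * l" by simp
  have 3: "p + 2 \<le> e" "1 \<le> p" using assms(1,2) p by auto
  have "2 * ((n + 1) * (e + 1) + 2 * (k + 1) + (n - 2) * g) =
      2 * (p * e) + 6 * e + 2 * p + 6 + 4 * l + 12 + 2 * (p * g)"
    by (simp add: p l algebra_simps)
  also have "\<dots> \<le> 2 * (p * (e * l)) + 4 * (p * e) + 6 * (e * l) + 12 * e + 2 * p + 6"
    using 1 2 3 by linarith
  also have "\<dots> = 2 * ((n + 1) * (d + 1))" by (simp add: p l assms(4) algebra_simps)
  finally show ?thesis by simp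
qed

text \<open>A point with \<delta> gaps costs (1 + w) + 2 \<delta> + n \<delta>, at most (n + 4)
  \<delta> parameters. The sum (n + 4) g + (n - 2) g equals 2 g (n + 1), exactly the number of
  coefficients replaced by the jets.\<close>

lemma dim_count_full:
  assumes G: "\<And>l. l < m \<Longrightarrow> semigroup_gaps (G l)" "\<And>l. l < m \<Longrightarrow> 0 < card (G l)"
    and g: "(\<Sum>l<m. card (G l)) = g" "g \<le> 8" and n: "2 \<le> n" and d: "2 * g \<le> d + 1"
    and N: "\<And>l. l < m \<Longrightarrow> N l = 2 * card (G l)"
  shows "dim_count n d m N G + (n - 2) * g \<le> (n + 1) * (d + 1)"
proof -
  obtain p where p: "n = p + 2" using n by (metis add.commute le_Suc_ex)
  have sumN: "(\<Sum>l<m. N l) = 2 * g" using N g(1) by (simp flip: sum_distrib_left)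
  have "(\<Sum>l<m. 1 + card (gen_gap_pairs (N l) (G l)) + N l + n * card (nongaps_below (N l) (G l)))
      \<le> (\<Sum>l<m. (n + 4) * card (G l))"
  proof (rule sum_mono)
    fix l assume "l \<in> {..<m}"
    then have l: "l < m" by simp
    have "card (G l) \<le> 8" using member_le_sum[of l "{..<m}" "\<lambda>l. card (G l)"] g l by simp
    then have w: "card (gen_gap_pairs (N l) (G l)) < 2 * card (G l)"
      using gap_weight_bounds(1)[OF G(1)[OF l] refl G(2)[OF l]] N[OF l] by simp
    have "card (nongaps_below (N l) (G l)) = card (G l)"
      using card_nongaps_below[of "G l" "N l"] gaps_below_eq[OF G(1)[OF l]] G(1)[OF l] N[OF l]
      by (simp add: semigroup_gaps_def)
    then show "1 + card (gen_gap_pairs (N l) (G l)) + N l + n * card (nongaps_below (N l) (G l)) \<le> (n + 4) * card (G l)"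
      using w N[OF l] by (simp add: algebra_simps)
  qed
  also have "\<dots> = (n + 4) * g" using g(1) by (simp flip: sum_distrib_left)
  finally have "dim_count n d m N G + (n - 2) * g \<le> (n + 4) * g + (n + 1) * (d + 1 - 2 * g) + (n - 2) * g"
    unfolding dim_count_def sumN by simp
  also have "\<dots> = (n + 1) * (2 * g + (d + 1 - 2 * g))" unfolding p by (simp add: algebra_simps)
  also have "\<dots> = (n + 1) * (d + 1)" using d by simp
  finally show ?thesis .
qed

lemma gen_gap_pairs_mono: "N \<le> N' \<Longrightarrow> card (gen_gap_pairs N G) \<le> card (gen_gap_pairs N' G)"
  by (intro card_mono finite_gen_gap_pairs) (auto simp: gen_gap_pairs_def)

text \<open>When d = 2 g - 2, the jets of order 2 * card (G l) are dependent, so the jet at one point l0 is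
  shortened by one. This loses conditions only if 2 * card (G l0) - 1 is a gap; nondegeneracy then
  forces n < g, which makes up for the loss.\<close>
lemma dim_count_truncated:
  assumes G: "\<And>l. l < m \<Longrightarrow> semigroup_gaps (G l)" "\<And>l. l < m \<Longrightarrow> 0 < card (G l)"
    and g: "(\<Sum>l<m. card (G l)) = g" "g \<le> 8" and n: "2 \<le> n" and d: "2 * g = d + 2"
    and l0: "l0 < m" "\<And>l. l < m \<Longrightarrow> card (G l) \<le> card (G l0)"
    and N: "\<And>l. l < m \<Longrightarrow> N l = (if l = l0 then 2 * card (G l) - 1 else 2 * card (G l))"
    and ng: "n + 1 \<le> (\<Sum>l<m. card (nongaps_below (N l) (G l)))"
  shows "dim_count n d m N G + (n - 2) * g \<le> (n + 1) * (d + 1)"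
proof -
  obtain p where p: "n = p + 2" using n by (metis add.commute le_Suc_ex)
  let ?L = "{..<m} - {l0}"
  have rm: "(\<Sum>l<m. f l) = f l0 + (\<Sum>l\<in>?L. f l)" for f :: "nat \<Rightarrow> nat"
    using l0(1) by (simp add: sum.remove)
  define s where "s = card (G l0)"
  define h where "h = (\<Sum>l\<in>?L. card (G l))"
  have gh: "g = s + h" using g(1) rm[of "\<lambda>l. card (G l)"] by (simp add: s_def h_def)
  have s: "0 < s" "s \<le> 8" using G(2)[OF l0(1)] gh g(2) by (auto simp: s_def)
  \<comment> \<open>Since \<open>l0\<close> has the most gaps and there are at most 8 in all, every
    other point has at most 4, where the sharper bound w < \<delta> is available.\<close>
  have sl: "semigroup_gaps (G l)" "0 < card (G l)" "N l = 2 * card (G l)" "card (G l) \<le> 4"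
     "card (nongaps_below (N l) (G l)) = card (G l)" if "l \<in> ?L" for l
  proof -
    show 1: "semigroup_gaps (G l)" and "0 < card (G l)" and 2: "N l = 2 * card (G l)" using that G N by auto
    have "card (G l) \<le> h" unfolding h_def by (rule member_le_sum) (use that in auto)
    moreover have "card (G l) \<le> s" using l0(2)[of l] that by (simp add: s_def)
    ultimately show "card (G l) \<le> 4" using gh g(2) by linarith
    show "card (nongaps_below (N l) (G l)) = card (G l)"
      using card_nongaps_below[of "G l" "N l"] gaps_below_eq[OF 1] 1 2 by (simp add: semigroup_gaps_def)
  qed
  have wl: "card (gen_gap_pairs (N l) (G l)) < card (G l)" if "l \<in> ?L" for l
    using gap_weight_bounds(2)[OF sl(1)[OF that] refl sl(2)[OF that]] sl(3,4)[OF that] by simp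
  have N0: "N l0 = 2 * s - 1" using N[OF l0(1)] by (simp add: s_def)
  have sg0: "semigroup_gaps (G l0)" "finite (G l0)" using G(1)[OF l0(1)] by (auto simp: semigroup_gaps_def)
  let ?w0 = "card (gen_gap_pairs (N l0) (G l0))" and ?r0 = "card (nongaps_below (N l0) (G l0))"
  have sumN: "(\<Sum>l<m. N l) = d + 1"
  proof -
    have "(\<Sum>l\<in>?L. N l) = 2 * h" unfolding h_def sum_distrib_left by (rule sum.cong) (auto simp: sl)
    then show ?thesis using rm[of N] N0 gh d s by simp
  qed
  have sumr: "(\<Sum>l<m. card (nongaps_below (N l) (G l))) = ?r0 + h"
  proof -
    have "(\<Sum>l\<in>?L. card (nongaps_below (N l) (G l))) = h" unfolding h_def by (rule sum.cong[OF refl]) (rule sl(5))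
    then show ?thesis unfolding rm[of "\<lambda>l. card (nongaps_below (N l) (G l))"] by simp
  qed
  have "(\<Sum>l\<in>?L. 1 + card (gen_gap_pairs (N l) (G l))) \<le> h"
    unfolding h_def by (rule sum_mono) (use wl in \<open>auto simp: Suc_le_eq\<close>)
  then have "(\<Sum>l<m. 1 + card (gen_gap_pairs (N l) (G l))) \<le> 1 + ?w0 + h"
    unfolding rm[of "\<lambda>l. 1 + card (gen_gap_pairs (N l) (G l))"] by simp
  moreover have "dim_count n d m N G = (\<Sum>l<m. 1 + card (gen_gap_pairs (N l) (G l))) + (d + 1) + n * (?r0 + h)"
  proof -
    have "dim_count n d m N G = (\<Sum>l<m. 1 + card (gen_gap_pairs (N l) (G l)) + N l + n * card (nongaps_below (N l) (G l)))"
      unfolding dim_count_def sumN by simp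
    also have "\<dots> = (\<Sum>l<m. 1 + card (gen_gap_pairs (N l) (G l))) + (\<Sum>l<m. N l)
        + n * (\<Sum>l<m. card (nongaps_below (N l) (G l)))"
      by (simp only: sum.distrib sum_distrib_left)
    finally show ?thesis unfolding sumN sumr .
  qed
  ultimately have dc: "dim_count n d m N G \<le> 1 + ?w0 + h + (d + 1) + n * (?r0 + h)" by simp
  have d1: "d + 1 = 2 * s + 2 * h - 1" using d gh by simp
  have below: "?r0 + card {k \<in> G l0. k < 2 * s - 1} = 2 * s - 1"
    using card_nongaps_below[OF sg0(2), of "N l0"] N0 by simp
  show ?thesis
  proof (cases "2 * s - 1 \<in> G l0")
    case True
    \<comment> \<open>The dropped position is a gap, so all \<open>s\<close> non-gaps stay in range
      and no expansion coefficient is saved. The bound \<open>?w0 < s\<close> and the inequality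
      \<open>n + 1 \<le> g\<close> from independence make up for it.\<close>
    have "{k \<in> G l0. k < 2 * s - 1} = G l0 - {2 * s - 1}"
      using gap_less[OF sg0(1)] by (force simp: s_def)
    then have "card {k \<in> G l0. k < 2 * s - 1} = s - 1" using True sg0(2) by (simp add: s_def)
    then have r0: "?r0 = s" using below s by simp
    have w0: "?w0 < s" using gap_weight_bounds(3)[OF sg0(1) s_def[symmetric] s True] N0 by simp
    have ng': "n + 1 \<le> g" using ng unfolding sumr r0 gh .
    have "dim_count n d m N G + (n - 2) * g \<le> g + (d + 1) + n * g + (n - 2) * g"
      using dc w0 unfolding r0 gh by simp
    also have "\<dots> \<le> n * (d + 1) + (d + 1)"
    proof -
      have "n * (d + 1) + n = n * (2 * g)" using d by simp
      then have "n * (d + 1) + n = n * g + n * g" by simp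
      moreover have "n * g = (n - 2) * g + 2 * g" unfolding p by (simp add: algebra_simps)
      ultimately show ?thesis using ng' by linarith
    qed
    finally show ?thesis by simp
  next
    case False
    \<comment> \<open>The dropped position is a non-gap: each of the n expansions loses one
      coefficient, so the general bound \<open>?w0 < 2 * s\<close> is enough.\<close>
    have "{k \<in> G l0. k < 2 * s - 1} = G l0"
    proof -
      have "k < 2 * s - 1" if "k \<in> G l0" for k
      proof -
        have "k < 2 * s" "k \<noteq> 2 * s - 1" using gap_less[OF sg0(1) that] False that by (auto simp: s_def)
        then show ?thesis by linarith
      qed
      then show ?thesis by blast
    qed
    then have "card {k \<in> G l0. k < 2 * s - 1} = s" by (simp add: s_def)
    then have r0: "?r0 = s - 1" using below by simp
    have "?w0 \<le> card (gen_gap_pairs (2 * s) (G l0))" by (rule gen_gap_pairs_mono) (simp add: N0)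
    also have "\<dots> < 2 * s" using gap_weight_bounds(1)[OF sg0(1) s_def[symmetric] s] .
    finally have w0: "?w0 < 2 * s" .
    have "dim_count n d m N G + (n - 2) * g \<le> 2 * g + (d + 1) + n * (g - 1) + (n - 2) * g"
      using dc w0 s(1) unfolding r0 gh by (simp add: Suc_le_eq)
    also have "\<dots> = n * (d + 1) + (d + 1)"
    proof -
      have "n * (d + 1) + n = n * (2 * g)" using d by simp
      then have 1: "n * (d + 1) + n = n * g + n * g" by simp
      have 2: "n * g = (n - 2) * g + 2 * g" unfolding p by (simp add: algebra_simps)
      have "0 < g" using gh s(1) by simp
      then have 3: "n * (g - 1) + n = n * g" by (cases g) auto
      show ?thesis using 1 2 3 by linarith
    qed
    finally show ?thesis by simp
  qed
qed

definition stratum_data :: "nat \<Rightarrow> nat \<Rightarrow> nat \<Rightarrow> (nat \<times> nat \<times> (nat \<Rightarrow> nat) \<times> (nat \<Rightarrow> nat set) \<times> (nat \<Rightarrow> nat)) set" where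
  "stratum_data n d g = {(c, m, N, G, j0). c \<le> g \<and> m \<le> g \<and>
     (\<forall>l. (l \<in> {..<g} \<longrightarrow> N l \<in> {..2 * g}) \<and> (l \<notin> {..<g} \<longrightarrow> N l = 0)) \<and>
     (\<forall>l. (l \<in> {..<g} \<longrightarrow> G l \<in> Pow {..<2 * g}) \<and> (l \<notin> {..<g} \<longrightarrow> G l = {})) \<and>
     (\<forall>l. (l \<in> {..<g} \<longrightarrow> j0 l \<in> {..n}) \<and> (l \<notin> {..<g} \<longrightarrow> j0 l = 0)) \<and>
     dim_count n d m N G + (n - 2) * g \<le> (n + 1) * (d + 1)}"

lemma finite_stratum_data: "finite (stratum_data n d g)"
proof -
  let ?N = "{N. \<forall>l. (l \<in> {..<g} \<longrightarrow> N l \<in> {..2 * g}) \<and> (l \<notin> {..<g} \<longrightarrow> N l = 0)}"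
  let ?G = "{G. \<forall>l. (l \<in> {..<g} \<longrightarrow> G l \<in> Pow {..<2 * g}) \<and> (l \<notin> {..<g} \<longrightarrow> G l = {})}"
  let ?J = "{j0. \<forall>l. (l \<in> {..<g} \<longrightarrow> j0 l \<in> {..n}) \<and> (l \<notin> {..<g} \<longrightarrow> j0 l = 0)}"
  have "finite ({..g} \<times> {..g} \<times> ?N \<times> ?G \<times> ?J)"
    by (intro finite_cartesian_product finite_set_of_finite_funs) auto
  moreover have "stratum_data n d g \<subseteq> {..g} \<times> {..g} \<times> ?N \<times> ?G \<times> ?J"
    unfolding stratum_data_def by blast
  ultimately show ?thesis by (rule rev_finite_subset)
qed

text \<open>When (U : W) has degree 1, \<open>a\<close> is \<open>b\<close> after a linear
  fractional change of parameter and a scaling, so the value semigroups of \<open>b\<close> become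
  conditions on jets of \<open>a\<close> at the preimages of the singular points.\<close>

lemma mem_cuspidal_stratum:
  assumes a: "a \<in> Mnd n d" and b: "is_morphism n d b"
    and det: "x1 * z0 - x0 * z1 \<noteq> 0"
    and eq: "\<And>i. i \<le> n \<Longrightarrow> aff_poly a d i = smult c0 (subst_poly b d [:x0, x1:] [:z0, z1:] i)"
    and g: "genus_param n b d = g" "0 < g" "g \<le> 8" and d: "2 * g \<le> d + 2" and n: "2 \<le> n"
  shows "\<exists>(c, m, N, G, j0)\<in>stratum_data n d g. a \<in> cuspidal_stratum n d c m N G j0"
proof -
  have am: "is_morphism n d a" and an: "nondegenerate n d a" using a by (auto simp: Mnd_def)
  obtain Q where "finite Q \<and> Q \<subseteq> std_points \<and> (\<forall>q\<in>Q. 0 < delta_inv n b d q) \<and>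
     (\<Sum>q\<in>Q. delta_inv n b d q) = g"
    using genus_points[of n b d, unfolded g(1), OF g(2)] by (elim exE)
  then have Q: "finite Q" "Q \<subseteq> std_points" "\<And>q. q \<in> Q \<Longrightarrow> 0 < delta_inv n b d q"
    "(\<Sum>q\<in>Q. delta_inv n b d q) = g" by simp_all
  define m where "m = card Q"
  obtain q where q: "bij_betw q {..<m} Q"
    using ex_bij_betw_nat_finite[OF Q(1)] unfolding m_def lessThan_atLeast0 by blast
  have qQ: "q l \<in> Q" if "l < m" for l using q that by (auto simp: bij_betw_def)
  have qstd: "q l \<in> std_points" if "l < m" for l using qQ[OF that] Q(2) by blast
  define S where "S l = value_semigroup n b d (q l)" for l
  define G where "G l = (if l < m then - S l else {})" for l
  have Gcard: "card (G l) = delta_inv n b d (q l)" if "l < m" for l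
    using that by (simp add: G_def S_def delta_inv_def Compl_eq_Diff_UNIV)
  have G: "semigroup_gaps (G l)" "0 < card (G l)" if "l < m" for l
    using semigroup_gaps_value_semigroup[OF Q(3)[OF qQ[OF that]]] Q(3)[OF qQ[OF that]] Gcard[OF that] that
    by (auto simp: G_def S_def)
  have sumG: "(\<Sum>l<m. card (G l)) = g"
  proof -
    have "(\<Sum>l<m. card (G l)) = (\<Sum>l<m. delta_inv n b d (q l))" by (rule sum.cong) (auto simp: Gcard)
    also have "\<dots> = (\<Sum>x\<in>Q. delta_inv n b d x)" by (rule sum.reindex_bij_betw[OF q])
    finally show ?thesis using Q(4) by simp
  qed
  have m_le: "m \<le> g"
  proof -
    have "(\<Sum>l<m. 1) \<le> (\<Sum>l<m. card (G l))" by (rule sum_mono) (use G(2) in \<open>auto simp: Suc_le_eq\<close>)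
    then show ?thesis using sumG by simp
  qed
  have m_pos: "0 < m" using sumG g(2) by (cases m) auto
  have Gle: "card (G l) \<le> g" if "l < m" for l
    using member_le_sum[of l "{..<m}" "\<lambda>l. card (G l)"] that sumG by simp
  \<comment> \<open>With this shift infinity is not mapped into \<open>Q\<close>, so every singular
    point has an affine preimage \<open>t l\<close> that can serve as an interpolation node.\<close>
  obtain c where c: "c \<le> m"
    "\<And>x. x \<in> Q \<Longrightarrow> snd x * (x1 + of_nat c * x0) - fst x * (z1 + of_nat c * z0) \<noteq> 0"
    using exists_shift[OF Q(1,2) det] unfolding m_def by blast
  define x1' where "x1' = x1 + of_nat c * x0"
  define z1' where "z1' = z1 + of_nat c * z0"
  have det': "x1' * z0 - x0 * z1' \<noteq> 0"
  proof -
    have "x1' * z0 - x0 * z1' = x1 * z0 - x0 * z1" by (simp add: x1'_def z1'_def algebra_simps)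
    then show ?thesis using det by simp
  qed
  define P where "P i = smult c0 (subst_poly b d [:x0, x1':] [:z0, z1':] i)" for i
  have aP: "fps_of_poly (aff_poly a d i) = unshift (of_nat c) d (fps_of_poly (P i))" if "i \<le> n" for i
  proof -
    have "fps_of_poly (aff_poly a d i) = fps_const c0 * unshift (of_nat c) d (fps_of_poly (subst_poly b d [:x0, x1':] [:z0, z1':] i))"
      unfolding eq[OF that] fps_of_poly_smult x1'_def z1'_def unshift_subst_poly[of b d x0 x1 z0 z1 i "of_nat c"] ..
    also have "\<dots> = unshift (of_nat c) d (fps_of_poly (P i))"
      using unshift_sum[of "of_nat c" d "\<lambda>_. c0" "\<lambda>_. fps_of_poly (subst_poly b d [:x0, x1':] [:z0, z1':] i)" "{()}"]
      by (simp add: P_def fps_of_poly_smult)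
    finally show ?thesis .
  qed
  have "\<forall>l. \<exists>t s. l < m \<longrightarrow> s \<noteq> 0 \<and> x0 + x1' * t = s * fst (q l) \<and> z0 + z1' * t = s * snd (q l)"
    using exists_preimage[OF qstd det'] c(2)[OF qQ] unfolding x1'_def z1'_def by blast
  then obtain t s where t: "\<And>l. l < m \<Longrightarrow> s l \<noteq> 0" "\<And>l. l < m \<Longrightarrow> x0 + x1' * t l = s l * fst (q l)"
    "\<And>l. l < m \<Longrightarrow> z0 + z1' * t l = s l * snd (q l)" by metis
  have inj: "inj_on t {..<m}"
  proof (rule inj_onI)
    fix k l assume kl: "k \<in> {..<m}" "l \<in> {..<m}" "t k = t l"
    then have k: "k < m" and l: "l < m" by auto
    have "q k = q l"
      by (rule std_points_eqI[OF qstd[OF k] qstd[OF l] t(1)[OF k] t(1)[OF l]])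
        (use t(2,3)[OF k] t(2,3)[OF l] kl(3) in auto)
    then show "k = l" using q kl by (auto simp: bij_betw_def inj_on_def)
  qed
  have "\<forall>l. \<exists>A u f j0. l < m \<longrightarrow> local_model n (subst_poly b d [:x0, x1':] [:z0, z1':]) (t l) (S l) A u f j0"
    using local_algebra_transfer[OF b qstd det' t] unfolding S_def by blast
  then obtain A u f j1 where
    "\<And>l. l < m \<Longrightarrow> local_model n (subst_poly b d [:x0, x1':] [:z0, z1':]) (t l) (S l) (A l) (u l) (f l) (j1 l)" by metis
  then have A: "is_subalgebra (A l)" "value_set (A l) = S l" "j1 l \<le> n" "f l (j1 l) = 1"
    and f: "\<And>i. i \<le> n \<Longrightarrow> f l i \<in> A l" "\<And>i. i \<le> n \<Longrightarrow>
      fps_of_poly (pcompose (subst_poly b d [:x0, x1':] [:z0, z1':] i) [:t l, 1:]) = u l * f l i" if "l < m" for l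
    using that unfolding local_model_def by blast+
  define j0 where "j0 l = (if l < m then j1 l else 0)" for l
  \<comment> \<open>Kept general in the jet lengths because two choices follow. If they exhaust all
    \<open>d + 1\<close> coefficients, nothing remains for a quotient and independence of the
    coordinates bounds n.\<close>
  have member: "a \<in> cuspidal_stratum n d c m N G j0 \<and>
      ((\<Sum>l<m. N l) = d + 1 \<longrightarrow> n + 1 \<le> (\<Sum>l<m. card (nongaps_below (N l) (G l))))"
    if N: "\<And>l. l < m \<Longrightarrow> 0 < N l" and sumN: "(\<Sum>l<m. N l) \<le> d + 1" for N
  proof -
    let ?M = "d + 1 - (\<Sum>l<m. N l)"
    have "\<exists>y. (\<forall>i. i \<notin> param_index n m N G j0 ?M \<longrightarrow> y i = 0) \<and> (\<forall>j\<le>n. fps_of_poly (P j) = curve_series m N G j0 ?M y j)"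
    proof (rule curve_series_exists[OF _ N sumN inj, where A = A and u = "\<lambda>l. fps_const c0 * u l" and f = f])
      show "degree (P j) \<le> d" for j
      proof -
        have "degree (P j) \<le> degree (subst_poly b d [:x0, x1':] [:z0, z1':] j)"
          unfolding P_def by (rule degree_smult_le)
        also have "\<dots> \<le> d * 1" by (rule degree_subst_poly) auto
        finally show ?thesis by simp
      qed
      show "value_set (A l) = - G l" if "l < m" for l using A(2)[OF that] that by (simp add: G_def)
      show "fps_of_poly (pcompose (P j) [:t l, 1:]) = fps_const c0 * u l * f l j" if "l < m" "j \<le> n" for l j
        using f(2)[OF that] by (simp add: P_def pcompose_smult fps_of_poly_smult mult.assoc)
      show "f l (j0 l) = 1" if "l < m" for l using A(4)[OF that] that by (simp add: j0_def)
    qed (use A(1) f(1) in auto)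
    then obtain y where y: "\<forall>i. i \<notin> param_index n m N G j0 ?M \<longrightarrow> y i = 0"
      "\<And>j. j \<le> n \<Longrightarrow> fps_of_poly (P j) = curve_series m N G j0 ?M y j" by blast
    have "a = cover_map n d c m N G j0 y" unfolding cover_map_def
      by (rule coeffs_eqI[OF am]) (simp add: aP y(2))
    then have mem: "a \<in> cuspidal_stratum n d c m N G j0" unfolding cuspidal_stratum_def using y(1) by blast
    have "n + 1 \<le> (\<Sum>l<m. card (nongaps_below (N l) (G l)))" if full: "(\<Sum>l<m. N l) = d + 1"
    proof (rule curve_series_independent_le[where P = P and ?j0.0 = j0 and y = y])
      show "fps_of_poly (P j) = curve_series m N G j0 0 y j" if "j \<le> n" for j using y(2)[OF that] full by simp
      show "0 \<notin> G l" if "l < m" for l using G(1)[OF that] by (simp add: semigroup_gaps_def)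
      fix x assume x: "(\<Sum>j\<le>n. smult (x j) (P j)) = 0"
      have "fps_of_poly (\<Sum>j\<le>n. smult (x j) (aff_poly a d j)) =
          unshift (of_nat c) d (\<Sum>j\<le>n. fps_const (x j) * fps_of_poly (P j))"
        unfolding unshift_sum fps_of_poly_sum fps_of_poly_smult by (rule sum.cong) (auto simp: aP)
      also have "(\<Sum>j\<le>n. fps_const (x j) * fps_of_poly (P j)) = fps_of_poly (\<Sum>j\<le>n. smult (x j) (P j))"
        by (simp add: fps_of_poly_sum fps_of_poly_smult)
      finally have "fps_of_poly (\<Sum>j\<le>n. smult (x j) (aff_poly a d j)) = fps_of_poly 0"
        unfolding x by (simp add: unshift_def)
      then have "(\<Sum>j\<le>n. smult (x j) (aff_poly a d j)) = 0" unfolding fps_of_poly_eq_iff .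
      then show "\<forall>j\<le>n. x j = 0" by (rule nondegenerate_aff_poly[OF an])
    qed (rule N)
    with mem show ?thesis by blast
  qed
  have data: "(c, m, N, G, j0) \<in> stratum_data n d g"
    if "\<And>l. l < m \<Longrightarrow> N l \<le> 2 * card (G l)" "\<And>l. \<not> l < m \<Longrightarrow> N l = 0"
      "dim_count n d m N G + (n - 2) * g \<le> (n + 1) * (d + 1)" for N
  proof -
    have "N l \<le> 2 * g" for l
      using that(1)[of l] that(2)[of l] Gle[of l] by (cases "l < m") auto
    moreover have "G l \<subseteq> {..<2 * g}" for l
    proof (cases "l < m")
      case True
      then show ?thesis using gap_less[OF G(1)[OF True]] Gle[OF True] by force
    qed (simp add: G_def)
    moreover have "j0 l \<le> n" for l using A(3)[of l] by (simp add: j0_def)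
    moreover have "N l = 0 \<and> G l = {} \<and> j0 l = 0" if "\<not> l < g" for l
      using that m_le \<open>\<And>l. \<not> l < m \<Longrightarrow> N l = 0\<close>[of l] by (auto simp: G_def j0_def)
    ultimately show ?thesis unfolding stratum_data_def using c(1) m_le that(3) by simp
  qed
  show ?thesis
  \<comment> \<open>Jets of total length \<open>2 * g\<close> fit into polynomials of degree at most
    \<open>d\<close> only in the first case; the second leaves exactly
    \<open>2 * g = d + 2\<close>.\<close>
  proof (cases "2 * g \<le> d + 1")
    case True
    define N where "N l = 2 * card (G l)" for l
    have "(\<Sum>l<m. N l) = 2 * g" by (simp add: N_def sumG flip: sum_distrib_left)
    then have "a \<in> cuspidal_stratum n d c m N G j0" using member[of N] G(2) True by (simp add: N_def)
    moreover have "dim_count n d m N G + (n - 2) * g \<le> (n + 1) * (d + 1)"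
      by (rule dim_count_full[OF G sumG g(3) n True]) (simp_all add: N_def)
    then have "(c, m, N, G, j0) \<in> stratum_data n d g" by (intro data) (auto simp: N_def G_def)
    ultimately show ?thesis by blast
  next
    case False
    then have d2: "2 * g = d + 2" using d by simp
    obtain l0 where l0: "l0 < m" "\<And>l. l < m \<Longrightarrow> card (G l) \<le> card (G l0)"
    proof -
      let ?C = "(\<lambda>l. card (G l)) ` {..<m}"
      have "Max ?C \<in> ?C" using m_pos by (intro Max_in) auto
      then obtain l0 where l0: "Max ?C = card (G l0)" "l0 \<in> {..<m}" by (rule imageE)
      show ?thesis
      proof (rule that[of l0])
        show "card (G l) \<le> card (G l0)" if "l < m" for l
          unfolding l0(1)[symmetric] by (rule Max_ge) (use that in auto)
      qed (use l0 in simp)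
    qed
    define N where "N l = (if l = l0 then 2 * card (G l) - 1 else 2 * card (G l))" for l
    have "(\<Sum>l<m. N l) + 1 = (\<Sum>l<m. 2 * card (G l))"
    proof -
      have "(\<Sum>l<m. 2 * card (G l)) = (\<Sum>l<m. N l + (if l = l0 then 1 else 0))"
        by (rule sum.cong) (use G(2) in \<open>auto simp: N_def\<close>)
      then show ?thesis using l0(1) by (simp add: sum.distrib)
    qed
    then have sumN: "(\<Sum>l<m. N l) = d + 1" using d2 sumG by (simp flip: sum_distrib_left)
    have Npos: "0 < N l" if "l < m" for l using G(2)[OF that] by (cases "l = l0") (auto simp: N_def)
    note mem = member[of N, OF Npos]
    have "dim_count n d m N G + (n - 2) * g \<le> (n + 1) * (d + 1)"
      by (rule dim_count_truncated[OF G sumG g(3) n d2 l0]) (use mem sumN in \<open>auto simp: N_def\<close>)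
    then have "(c, m, N, G, j0) \<in> stratum_data n d g"
      by (intro data) (auto simp: N_def G_def)
    moreover have "a \<in> cuspidal_stratum n d c m N G j0" using mem sumN by simp
    ultimately show ?thesis by blast
  qed
qed

lemma linear_poly_eq: "degree p \<le> 1 \<Longrightarrow> p = [:coeff p 0, coeff p 1:]" for p :: "complex poly"
  by (rule poly_eqI) (auto simp: coeff_pCons coeff_eq_0 split: nat.splits)

text \<open>Factor through the normalization and cover by a disjoint sum of two finite families:
  multiple covers, labelled by the degrees (e, k), and reparametrized injective curves, labelled by
  \<open>stratum_data\<close>.\<close>

lemma zdim_unibranch_locus_le:
  assumes n: "3 \<le> n" and nd: "n \<le> d" and g: "0 < g" "g \<le> 8" and d: "2 * g \<le> d + 2"
  shows "zdim (unibranch_locus n d g) + int ((n - 2) * g) \<le> int ((n + 1) * (d + 1))"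
proof -
  define K where "K = (n + 1) * (d + 1) - (n - 2) * g"
  define MC where "MC = (\<lambda>(e, k). {a. is_morphism n d a \<and>
     (\<exists>b U W c. degree U \<le> k \<and> degree W \<le> k \<and> (\<forall>i\<le>n. aff_poly a d i = smult c (subst_poly b e U W i)))})"
  define C1 where "C1 = {(e, k). e \<le> d \<and> k \<le> d \<and> (n + 1) * (e + 1) + 2 * (k + 1) + (n - 2) * g \<le> (n + 1) * (d + 1)}"
  define T where "T = case_sum MC (\<lambda>(c, m, N, G, j0). cuspidal_stratum n d c m N G j0)"
  define C where "C = C1 <+> stratum_data n d g"
  have "C1 \<subseteq> {..d} \<times> {..d}" by (auto simp: C1_def)
  then have "finite C1" by (rule finite_subset) simp
  then have finC: "finite C" by (simp add: C_def finite_stratum_data)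
  \<comment> \<open>Ensures that the natural subtraction in \<open>K\<close> does not
    truncate.\<close>
  have le: "(n - 2) * g \<le> (n + 1) * (d + 1)"
    by (rule mult_le_mono) (use g d in auto)
  have cov: "poly_covered K (T x)" if "x \<in> C" for x
  proof (cases x)
    case (Inl ek)
    obtain e k where ek: "ek = (e, k)" by (cases ek)
    have bound: "(n + 1) * (e + 1) + 2 * (k + 1) \<le> K" using that Inl ek by (auto simp: C_def C1_def K_def)
    have "poly_covered K (MC (e, k))"
      unfolding MC_def prod.case by (rule poly_covered_multiple_covers[OF bound])
    then show ?thesis by (simp add: T_def Inl ek)
  next
    case (Inr x')
    obtain c m N G j0 where x': "x' = (c, m, N, G, j0)" by (cases x') auto
    have mem: "(c, m, N, G, j0) \<in> stratum_data n d g" using that Inr x' by (auto simp: C_def)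
    then have "j0 l \<le> n" if "l < m" for l using that by (auto simp: stratum_data_def)
    moreover have "dim_count n d m N G \<le> K" using mem by (auto simp: stratum_data_def K_def)
    ultimately have "poly_covered K (cuspidal_stratum n d c m N G j0)" by (rule poly_covered_cuspidal_stratum)
    then show ?thesis by (simp add: T_def Inr x')
  qed
  have "unibranch_locus n d g \<subseteq> (\<Union>x\<in>C. T x)"
  proof
    fix a assume "a \<in> unibranch_locus n d g"
    then obtain e b where aM: "a \<in> Mnd n d" and b: "is_morphism n e b" "injective_morphism n e b"
      and im: "same_image n d a e b" and gen: "genus_param n b e = g" and e1: "1 \<le> e"
      unfolding unibranch_locus_def by blast
    have am: "is_morphism n d a" "nondegenerate n d a" using aM by (auto simp: Mnd_def)
    have cov': "\<exists>q. q \<noteq> (0, 0) \<and> proportional n (\<lambda>i. hom_eval a d i p) (\<lambda>i. hom_eval b e i q)" if "p \<noteq> (0, 0)" for p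
      using im that unfolding same_image_def by blast
    have "1 \<le> n" using n by simp
    from factor_through_injective[OF this am b cov'] obtain U W k c where
      UW: "coprime U W" "degree U \<le> k" "degree W \<le> k" "(coeff U k, coeff W k) \<noteq> (0, 0)" and c: "c \<noteq> 0"
      and eq: "\<And>i. i \<le> n \<Longrightarrow> aff_poly a d i = smult c (subst_poly b e U W i)" and de: "d = e * k" by blast
    have ne: "n \<le> e" by (rule degree_ge_if_nondegenerate[OF am(2) eq])
    have "k \<noteq> 0" using de n nd by (cases k) auto
    then consider "k = 1" | "2 \<le> k" by linarith
    then show "a \<in> (\<Union>x\<in>C. T x)"
    proof cases
      case 1
      have ed: "e = d" using de 1 by simp
      obtain x1 x0 z1 z0 where U: "U = [:x0, x1:]" and W: "W = [:z0, z1:]"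
        using linear_poly_eq[OF UW(2)[unfolded 1]] linear_poly_eq[OF UW(3)[unfolded 1]] by blast
      \<comment> \<open>A vanishing determinant would give the linear forms U and W a common affine
        root, against coprimality; a common zero at infinity is excluded by their top
        coefficients.\<close>
      have det: "x1 * z0 - x0 * z1 \<noteq> 0"
      proof
        assume det0: "x1 * z0 - x0 * z1 = 0"
        have "x1 \<noteq> 0 \<or> z1 \<noteq> 0" using UW(4) 1 U W by auto
        then obtain t where "poly U t = 0 \<and> poly W t = 0"
        proof
          assume "x1 \<noteq> 0"
          then have "poly U (- x0 / x1) = 0 \<and> poly W (- x0 / x1) = 0" using det0 by (simp add: U W field_simps)
          then show ?thesis by (rule that)
        next
          assume "z1 \<noteq> 0"
          then have "poly U (- z0 / z1) = 0 \<and> poly W (- z0 / z1) = 0" using det0 by (simp add: U W field_simps)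
          then show ?thesis by (rule that)
        qed
        then show False using UW(1) coprime_poly_0 by blast
      qed
      have "\<exists>(c, m, N, G, j0)\<in>stratum_data n d g. a \<in> cuspidal_stratum n d c m N G j0"
        by (rule mem_cuspidal_stratum[OF aM b(1)[unfolded ed] det])
          (use eq U W ed gen g d n in auto)
      then obtain x where "x \<in> stratum_data n d g" "a \<in> T (Inr x)" by (auto simp: T_def)
      then show ?thesis by (auto simp: C_def)
    next
      case 2
      have "(e, k) \<in> C1"
        unfolding C1_def using multiple_cover_count[OF n ne 2 de d] de e1 2 by auto
      moreover have "a \<in> MC (e, k)" unfolding MC_def using am(1) UW(2,3) eq by auto
      ultimately show ?thesis by (auto simp: C_def T_def intro!: bexI[of _ "Inl (e, k)"])
    qed
  qed
  from zdim_le[OF finC cov this] have "zdim (unibranch_locus n d g) \<le> int K" .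
  then show ?thesis using le unfolding K_def by (simp add: of_nat_diff)
qed

theorem theorem1p1:
  fixes n d g :: nat
  assumes "1 \<le> n" and "1 \<le> d" and "0 < g" and "g \<le> 8"
    and "n \<le> d" and "2 * int g - 2 \<le> int d"
  shows "zdim (Mnd n d) - zdim (unibranch_locus n d g) \<ge> (int n - 2) * int g"
proof (cases "3 \<le> n")
  case True
  have "int (n - 2) = int n - 2" using True by simp
  then have "int ((n - 2) * g) = (int n - 2) * int g" by simp
  moreover have "zdim (unibranch_locus n d g) + int ((n - 2) * g) \<le> int ((n + 1) * (d + 1))"
    by (rule zdim_unibranch_locus_le) (use assms True in auto)
  ultimately show ?thesis using zdim_Mnd[OF assms(1,5)] by linarith
next
  case False
  \<comment> \<open>For n at most 2 the claimed bound is not positive, so it suffices that the locus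
    lies in the coefficient space, whose dimension is that of \<open>Mnd\<close>.\<close>
  let ?I = "{..n} \<times> {..d}"
  have "zdim (unibranch_locus n d g) \<le> int (card ?I)"
  proof (rule zdim_le[of "{()}" _ "\<lambda>_. supported_on ?I"])
    show "poly_covered (card ?I) (supported_on ?I)" by (rule poly_covered_supported_on) simp
    show "unibranch_locus n d g \<subseteq> (\<Union>c\<in>{()}. supported_on ?I)"
      by (auto simp: unibranch_locus_def Mnd_def is_morphism_def supported_on_def)
  qed simp
  then have "zdim (unibranch_locus n d g) \<le> zdim (Mnd n d)"
    by (simp add: zdim_Mnd[OF assms(1,5)] card_cartesian_product)
  moreover have "(int n - 2) * int g \<le> 0" using False by (intro mult_nonpos_nonneg) auto
  ultimately show ?thesis by linarith
qed

end
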